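(* Let $G$ be a finitely generated weakly branch group, and let $$1\longrightarrow G\longrightarrow\Gamma\overset{q}{\longrightarrow}F\longrightarrow 1$$ be a short exact sequence with $F$ finite. Let $\mu\colon F\to\operatorname{Out}(G)$ be the monodromy homomorphism induced by conjugation in $\Gamma$, and let $\pi\colon\operatorname{Aut}(G)\to\operatorname{Out}(G)$ be the natural quotient map. Conjugation induces a surjective homomorphism $\rho\colon\Gamma\to\pi^{-1}(\mu(F))\leq\operatorname{Aut}(G)$ whose kernel is naturally isomorphic to $\ker(\mu)$. Consequently, the following are equivalent: (i) the monodromy homomorphism $\mu$ is injective; (ii) the homomorphism $\rho$ is an isomorphism (onto $\pi^{-1}(\mu(F))$); (iii) the group $\Gamma$ is weakly branch. If $G$ is branch, these conditions are also equivalent to: (iv) the group $\Gamma$ is branch. Whenever these conditions hold, every faithful weakly branch action $G\curvearrowright T$ gives rise to a weakly branch action $\Gamma\curvearrowright\widehat T$ (via $\rho$ and the action of $\operatorname{Aut}(G)$ on $\widehat T$), where $\widehat T$ is the automorphism-invariant refinement of $T$. In fact $G\curvearrowright T$ is branch if and only if $\Gamma\curvearrowright\widehat T$ is branch.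
   Context: Rooted trees are locally finite and have no leaves. For a rooted tree $T$ with root $o$, $T_n$ is the set of vertices at distance $n$ from $o$, and $T_v$ is the subtree of $v$ and its descendants. $\operatorname{Aut}(T)$ is the group of graph automorphisms fixing $o$. The boundary $\partial T$ is the space of infinite non-backtracking rays from $o$, with basis the cylinders $\operatorname{Cyl}(v)$ (rays through $v$); $|\xi\wedge\eta|$ is the length of the maximal common initial segment of $\xi,\eta\in\partial T$ ($\infty$ if $\xi=\eta$). For $G\le\operatorname{Aut}(T)$: $\operatorname{Rist}_G(v)=\{g\in G: gw=w\text{ for all }w\notin T_v\}$ and $\operatorname{Rist}_G(n)=\langle\operatorname{Rist}_G(v):v\in T_n\rangle$. $G$ is weakly branch on $T$ if it is transitive on each $T_n$ and $\operatorname{Rist}_G(v)\neq1$ for every vertex $v$; $G$ is branch on $T$ if it is transitive on each $T_n$ and $[G:\operatorname{Rist}_G(n)]<\infty$ for all $n\geq0$. An abstract group is called weakly branch (resp. branch) if it admits a faithful weakly branch (resp. branch) action on some locally finite rooted tree without leaves. The map $\rho$ sends $\gamma$ to the automorphism $g\mapsto\gamma g\gamma^{-1}$ of $G$, and $\mu(\gamma G)$ is its class in $\operatorname{Out}(G)$. Canonical boundary action (known theorem of Lavreniuk and Nekrashevych): if $G\le\operatorname{Aut}(T)$ is weakly branch, each $\alpha\in\operatorname{Aut}(G)$ corresponds to a unique homeomorphism $\xi\mapsto\alpha\cdot\xi$ of $\partial T$ with $\alpha\cdot(g\xi)=\alpha(g)(\alpha\cdot\xi)$ for all $g\in G,\xi\in\partial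 T$, and this is a faithful action of $\operatorname{Aut}(G)$. The tree $\widehat T$: for a finitely generated $G\le\operatorname{Aut}(T)$ that is weakly branch on $T$, put $\widehat c(\xi,\eta)=\inf_{\alpha\in\operatorname{Aut}(G)}|(\alpha\cdot\xi)\wedge(\alpha\cdot\eta)|$ for $\xi,\eta\in\partial T$. The relation $\widehat c(\xi,\eta)\ge n$ is an equivalence relation on $\partial T$ with finitely many classes, all clopen. $\widehat T$ is the locally finite rooted tree whose level-$n$ vertices are these classes, each level-$(n+1)$ class being adjacent to the level-$n$ class containing it. $\widehat c$ is $\operatorname{Aut}(G)$-invariant, so $\operatorname{Aut}(G)$ acts on $\widehat T$ by rooted automorphisms by permuting the classes. *)

theory Defs
  imports
    "HOL-Algebra.Algebra"
    "HOL-Analysis.Abstract_Topology"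
    "HOL-Library.Extended_Nat"
begin

section \<open>Rooted trees\<close>

record 'v rooted_graph =
  verts :: "'v set"
  adj :: "'v \<Rightarrow> 'v \<Rightarrow> bool"
  root :: 'v

definition walk :: "'v rooted_graph \<Rightarrow> 'v list \<Rightarrow> bool" where
  "walk T p \<longleftrightarrow> p \<noteq> [] \<and> set p \<subseteq> verts T \<and> successively (adj T) p"

text \<open>The distance of a vertex from the root; a walk with \<open>n + 1\<close> vertices has length \<open>n\<close>.\<close>

definition depth :: "'v rooted_graph \<Rightarrow> 'v \<Rightarrow> nat" where
  "depth T v = (LEAST n. \<exists>p. walk T p \<and> hd p = root T \<and> last p = v \<and> length p = Suc n)"

definition level :: "'v rooted_graph \<Rightarrow> nat \<Rightarrow> 'v set" where
  "level T n = {v \<in> verts T. depth T v = n}"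

definition child_rel :: "'v rooted_graph \<Rightarrow> ('v \<times> 'v) set" where
  "child_rel T = {(u, v). u \<in> verts T \<and> v \<in> verts T \<and> adj T u v \<and> depth T v = Suc (depth T u)}"

definition subtree :: "'v rooted_graph \<Rightarrow> 'v \<Rightarrow> 'v set" where
  "subtree T v = {w. (v, w) \<in> (child_rel T)\<^sup>*}"

text \<open>
  Being leafless means that every vertex has a child. The root may well have degree one
  (so it is not counted as a leaf then); this is needed because the first level of
  \<open>hat_tree\<close> below can consist of a single vertex.
\<close>

locale rooted_tree =
  fixes T :: "'v rooted_graph"
  assumes root_in_verts: "root T \<in> verts T"
    and adj_in_verts: "adj T u v \<Longrightarrow> u \<in> verts T \<and> v \<in> verts T"
    and adj_sym: "adj T u v \<Longrightarrow> adj T v u"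
    and adj_irrefl: "\<not> adj T v v"
    and connected: "u \<in> verts T \<Longrightarrow> v \<in> verts T \<Longrightarrow> \<exists>p. walk T p \<and> hd p = u \<and> last p = v"
    and acyclic: "\<not> (\<exists>p. walk T p \<and> distinct p \<and> 3 \<le> length p \<and> adj T (last p) (hd p))"
    and locally_finite: "v \<in> verts T \<Longrightarrow> finite {w. adj T v w}"
    and no_leaves: "v \<in> verts T \<Longrightarrow> \<exists>w. (v, w) \<in> child_rel T"

definition tree_auto :: "'v rooted_graph \<Rightarrow> ('v \<Rightarrow> 'v) set" where
  "tree_auto T = {f \<in> Bij (verts T). f (root T) = root T \<and>
     (\<forall>u\<in>verts T. \<forall>v\<in>verts T. adj T (f u) (f v) \<longleftrightarrow> adj T u v)}"

definition TreeAuto :: "'v rooted_graph \<Rightarrow> ('v \<Rightarrow> 'v) monoid" where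
  "TreeAuto T = BijGroup (verts T) \<lparr>carrier := tree_auto T\<rparr>"


section \<open>Branch and weakly branch groups\<close>

definition rist :: "'v rooted_graph \<Rightarrow> ('v \<Rightarrow> 'v) set \<Rightarrow> 'v \<Rightarrow> ('v \<Rightarrow> 'v) set" where
  "rist T H v = {g \<in> H. \<forall>w \<in> verts T - subtree T v. g w = w}"

definition rist_level :: "'v rooted_graph \<Rightarrow> ('v \<Rightarrow> 'v) set \<Rightarrow> nat \<Rightarrow> ('v \<Rightarrow> 'v) set" where
  "rist_level T H n = generate (TreeAuto T) (\<Union>v\<in>level T n. rist T H v)"

definition level_transitive :: "'v rooted_graph \<Rightarrow> ('v \<Rightarrow> 'v) set \<Rightarrow> bool" where
  "level_transitive T H \<longleftrightarrow> (\<forall>n. \<forall>u\<in>level T n. \<forall>v\<in>level T n. \<exists>g\<in>H. g u = v)"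

definition weakly_branch_on :: "'v rooted_graph \<Rightarrow> ('v \<Rightarrow> 'v) set \<Rightarrow> bool" where
  "weakly_branch_on T H \<longleftrightarrow> subgroup H (TreeAuto T) \<and> level_transitive T H \<and>
     (\<forall>v\<in>verts T. rist T H v \<noteq> {\<one>\<^bsub>TreeAuto T\<^esub>})"

definition branch_on :: "'v rooted_graph \<Rightarrow> ('v \<Rightarrow> 'v) set \<Rightarrow> bool" where
  "branch_on T H \<longleftrightarrow> subgroup H (TreeAuto T) \<and> level_transitive T H \<and>
     (\<forall>n. finite (rcosets\<^bsub>TreeAuto T\<lparr>carrier := H\<rparr>\<^esub> (rist_level T H n)))"

text \<open>Faithful actions of an abstract group \<open>G\<close>, given by \<open>\<phi>: G \<rightarrow> Aut(T)\<close>.\<close>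

definition weakly_branch_action ::
  "('g, 'm) monoid_scheme \<Rightarrow> 'v rooted_graph \<Rightarrow> ('g \<Rightarrow> 'v \<Rightarrow> 'v) \<Rightarrow> bool" where
  "weakly_branch_action G T \<phi> \<longleftrightarrow>
     rooted_tree T \<and> \<phi> \<in> mon G (TreeAuto T) \<and> weakly_branch_on T (\<phi> ` carrier G)"

definition branch_action ::
  "('g, 'm) monoid_scheme \<Rightarrow> 'v rooted_graph \<Rightarrow> ('g \<Rightarrow> 'v \<Rightarrow> 'v) \<Rightarrow> bool" where
  "branch_action G T \<phi> \<longleftrightarrow>
     rooted_tree T \<and> \<phi> \<in> mon G (TreeAuto T) \<and> branch_on T (\<phi> ` carrier G)"

text \<open>
  A connected locally finite graph has countably many vertices, so every such tree is
  isomorphic to one whose vertices are natural numbers. Quantifying over trees with vertices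
  of type \<open>nat\<close> is therefore no restriction.
\<close>

definition weakly_branch_group :: "('g, 'm) monoid_scheme \<Rightarrow> bool" where
  "weakly_branch_group G \<longleftrightarrow>
     group G \<and> (\<exists>(T :: nat rooted_graph) \<phi>. weakly_branch_action G T \<phi>)"

definition branch_group :: "('g, 'm) monoid_scheme \<Rightarrow> bool" where
  "branch_group G \<longleftrightarrow> group G \<and> (\<exists>(T :: nat rooted_graph) \<phi>. branch_action G T \<phi>)"

definition finitely_generated :: "('g, 'm) monoid_scheme \<Rightarrow> bool" where
  "finitely_generated G \<longleftrightarrow> (\<exists>S \<subseteq> carrier G. finite S \<and> generate G S = carrier G)"


section \<open>Outer automorphisms and extensions\<close>

definition inner_auto :: "('g, 'm) monoid_scheme \<Rightarrow> ('g \<Rightarrow> 'g) set" where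
  "inner_auto G = (\<lambda>g. \<lambda>x\<in>carrier G. g \<otimes>\<^bsub>G\<^esub> x \<otimes>\<^bsub>G\<^esub> inv\<^bsub>G\<^esub> g) ` carrier G"

definition OutGroup :: "('g, 'm) monoid_scheme \<Rightarrow> ('g \<Rightarrow> 'g) set monoid" where
  "OutGroup G = AutoGroup G Mod inner_auto G"

definition out_class :: "('g, 'm) monoid_scheme \<Rightarrow> ('g \<Rightarrow> 'g) \<Rightarrow> ('g \<Rightarrow> 'g) set" where
  "out_class G \<alpha> = inner_auto G #>\<^bsub>AutoGroup G\<^esub> \<alpha>"

text \<open>
  A short exact sequence \<open>1 \<rightarrow> G \<rightarrow> \<Gamma> \<rightarrow> F \<rightarrow> 1\<close> with maps \<open>\<iota>\<close> and \<open>q\<close>. The library's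
  \<^const>\<open>short_exact_sequence\<close> forces all groups to live on the same type.
\<close>

locale group_extension =
  fixes G :: "('g, 'm) monoid_scheme" and \<iota> :: "'g \<Rightarrow> 'e"
    and \<Gamma> :: "('e, 'n) monoid_scheme" and q :: "'e \<Rightarrow> 'f"
    and F :: "('f, 'k) monoid_scheme"
  assumes group_G: "group G" and group_\<Gamma>: "group \<Gamma>" and group_F: "group F"
    and \<iota>_mon: "\<iota> \<in> mon G \<Gamma>" and q_epi: "q \<in> epi \<Gamma> F"
    and exact: "\<iota> ` carrier G = kernel \<Gamma> F q"

text \<open>The map \<open>\<rho>\<close>: conjugation by \<open>\<gamma>\<close>, transported to \<open>G\<close> along \<open>\<iota>\<close>.\<close>

definition conj_auto ::
  "('g, 'm) monoid_scheme \<Rightarrow> ('g \<Rightarrow> 'e) \<Rightarrow> ('e, 'n) monoid_scheme \<Rightarrow> 'e \<Rightarrow> 'g \<Rightarrow> 'g" where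
  "conj_auto G \<iota> \<Gamma> \<gamma> =
     (\<lambda>g\<in>carrier G. inv_into (carrier G) \<iota> (\<gamma> \<otimes>\<^bsub>\<Gamma>\<^esub> \<iota> g \<otimes>\<^bsub>\<Gamma>\<^esub> inv\<^bsub>\<Gamma>\<^esub> \<gamma>))"

text \<open>
  The map \<open>\<mu>\<close>: the outer class of conjugation by any \<open>\<gamma>\<close> lying over \<open>f\<close>. All these \<open>\<gamma>\<close> give
  the same class, see \<open>monodromy_eq\<close> and \<open>monodromy_hom\<close> below.
\<close>

definition monodromy ::
  "('g, 'm) monoid_scheme \<Rightarrow> ('g \<Rightarrow> 'e) \<Rightarrow> ('e, 'n) monoid_scheme \<Rightarrow> ('e \<Rightarrow> 'f) \<Rightarrow>
   'f \<Rightarrow> ('g \<Rightarrow> 'g) set" where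
  "monodromy G \<iota> \<Gamma> q f =
     the_elem ((\<lambda>\<gamma>. out_class G (conj_auto G \<iota> \<Gamma> \<gamma>)) ` {\<gamma> \<in> carrier \<Gamma>. q \<gamma> = f})"


lemma (in group_extension) conj_auto_\<iota>:
  assumes "\<gamma> \<in> carrier \<Gamma>" and "g \<in> carrier G"
  shows "conj_auto G \<iota> \<Gamma> \<gamma> g \<in> carrier G"
    and "\<iota> (conj_auto G \<iota> \<Gamma> \<gamma> g) = \<gamma> \<otimes>\<^bsub>\<Gamma>\<^esub> \<iota> g \<otimes>\<^bsub>\<Gamma>\<^esub> inv\<^bsub>\<Gamma>\<^esub> \<gamma>"
proof -
  interpret \<Gamma>: group \<Gamma> by (rule group_\<Gamma>)
  interpret F: group F by (rule group_F)
  interpret q: group_hom \<Gamma> F q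
    using q_epi by unfold_locales (auto simp: epi_def)
  have "\<iota> g \<in> kernel \<Gamma> F q" using exact assms(2) by blast
  then have "\<gamma> \<otimes>\<^bsub>\<Gamma>\<^esub> \<iota> g \<otimes>\<^bsub>\<Gamma>\<^esub> inv\<^bsub>\<Gamma>\<^esub> \<gamma> \<in> kernel \<Gamma> F q"
    using assms(1) by (simp add: kernel_def)
  then have *: "\<gamma> \<otimes>\<^bsub>\<Gamma>\<^esub> \<iota> g \<otimes>\<^bsub>\<Gamma>\<^esub> inv\<^bsub>\<Gamma>\<^esub> \<gamma> \<in> \<iota> ` carrier G" using exact by simp
  show "conj_auto G \<iota> \<Gamma> \<gamma> g \<in> carrier G"
    using inv_into_into[OF *] assms(2) by (simp add: conj_auto_def)
  show "\<iota> (conj_auto G \<iota> \<Gamma> \<gamma> g) = \<gamma> \<otimes>\<^bsub>\<Gamma>\<^esub> \<iota> g \<otimes>\<^bsub>\<Gamma>\<^esub> inv\<^bsub>\<Gamma>\<^esub> \<gamma>"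
    using f_inv_into_f[OF *] assms(2) by (simp add: conj_auto_def)
qed

lemma (in group_extension) conj_auto_eqI:
  assumes "\<gamma> \<in> carrier \<Gamma>" "g \<in> carrier G" "x \<in> carrier G"
    and "\<iota> x = \<gamma> \<otimes>\<^bsub>\<Gamma>\<^esub> \<iota> g \<otimes>\<^bsub>\<Gamma>\<^esub> inv\<^bsub>\<Gamma>\<^esub> \<gamma>"
  shows "conj_auto G \<iota> \<Gamma> \<gamma> g = x"
  using conj_auto_\<iota>[OF assms(1,2)] assms(3,4) \<iota>_mon by (auto simp: mon_def inj_on_def)

lemma (in group_extension) conj_auto_hom: "conj_auto G \<iota> \<Gamma> \<in> hom \<Gamma> (AutoGroup G)"
proof -
  interpret G: group G by (rule group_G)
  interpret \<Gamma>: group \<Gamma> by (rule group_\<Gamma>)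
  interpret \<iota>: group_hom G \<Gamma> \<iota>
    using \<iota>_mon by unfold_locales (auto simp: mon_def)
  let ?\<rho> = "conj_auto G \<iota> \<Gamma>"
  have mult: "?\<rho> (\<gamma> \<otimes>\<^bsub>\<Gamma>\<^esub> \<delta>) g = ?\<rho> \<gamma> (?\<rho> \<delta> g)"
    if "\<gamma> \<in> carrier \<Gamma>" "\<delta> \<in> carrier \<Gamma>" "g \<in> carrier G" for \<gamma> \<delta> g
    using that
    by (intro conj_auto_eqI) (simp_all add: conj_auto_\<iota> \<Gamma>.inv_mult_group \<Gamma>.m_assoc)
  have one: "?\<rho> \<one>\<^bsub>\<Gamma>\<^esub> g = g" if "g \<in> carrier G" for g
    using that by (intro conj_auto_eqI) simp_all
  have auto: "?\<rho> \<gamma> \<in> auto G" if \<gamma>: "\<gamma> \<in> carrier \<Gamma>" for \<gamma>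
  proof -
    have "?\<rho> \<gamma> (g \<otimes>\<^bsub>G\<^esub> h) = ?\<rho> \<gamma> g \<otimes>\<^bsub>G\<^esub> ?\<rho> \<gamma> h"
      if "g \<in> carrier G" "h \<in> carrier G" for g h
      using \<gamma> that
    proof (intro conj_auto_eqI)
      have cancel: "inv\<^bsub>\<Gamma>\<^esub> \<gamma> \<otimes>\<^bsub>\<Gamma>\<^esub> (\<gamma> \<otimes>\<^bsub>\<Gamma>\<^esub> x) = x" if "x \<in> carrier \<Gamma>" for x
        using \<gamma> that by (simp flip: \<Gamma>.m_assoc)
      show "\<iota> (?\<rho> \<gamma> g \<otimes>\<^bsub>G\<^esub> ?\<rho> \<gamma> h) =
          \<gamma> \<otimes>\<^bsub>\<Gamma>\<^esub> \<iota> (g \<otimes>\<^bsub>G\<^esub> h) \<otimes>\<^bsub>\<Gamma>\<^esub> inv\<^bsub>\<Gamma>\<^esub> \<gamma>"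
        using \<gamma> that by (simp add: conj_auto_\<iota> \<Gamma>.m_assoc cancel)
    qed (use \<gamma> that in \<open>simp_all add: conj_auto_\<iota>\<close>)
    then have "?\<rho> \<gamma> \<in> hom G G" using \<gamma> by (auto simp: hom_def conj_auto_\<iota>)
    moreover have "bij_betw (?\<rho> \<gamma>) (carrier G) (carrier G)"
      using mult[OF \<gamma> \<Gamma>.inv_closed[OF \<gamma>]] mult[OF \<Gamma>.inv_closed[OF \<gamma>] \<gamma>] one \<gamma>
      by (intro bij_betwI[where g = "?\<rho> (inv\<^bsub>\<Gamma>\<^esub> \<gamma>)"]) (auto simp: conj_auto_\<iota>)
    moreover have "?\<rho> \<gamma> \<in> extensional (carrier G)" by (simp add: conj_auto_def)
    ultimately show ?thesis by (simp add: auto_def Bij_def)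
  qed
  have "?\<rho> (\<gamma> \<otimes>\<^bsub>\<Gamma>\<^esub> \<delta>) = compose (carrier G) (?\<rho> \<gamma>) (?\<rho> \<delta>)"
    if "\<gamma> \<in> carrier \<Gamma>" "\<delta> \<in> carrier \<Gamma>" for \<gamma> \<delta>
    using mult[OF that]
    by (intro extensionalityI[of _ "carrier G"]) (auto simp: compose_def conj_auto_def)
  then show ?thesis
    using auto by (auto simp: hom_def AutoGroup_def BijGroup_def auto_def)
qed

lemma (in group) inner_auto_conj_auto: "inner_auto G = conj_auto G id G ` carrier G"
proof -
  have "conj_auto G id G g = (\<lambda>x\<in>carrier G. g \<otimes> x \<otimes> inv g)" if "g \<in> carrier G" for g
    using that unfolding conj_auto_def
    by (intro restrict_ext) (metis f_inv_into_f id_apply image_id inv_closed m_closed)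
  then show ?thesis by (simp add: inner_auto_def)
qed

lemma (in group) normal_inner_auto: "inner_auto G \<lhd> AutoGroup G"
proof -
  interpret A: group "AutoGroup G" by (rule AutoGroup)
  interpret t: group_extension G id G "\<lambda>_. \<one>" "singleton_group \<one>"
    by unfold_locales (auto simp: mon_def epi_def hom_def kernel_def singleton_group_def Units_def)
  interpret c: group_hom G "AutoGroup G" "conj_auto G id G"
    using t.conj_auto_hom by unfold_locales
  have "subgroup (inner_auto G) (AutoGroup G)"
    using c.img_is_subgroup by (simp add: inner_auto_conj_auto)
  moreover have "\<alpha> \<otimes>\<^bsub>AutoGroup G\<^esub> h \<otimes>\<^bsub>AutoGroup G\<^esub> inv\<^bsub>AutoGroup G\<^esub> \<alpha> \<in> inner_auto G"
    if \<alpha>: "\<alpha> \<in> carrier (AutoGroup G)" and h: "h \<in> inner_auto G" for \<alpha> h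
  proof -
    obtain g where g: "g \<in> carrier G" "h = conj_auto G id G g"
      using h by (auto simp: inner_auto_conj_auto)
    have \<alpha>c: "\<alpha> \<in> hom G G" "\<alpha> \<in> Bij (carrier G)" using \<alpha> by (auto simp: AutoGroup_def auto_def)
    then interpret \<alpha>: group_hom G G \<alpha> by unfold_locales
    let ?k = "conj_auto G id G (\<alpha> g)"
    have k: "?k \<in> carrier (AutoGroup G)" "h \<in> carrier (AutoGroup G)"
      using g c.hom_closed by auto
    have "\<alpha> \<otimes>\<^bsub>AutoGroup G\<^esub> h = ?k \<otimes>\<^bsub>AutoGroup G\<^esub> \<alpha>"
    proof -
      have "\<alpha> (h x) = ?k (\<alpha> x)" if "x \<in> carrier G" for x
        using that g t.conj_auto_\<iota>(2)[of g x] t.conj_auto_\<iota>(2)[of "\<alpha> g" "\<alpha> x"] by simp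
      moreover have "?k \<in> Bij (carrier G)" "h \<in> Bij (carrier G)"
        using k by (auto simp: AutoGroup_def auto_def)
      ultimately show ?thesis using \<alpha>c
        by (simp add: AutoGroup_def BijGroup_def) (auto simp: compose_def)
    qed
    then have "\<alpha> \<otimes>\<^bsub>AutoGroup G\<^esub> h \<otimes>\<^bsub>AutoGroup G\<^esub> inv\<^bsub>AutoGroup G\<^esub> \<alpha> = ?k"
      using \<alpha> k by (simp add: A.m_assoc)
    then show ?thesis using g by (simp add: inner_auto_conj_auto)
  qed
  ultimately show ?thesis by (simp add: A.normal_inv_iff)
qed

lemma (in group_extension) monodromy_eq:
  assumes "\<gamma> \<in> carrier \<Gamma>"
  shows "monodromy G \<iota> \<Gamma> q (q \<gamma>) = out_class G (conj_auto G \<iota> \<Gamma> \<gamma>)"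
proof -
  interpret G: group G by (rule group_G)
  interpret \<Gamma>: group \<Gamma> by (rule group_\<Gamma>)
  interpret F: group F by (rule group_F)
  interpret A: group "AutoGroup G" by (rule G.AutoGroup)
  interpret q: group_hom \<Gamma> F q
    using q_epi by unfold_locales (auto simp: epi_def)
  interpret \<rho>: group_hom \<Gamma> "AutoGroup G" "conj_auto G \<iota> \<Gamma>"
    using conj_auto_hom by unfold_locales
  interpret \<iota>: group_hom G \<Gamma> \<iota>
    using \<iota>_mon by unfold_locales (auto simp: mon_def)
  interpret I: normal "inner_auto G" "AutoGroup G" by (rule G.normal_inner_auto)
  have inner: "conj_auto G \<iota> \<Gamma> (\<iota> g) \<in> inner_auto G" if g: "g \<in> carrier G" for g
  proof -
    have "conj_auto G \<iota> \<Gamma> (\<iota> g) = (\<lambda>x\<in>carrier G. g \<otimes>\<^bsub>G\<^esub> x \<otimes>\<^bsub>G\<^esub> inv\<^bsub>G\<^esub> g)"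
    proof (rule extensionalityI[of _ "carrier G"])
      show "conj_auto G \<iota> \<Gamma> (\<iota> g) \<in> extensional (carrier G)" by (simp add: conj_auto_def)
      fix x assume x: "x \<in> carrier G"
      have "conj_auto G \<iota> \<Gamma> (\<iota> g) x = g \<otimes>\<^bsub>G\<^esub> x \<otimes>\<^bsub>G\<^esub> inv\<^bsub>G\<^esub> g"
        using g x by (intro conj_auto_eqI) simp_all
      then show "conj_auto G \<iota> \<Gamma> (\<iota> g) x = (\<lambda>x\<in>carrier G. g \<otimes>\<^bsub>G\<^esub> x \<otimes>\<^bsub>G\<^esub> inv\<^bsub>G\<^esub> g) x"
        using x by simp
    qed simp
    then show ?thesis using g by (auto simp: inner_auto_def)
  qed
  have "out_class G (conj_auto G \<iota> \<Gamma> \<delta>) = out_class G (conj_auto G \<iota> \<Gamma> \<gamma>)"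
    if \<delta>: "\<delta> \<in> carrier \<Gamma>" "q \<delta> = q \<gamma>" for \<delta>
  proof -
    have "\<delta> \<otimes>\<^bsub>\<Gamma>\<^esub> inv\<^bsub>\<Gamma>\<^esub> \<gamma> \<in> kernel \<Gamma> F q" using \<delta> assms by (simp add: kernel_def)
    then obtain g where g: "g \<in> carrier G" "\<delta> \<otimes>\<^bsub>\<Gamma>\<^esub> inv\<^bsub>\<Gamma>\<^esub> \<gamma> = \<iota> g" using exact by auto
    then have "\<delta> = \<iota> g \<otimes>\<^bsub>\<Gamma>\<^esub> \<gamma>" 
      using \<delta> assms by (simp add: \<Gamma>.m_assoc flip: g(2))
    then have "conj_auto G \<iota> \<Gamma> \<delta> = conj_auto G \<iota> \<Gamma> (\<iota> g) \<otimes>\<^bsub>AutoGroup G\<^esub> conj_auto G \<iota> \<Gamma> \<gamma>"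
      using g assms by simp
    then have "conj_auto G \<iota> \<Gamma> \<delta> \<in> out_class G (conj_auto G \<iota> \<Gamma> \<gamma>)"
      using inner[OF g(1)] by (auto simp: out_class_def r_coset_def)
    then show ?thesis
      unfolding out_class_def
      by (rule A.repr_independence[OF _ \<rho>.hom_closed[OF assms] I.subgroup_axioms, symmetric])
  qed
  then have "(\<lambda>\<gamma>. out_class G (conj_auto G \<iota> \<Gamma> \<gamma>)) ` {\<delta> \<in> carrier \<Gamma>. q \<delta> = q \<gamma>} =
      {out_class G (conj_auto G \<iota> \<Gamma> \<gamma>)}" using assms by blast
  then show ?thesis by (simp add: monodromy_def)
qed

lemma (in group_extension) monodromy_hom: "monodromy G \<iota> \<Gamma> q \<in> hom F (OutGroup G)"
proof -
  interpret G: group G by (rule group_G)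
  interpret \<Gamma>: group \<Gamma> by (rule group_\<Gamma>)
  interpret F: group F by (rule group_F)
  interpret q: group_hom \<Gamma> F q
    using q_epi by unfold_locales (auto simp: epi_def)
  interpret A: group "AutoGroup G" by (rule G.AutoGroup)
  interpret \<rho>: group_hom \<Gamma> "AutoGroup G" "conj_auto G \<iota> \<Gamma>"
    using conj_auto_hom by unfold_locales
  interpret I: normal "inner_auto G" "AutoGroup G" by (rule G.normal_inner_auto)
  have im: "carrier F = q ` carrier \<Gamma>" using q_epi by (simp add: epi_def)
  have m: "monodromy G \<iota> \<Gamma> q (q \<gamma> \<otimes>\<^bsub>F\<^esub> q \<delta>) =
      monodromy G \<iota> \<Gamma> q (q \<gamma>) \<otimes>\<^bsub>OutGroup G\<^esub> monodromy G \<iota> \<Gamma> q (q \<delta>)"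
    if "\<gamma> \<in> carrier \<Gamma>" "\<delta> \<in> carrier \<Gamma>" for \<gamma> \<delta>
    using that by (simp flip: q.hom_mult
      add: monodromy_eq out_class_def OutGroup_def FactGroup_def I.rcos_sum)
  have "monodromy G \<iota> \<Gamma> q (q \<gamma>) \<in> carrier (OutGroup G)" if "\<gamma> \<in> carrier \<Gamma>" for \<gamma>
    using that by (auto simp: monodromy_eq out_class_def OutGroup_def FactGroup_def RCOSETS_def)
  with m show ?thesis unfolding hom_def im by auto
qed


section \<open>The boundary and the canonical action of the automorphism group\<close>

definition boundary :: "'v rooted_graph \<Rightarrow> (nat \<Rightarrow> 'v) set" where
  "boundary T = {\<xi>. \<xi> 0 = root T \<and>
     (\<forall>n. adj T (\<xi> n) (\<xi> (Suc n)) \<and> \<xi> (Suc (Suc n)) \<noteq> \<xi> n)}"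

definition cylinder :: "'v rooted_graph \<Rightarrow> 'v \<Rightarrow> (nat \<Rightarrow> 'v) set" where
  "cylinder T v = {\<xi> \<in> boundary T. v \<in> range \<xi>}"

definition boundary_topology :: "'v rooted_graph \<Rightarrow> (nat \<Rightarrow> 'v) topology" where
  "boundary_topology T = topology_generated_by (cylinder T ` verts T)"

text \<open>
  \<open>|\<xi> \<and> \<eta>|\<close>: the segments \<open>\<xi> 0, \<dots>, \<xi> n\<close> have length \<open>n\<close>. The supremum is \<open>\<infinity>\<close> iff \<open>\<xi> = \<eta>\<close>.
\<close>

definition confluence :: "(nat \<Rightarrow> 'v) \<Rightarrow> (nat \<Rightarrow> 'v) \<Rightarrow> enat" where
  "confluence \<xi> \<eta> = (SUP n \<in> {n. \<forall>i\<le>n. \<xi> i = \<eta> i}. enat n)"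

text \<open>
  The homeomorphism \<open>\<xi> \<mapsto> \<alpha> \<cdot> \<xi>\<close> for \<open>G\<close> acting on \<open>T\<close> through \<open>\<phi>\<close>. By the theorem of Lavreniuk
  and Nekrashevych it exists and is unique if the action is faithful and weakly branch
  (uniqueness as a function uses the value \<open>undefined\<close> outside of the boundary).
\<close>

definition boundary_act ::
  "('g, 'm) monoid_scheme \<Rightarrow> 'v rooted_graph \<Rightarrow> ('g \<Rightarrow> 'v \<Rightarrow> 'v) \<Rightarrow>
   ('g \<Rightarrow> 'g) \<Rightarrow> (nat \<Rightarrow> 'v) \<Rightarrow> (nat \<Rightarrow> 'v)" where
  "boundary_act G T \<phi> \<alpha> = (THE h.
     h \<in> extensional (boundary T) \<and>
     homeomorphic_map (boundary_topology T) (boundary_topology T) h \<and>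
     (\<forall>g\<in>carrier G. \<forall>\<xi>\<in>boundary T. h (\<phi> g \<circ> \<xi>) = \<phi> (\<alpha> g) \<circ> h \<xi>))"


section \<open>The automorphism-invariant refinement of a tree\<close>

definition hat_confluence ::
  "('g, 'm) monoid_scheme \<Rightarrow> 'v rooted_graph \<Rightarrow> ('g \<Rightarrow> 'v \<Rightarrow> 'v) \<Rightarrow>
   (nat \<Rightarrow> 'v) \<Rightarrow> (nat \<Rightarrow> 'v) \<Rightarrow> enat" where
  "hat_confluence G T \<phi> \<xi> \<eta> =
     (INF \<alpha> \<in> carrier (AutoGroup G). confluence (boundary_act G T \<phi> \<alpha> \<xi>) (boundary_act G T \<phi> \<alpha> \<eta>))"

definition hat_classes ::
  "('g, 'm) monoid_scheme \<Rightarrow> 'v rooted_graph \<Rightarrow> ('g \<Rightarrow> 'v \<Rightarrow> 'v) \<Rightarrow> nat \<Rightarrow> (nat \<Rightarrow> 'v) set set" where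
  "hat_classes G T \<phi> n = boundary T //
     {(\<xi>, \<eta>). \<xi> \<in> boundary T \<and> \<eta> \<in> boundary T \<and> enat n \<le> hat_confluence G T \<phi> \<xi> \<eta>}"

text \<open>
  Vertices are tagged with their level, since one and the same set of rays can be a class for
  several \<open>n\<close> and then gives a different vertex for each of them.
\<close>

definition hat_tree ::
  "('g, 'm) monoid_scheme \<Rightarrow> 'v rooted_graph \<Rightarrow> ('g \<Rightarrow> 'v \<Rightarrow> 'v) \<Rightarrow>
   (nat \<times> (nat \<Rightarrow> 'v) set) rooted_graph" where
  "hat_tree G T \<phi> =
     \<lparr>verts = Sigma UNIV (hat_classes G T \<phi>),
      adj = (\<lambda>(m, C) (n, D). C \<in> hat_classes G T \<phi> m \<and> D \<in> hat_classes G T \<phi> n \<and>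
               (n = Suc m \<and> D \<subseteq> C \<or> m = Suc n \<and> C \<subseteq> D)),
      root = (0, boundary T)\<rparr>"

definition hat_act ::
  "('g, 'm) monoid_scheme \<Rightarrow> 'v rooted_graph \<Rightarrow> ('g \<Rightarrow> 'v \<Rightarrow> 'v) \<Rightarrow>
   ('g \<Rightarrow> 'g) \<Rightarrow> nat \<times> (nat \<Rightarrow> 'v) set \<Rightarrow> nat \<times> (nat \<Rightarrow> 'v) set" where
  "hat_act G T \<phi> \<alpha> =
     (\<lambda>(n, C) \<in> verts (hat_tree G T \<phi>). (n, boundary_act G T \<phi> \<alpha> ` C))"

end

theory Submission imports Defs
begin

text \<open>
  The boundary action. For \<open>\<alpha> \<in> Aut(G)\<close> let \<open>U(v)\<close> be the open set of rays moved by
  \<open>\<alpha>\<^sup>-\<^sup>1(Rist(v))\<close>. For distinct vertices \<open>v, w\<close> of the same level the subgroups \<open>\<alpha>\<^sup>-\<^sup>1(Rist(v))\<close> and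
  \<open>\<alpha>\<^sup>-\<^sup>1(Rist(w))\<close> commute and are normalized by a subgroup of finite index; at a ray in
  \<open>U(v) \<inter> U(w)\<close> this would force a part of some rigid stabilizer to be commutative. So the sets
  \<open>U(v)\<close> of a fixed level partition the boundary, and sending \<open>y\<close> to the ray of all \<open>v\<close> with
  \<open>y \<in> U(v)\<close> is the homeomorphism belonging to \<open>\<alpha>\<close>. It is unique since the stabilizer of a ray
  fixes no other ray.

  If \<open>G\<close> is finitely generated, then these homeomorphisms are equicontinuous. Hence every class
  on the hat tree contains, and is contained in, cylinders of \<open>T\<close>, and the rigid stabilizers of
  \<open>G\<close> on \<open>T\<close> and of \<open>\<Gamma>\<close> on the hat tree can be compared up to finite index.

  Conversely, the kernel of \<open>\<rho>\<close> is the centralizer of the subgroup \<open>G\<close> of finite index in \<open>\<Gamma>\<close>,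
  and such a centralizer is trivial in a weakly branch group. An infinite branch group is weakly
  branch, since one trivial rigid stabilizer would make a subgroup \<open>Rist(n)\<close> of finite index trivial.
\<close>

text \<open>The obstacle is that neither an automorphism of G nor an element of \<Gamma> has to
  respect the levels of T. Hence everything is carried out on the boundary: a vertex of level n is
  represented by any ray through it, and a tree automorphism is recovered from its action on rays.
  The class of \<xi> at level n lies in the cylinder of \<open>\<xi> n\<close>, as the identity is
  among the automorphisms in the infimum. Equicontinuity is the reverse inclusion, for cylinders of
  a level N that depends on n only.

  Subgroups of finite index often enter through a function f with finite range on the group: two
  distinct elements of a rigid stabilizer share a value, and their quotient is a nontrivial element
  of the subgroup in question. No normal core has to be formed.

  A rigid stabilizer of \<Gamma> on the hat tree need not lie in G. Cutting it down to G costs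
  finite index; since the rigid stabilizers of one level commute, it costs only finite index in the
  group that they generate.

  The kernels of \<rho> and \<mu> correspond because the kernel of \<rho> meets G in the centre of
  G, which is trivial.\<close>

lemma walk_singleton [simp]: "walk T [v] \<longleftrightarrow> v \<in> verts T"
  by (simp add: walk_def)

lemma walk_append:
  assumes "walk T p" "walk T r" "adj T (last p) (hd r)"
  shows "walk T (p @ r)"
  using assms by (auto simp: walk_def successively_append_iff)

lemma walk_join:
  assumes "walk T p" "walk T r" "last p = hd r"
  shows "\<exists>s. walk T s \<and> hd s = hd p \<and> last s = last r"
proof (cases "tl r = []")
  case True
  then have "last r = hd r" using assms(2) by (cases r) (auto simp: walk_def)
  then show ?thesis using assms by metis
next
  case False
  then obtain x y ys where r: "r = x # y # ys" by (metis list.exhaust list.sel(2,3))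
  with assms have "walk T (p @ y # ys)"
    by (intro walk_append) (auto simp: walk_def)
  then show ?thesis using assms r by (intro exI[of _ "p @ y # ys"]) (auto simp: walk_def)
qed

lemma walk_rev:
  assumes "\<And>u v. adj T u v \<Longrightarrow> adj T v u" and "walk T p"
  shows "walk T (rev p)"
proof -
  have "successively (\<lambda>x y. adj T y x) p"
    using assms by (auto simp: walk_def elim: successively_mono)
  then show ?thesis using assms(2) by (auto simp: walk_def)
qed

section \<open>Trees given by a rank and a parent function\<close>

text \<open>The hat tree and the relabelled trees come with an explicit level and parent, whereas
  \<open>rooted_tree\<close> speaks of walks and cycles. This interface bridges the two once and for
  all; conversely every \<open>rooted_tree\<close> is shown to be an instance.\<close>

locale ranked_tree =
  fixes T :: "'v rooted_graph" and rk :: "'v \<Rightarrow> nat" and par :: "'v \<Rightarrow> 'v"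
  assumes root_V: "root T \<in> verts T" and rk_root: "rk (root T) = 0"
    and rk_0: "v \<in> verts T \<Longrightarrow> rk v = 0 \<Longrightarrow> v = root T"
    and par: "v \<in> verts T \<Longrightarrow> rk v = Suc n \<Longrightarrow> par v \<in> verts T \<and> rk (par v) = n"
    and adj_iff: "adj T u v \<longleftrightarrow> u \<in> verts T \<and> v \<in> verts T \<and>
      (rk v = Suc (rk u) \<and> par v = u \<or> rk u = Suc (rk v) \<and> par u = v)"
    and finite_children: "v \<in> verts T \<Longrightarrow> finite {w \<in> verts T. rk w = Suc (rk v) \<and> par w = v}"
    and ex_child: "v \<in> verts T \<Longrightarrow> \<exists>w\<in>verts T. rk w = Suc (rk v) \<and> par w = v"
begin

lemma sym: "adj T u v \<Longrightarrow> adj T v u"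
  by (auto simp: adj_iff)

lemma walk_from_root:
  assumes "v \<in> verts T"
  shows "\<exists>p. walk T p \<and> hd p = root T \<and> last p = v \<and> length p = Suc (rk v)"
  using assms
proof (induction "rk v" arbitrary: v)
  case 0
  then have "v = root T" using rk_0 by simp
  then show ?case using 0 by (intro exI[of _ "[v]"]) auto
next
  case (Suc n)
  then obtain p where p: "walk T p" "hd p = root T" "last p = par v" "length p = Suc n"
    using par[of v n] by metis
  have "walk T (p @ [v])"
    using p Suc par[of v n] by (intro walk_append) (auto simp: adj_iff)
  then show ?case using p Suc by (intro exI[of _ "p @ [v]"]) (auto simp: walk_def)
qed

text \<open>Each edge changes the rank by one. The inequality is strict because
  \<open>length p\<close> counts vertices, one more than the edges.\<close>

lemma rk_le_walk:
  assumes "walk T p"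
  shows "rk (last p) < rk (hd p) + length p"
  using assms
proof (induction p rule: induct_list012)
  case (3 x y zs)
  then have "adj T x y" "walk T (y # zs)" by (auto simp: walk_def)
  then show ?case using 3 by (auto simp: adj_iff split: if_splits)
qed (auto simp: walk_def)

lemma depth_eq:
  assumes "v \<in> verts T"
  shows "depth T v = rk v"
  unfolding depth_def
proof (rule Least_equality)
  show "\<exists>p. walk T p \<and> hd p = root T \<and> last p = v \<and> length p = Suc (rk v)"
    using walk_from_root[OF assms] .
  fix n assume "\<exists>p. walk T p \<and> hd p = root T \<and> last p = v \<and> length p = Suc n"
  then show "rk v \<le> n" using rk_le_walk by (force simp: rk_root)
qed

text \<open>A vertex of maximal rank on a cycle has its parent as both neighbours.\<close>

lemma no_cycle:
  assumes "walk T p" "distinct p" "3 \<le> length p" "adj T (last p) (hd p)"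
  shows False
proof -
  have "p \<noteq> []" using assms by auto
  obtain x where x: "x \<in> set p" "\<And>y. y \<in> set p \<Longrightarrow> rk y \<le> rk x"
  proof -
    have "finite (set p)" "set p \<noteq> {}" using \<open>p \<noteq> []\<close> by auto
    then have "Max (rk ` set p) \<in> rk ` set p" by simp
    then obtain x where "x \<in> set p" "rk x = Max (rk ` set p)" by auto
    then show thesis by (intro that[of x]) auto
  qed
  obtain as bs where p: "p = as @ x # bs" using x(1) by (meson split_list)
  \<comment> \<open>The cycle is rotated so as to start at x; then \<open>hd r\<close> and
    \<open>last r\<close> are the two neighbours of x on it, and they differ because r has at least
    two vertices.\<close>
  define r where "r = bs @ as"
  have r: "r \<noteq> []" "distinct r" "2 \<le> length r" "set r \<subseteq> set p"
    using assms p by (auto simp: r_def)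
  have "adj T x (hd r) \<and> adj T (last r) x"
    using assms(1,4) r(1) p by (cases as; cases bs)
      (auto simp: walk_def r_def successively_append_iff successively_Cons split: if_splits)
  moreover have "rk (hd r) \<le> rk x" "rk (last r) \<le> rk x"
    using r x by (auto simp: subset_iff)
  ultimately have "hd r = last r" by (auto simp: adj_iff)
  then show False using r by (cases r) (auto split: if_splits)
qed

lemma child_rel_iff:
  "(u, v) \<in> child_rel T \<longleftrightarrow> u \<in> verts T \<and> v \<in> verts T \<and> rk v = Suc (rk u) \<and> par v = u"
  by (auto simp: child_rel_def adj_iff depth_eq)

lemma rooted_tree: "rooted_tree T"
proof
  show "root T \<in> verts T" by (rule root_V)
  fix u v
  show "u \<in> verts T \<and> v \<in> verts T" if "adj T u v" using that by (simp add: adj_iff)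
  show "adj T v u" if "adj T u v" using that by (rule sym)
  show "\<not> adj T v v" by (auto simp: adj_iff)
  show "\<exists>p. walk T p \<and> hd p = u \<and> last p = v" if uv: "u \<in> verts T" "v \<in> verts T"
  proof -
    obtain p where p: "walk T p" "hd p = root T" "last p = u" using walk_from_root[OF uv(1)] by auto
    obtain r where r: "walk T r" "hd r = root T" "last r = v" using walk_from_root[OF uv(2)] by auto
    have "p \<noteq> []" using p(1) by (auto simp: walk_def)
    then show ?thesis
      using walk_join[OF walk_rev[OF sym p(1)] r(1)] p r by (simp add: last_rev hd_rev)
  qed
  show "\<not> (\<exists>p. walk T p \<and> distinct p \<and> 3 \<le> length p \<and> adj T (last p) (hd p))"
    using no_cycle by blast
  show "finite {w. adj T v w}" if v: "v \<in> verts T"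
  proof (rule finite_subset)
    show "{w. adj T v w} \<subseteq> insert (par v) {w \<in> verts T. rk w = Suc (rk v) \<and> par w = v}"
      by (auto simp: adj_iff)
  qed (use finite_children v in simp)
  show "\<exists>w. (v, w) \<in> child_rel T" if v: "v \<in> verts T"
    using ex_child[OF v] v by (auto simp: child_rel_iff)
qed

end

section \<open>Rays in rooted trees\<close>

context rooted_tree
begin

lemma depth_ex:
  assumes "v \<in> verts T"
  shows "\<exists>p. walk T p \<and> hd p = root T \<and> last p = v \<and> length p = Suc (depth T v)"
proof -
  obtain p where p: "walk T p" "hd p = root T" "last p = v"
    using connected[OF root_in_verts assms] by blast
  then have "p \<noteq> []" by (auto simp: walk_def)
  then have "length p = Suc (length p - 1)" by (cases p) auto
  then have "\<exists>n p. walk T p \<and> hd p = root T \<and> last p = v \<and> length p = Suc n"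
    using p by blast
  then show ?thesis unfolding depth_def by (rule LeastI_ex)
qed

lemma depth_le:
  assumes "walk T p" "hd p = root T" "length p = Suc n"
  shows "depth T (last p) \<le> n"
  unfolding depth_def using assms by (intro Least_le) auto

lemma depth_root [simp]: "depth T (root T) = 0"
  using depth_le[of "[root T]" 0] root_in_verts by simp

lemma depth_0:
  assumes "v \<in> verts T" "depth T v = 0"
  shows "v = root T"
proof -
  obtain p where "walk T p" "hd p = root T" "last p = v" "length p = Suc 0"
    using depth_ex[OF assms(1)] assms(2) by auto
  then show ?thesis by (cases p) auto
qed

lemma depth_adj_le:
  assumes "adj T u v"
  shows "depth T v \<le> Suc (depth T u)"
proof -
  obtain p where p: "walk T p" "hd p = root T" "last p = u" "length p = Suc (depth T u)"
    using depth_ex adj_in_verts[OF assms] by blast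
  then have "walk T (p @ [v])" using assms adj_in_verts[OF assms] by (intro walk_append) auto
  moreover have "p \<noteq> []" using p by auto
  ultimately show ?thesis using depth_le[of "p @ [v]"] p by simp
qed

lemma ex_parent:
  assumes "v \<in> verts T" "depth T v = Suc n"
  shows "\<exists>u. adj T u v \<and> depth T u = n"
proof -
  obtain p where p: "walk T p" "hd p = root T" "last p = v" "length p = Suc (Suc n)"
    using depth_ex[OF assms(1)] assms(2) by auto
  then obtain r where r: "p = r @ [v]" "r \<noteq> []"
    by (cases p rule: rev_cases) fastforce+
  then have w: "walk T r" "adj T (last r) v" "hd r = root T" "length r = Suc n"
    using p by (auto simp: walk_def successively_append_iff)
  have "depth T (last r) \<le> n" using depth_le w by blast
  moreover have "Suc n \<le> Suc (depth T (last r))" using depth_adj_le[OF w(2)] assms by simp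
  ultimately show ?thesis using w by (intro exI[of _ "last r"]) auto
qed

text \<open>Climb from both vertices until the ancestors meet. As the walk stays at depth at most n,
  it can be closed to a cycle by an edge between its ends or by a common child of them; this
  excludes edges inside a level and second parents.\<close>

lemma walk_same_depth:
  assumes "u \<in> verts T" "v \<in> verts T" "depth T u = n" "depth T v = n" "u \<noteq> v"
  shows "\<exists>p. walk T p \<and> hd p = u \<and> last p = v \<and> distinct p \<and> 3 \<le> length p \<and> (\<forall>w\<in>set p. depth T w \<le> n)"
  using assms
proof (induction n arbitrary: u v)
  case 0
  then show ?case using depth_0 by metis
next
  case (Suc n)
  obtain u' v' where u': "adj T u' u" "depth T u' = n" and v': "adj T v' v" "depth T v' = n"
    using ex_parent Suc.prems by metis
  have V: "u' \<in> verts T" "v' \<in> verts T" using u' v' adj_in_verts by blast+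
  have "\<exists>p. walk T p \<and> hd p = u' \<and> last p = v' \<and> distinct p \<and> (\<forall>w\<in>set p. depth T w \<le> n)"
  proof (cases "u' = v'")
    case True
    then show ?thesis using V u' by (intro exI[of _ "[u']"]) auto
  next
    case False
    then show ?thesis using Suc.IH[of u' v'] V u' v' by blast
  qed
  then obtain p where p: "walk T p" "hd p = u'" "last p = v'" "distinct p" "\<forall>w\<in>set p. depth T w \<le> n"
    by blast
  have "walk T ([u] @ p @ [v])"
    using p u' v' Suc.prems adj_sym by (intro walk_append) (auto simp: walk_def)
  moreover have "distinct ([u] @ p @ [v])" using p Suc.prems by auto
  moreover have "3 \<le> length ([u] @ p @ [v])" using p by (cases p) (auto simp: walk_def)
  moreover have "\<forall>w\<in>set ([u] @ p @ [v]). depth T w \<le> Suc n" using p Suc.prems by auto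
  ultimately show ?case by (intro exI[of _ "[u] @ p @ [v]"]) auto
qed

lemma adj_depth_neq:
  assumes "adj T u v"
  shows "depth T u \<noteq> depth T v"
proof
  assume d: "depth T u = depth T v"
  have "u \<noteq> v" using assms adj_irrefl by metis
  then obtain p where "walk T p" "hd p = u" "last p = v" "distinct p" "3 \<le> length p"
    using walk_same_depth[of u v] adj_in_verts[OF assms] d by metis
  then show False using acyclic adj_sym[OF assms] by blast
qed

lemma parent_unique:
  assumes "adj T u w" "adj T v w" "depth T w = Suc n" "depth T u = n" "depth T v = n"
  shows "u = v"
proof (rule ccontr)
  assume "u \<noteq> v"
  then obtain p where p: "walk T p" "hd p = u" "last p = v" "distinct p" "3 \<le> length p"
    "\<forall>w\<in>set p. depth T w \<le> n"
    using walk_same_depth[of u v n] adj_in_verts assms by metis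
  have "walk T (w # p)" using walk_append[of T "[w]" p] p assms adj_sym adj_in_verts by auto
  moreover have "distinct (w # p)" using p assms by auto
  ultimately show False using acyclic p assms by (metis (no_types, lifting) last_ConsR length_Cons
    le_SucI list.sel(1) list.size(3) not_numeral_le_zero)
qed

definition parent :: "'v \<Rightarrow> 'v" where
  "parent v = (SOME u. adj T u v \<and> Suc (depth T u) = depth T v)"

lemma parent:
  assumes "v \<in> verts T" "depth T v = Suc n"
  shows "adj T (parent v) v" "parent v \<in> verts T" "depth T (parent v) = n"
proof -
  have "\<exists>u. adj T u v \<and> Suc (depth T u) = depth T v" using ex_parent[OF assms] assms by metis
  then have *: "adj T (parent v) v \<and> Suc (depth T (parent v)) = depth T v"
    unfolding parent_def by (rule someI_ex)
  then show "adj T (parent v) v" "depth T (parent v) = n" using assms by auto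
  then show "parent v \<in> verts T" using adj_in_verts by blast
qed

lemma adj_cases:
  assumes "adj T u v"
  shows "depth T v = Suc (depth T u) \<and> parent v = u \<or> depth T u = Suc (depth T v) \<and> parent u = v"
proof -
  have V: "u \<in> verts T" "v \<in> verts T" using adj_in_verts[OF assms] by auto
  consider "depth T v = Suc (depth T u)" | "depth T u = Suc (depth T v)"
    using depth_adj_le[OF assms] depth_adj_le[OF adj_sym[OF assms]] adj_depth_neq[OF assms]
    by linarith
  then show ?thesis
  proof cases
    case 1
    then show ?thesis using parent[OF V(2) 1] parent_unique assms by metis
  next
    case 2
    then show ?thesis using parent[OF V(1) 2] parent_unique adj_sym[OF assms] by metis
  qed
qed

lemma ranked: "ranked_tree T (depth T) parent"
proof
  show "root T \<in> verts T" by (rule root_in_verts)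
  show "depth T (root T) = 0" by simp
  fix u v n
  show "v = root T" if "v \<in> verts T" "depth T v = 0" using that by (rule depth_0)
  show "parent v \<in> verts T \<and> depth T (parent v) = n" if "v \<in> verts T" "depth T v = Suc n"
    using parent[OF that] by simp
  show *: "adj T u v \<longleftrightarrow> u \<in> verts T \<and> v \<in> verts T \<and>
      (depth T v = Suc (depth T u) \<and> parent v = u \<or> depth T u = Suc (depth T v) \<and> parent u = v)" for u v
    using adj_cases[of u v] adj_in_verts[of u v] parent(1)[of u] parent(1)[of v] adj_sym[of v u] by blast
  assume v: "v \<in> verts T"
  show "finite {w \<in> verts T. depth T w = Suc (depth T v) \<and> parent w = v}"
    by (rule finite_subset[OF _ locally_finite[OF v]]) (use v in \<open>auto simp: *\<close>)
  show "\<exists>w\<in>verts T. depth T w = Suc (depth T v) \<and> parent w = v"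
  proof -
    obtain w where w: "w \<in> verts T" "adj T v w" "depth T w = Suc (depth T v)"
      using no_leaves[OF v] by (auto simp: child_rel_def)
    then show ?thesis using adj_cases[of v w] by auto
  qed
qed

sublocale ranked_tree T "depth T" parent
  by (rule ranked)

text \<open>A ray without backtracking can only descend: the single neighbour of smaller depth is
  the parent, and the ray has just come from there.\<close>

lemma boundary_ray:
  assumes "\<xi> \<in> boundary T"
  shows "\<xi> n \<in> verts T" "depth T (\<xi> n) = n" "parent (\<xi> (Suc n)) = \<xi> n"
proof -
  have 0: "\<xi> 0 = root T" and a: "\<And>n. adj T (\<xi> n) (\<xi> (Suc n))" and nb: "\<And>n. \<xi> (Suc (Suc n)) \<noteq> \<xi> n"
    using assms by (auto simp: boundary_def)
  have *: "depth T (\<xi> n) = n \<and> depth T (\<xi> (Suc n)) = Suc n" for n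
  proof (induction n)
    case 0
    then show ?case using adj_cases[OF a[of 0]] \<open>\<xi> 0 = root T\<close> by auto
  next
    case (Suc n)
    then have "parent (\<xi> (Suc n)) = \<xi> n" using adj_cases[OF a[of n]] by auto
    then have "parent (\<xi> (Suc n)) \<noteq> \<xi> (Suc (Suc n))" using nb by metis
    then show ?case using adj_cases[OF a[of "Suc n"]] Suc by auto
  qed
  show "depth T (\<xi> n) = n" using * by blast
  show "\<xi> n \<in> verts T" using a adj_in_verts by blast
  show "parent (\<xi> (Suc n)) = \<xi> n" using adj_cases[OF a[of n]] *[of n] by auto
qed

lemma boundary_iff:
  "\<xi> \<in> boundary T \<longleftrightarrow> (\<forall>n. \<xi> n \<in> verts T \<and> depth T (\<xi> n) = n \<and> parent (\<xi> (Suc n)) = \<xi> n)"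
proof
  assume "\<xi> \<in> boundary T"
  then show "\<forall>n. \<xi> n \<in> verts T \<and> depth T (\<xi> n) = n \<and> parent (\<xi> (Suc n)) = \<xi> n"
    using boundary_ray by blast
next
  assume *: "\<forall>n. \<xi> n \<in> verts T \<and> depth T (\<xi> n) = n \<and> parent (\<xi> (Suc n)) = \<xi> n"
  moreover have "\<xi> (Suc (Suc n)) \<noteq> \<xi> n" for n
    using * by (metis lessI less_SucI less_irrefl)
  ultimately show "\<xi> \<in> boundary T" unfolding boundary_def using depth_0 by (auto simp: adj_iff)
qed

text \<open>A vertex determines its ancestors through repeated parents. So
  \<open>\<xi> n = \<eta> n\<close> alone expresses agreement up to level n, and it is used in this
  sense from here on.\<close>

lemma ray_prefix:
  assumes "\<xi> \<in> boundary T" "\<eta> \<in> boundary T" "\<xi> n = \<eta> n" "m \<le> n"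
  shows "\<xi> m = \<eta> m"
  using assms(4,3)
proof (induction rule: inc_induct)
  case (step k)
  then show ?case using boundary_ray(3)[of _ k] assms by metis
qed simp

lemma ex_ray:
  assumes "v \<in> verts T"
  shows "\<exists>\<xi>\<in>boundary T. \<xi> (depth T v) = v"
proof -
  obtain c where c: "\<And>u. u \<in> verts T \<Longrightarrow> c u \<in> verts T \<and> depth T (c u) = Suc (depth T u) \<and> parent (c u) = u"
    using ex_child by metis
  have "\<exists>s. s 0 = v \<and> (\<forall>n. s n \<in> verts T \<and> depth T (s n) = depth T v + n \<and> parent (s (Suc n)) = s n)"
  proof -
    have "(c ^^ n) v \<in> verts T \<and> depth T ((c ^^ n) v) = depth T v + n" for n
      by (induction n) (use assms c in auto)
    then show ?thesis using c by (intro exI[of _ "\<lambda>n. (c ^^ n) v"]) auto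
  qed
  then obtain s where s: "s 0 = v"
    "\<And>n. s n \<in> verts T" "\<And>n. depth T (s n) = depth T v + n" "\<And>n. parent (s (Suc n)) = s n"
    by blast
  have up: "i \<le> depth T v \<Longrightarrow> (parent ^^ i) v \<in> verts T \<and> depth T ((parent ^^ i) v) = depth T v - i" for i
  proof (induction i)
    case (Suc i)
    then show ?case using parent[of "(parent ^^ i) v" "depth T v - Suc i"] by auto
  qed (use assms in simp)
  define \<xi> where "\<xi> n = (if n \<le> depth T v then (parent ^^ (depth T v - n)) v else s (n - depth T v))" for n
  have "\<xi> n \<in> verts T \<and> depth T (\<xi> n) = n \<and> parent (\<xi> (Suc n)) = \<xi> n" for n
  proof -
    have "parent (\<xi> (Suc n)) = \<xi> n"
    proof (cases "n < depth T v")
      case True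
      then have "depth T v - n = Suc (depth T v - Suc n)" by simp
      then show ?thesis using True by (simp add: \<xi>_def)
    next
      case False
      then show ?thesis using s(1) s(4)[of "n - depth T v"] by (auto simp: \<xi>_def Suc_diff_le)
    qed
    then show ?thesis using up[of "depth T v - n"] s by (auto simp: \<xi>_def)
  qed
  then have "\<xi> \<in> boundary T" by (simp add: boundary_iff)
  then show ?thesis by (intro bexI[of _ \<xi>]) (auto simp: \<xi>_def)
qed

lemma boundary_nonempty: "boundary T \<noteq> {}"
  using ex_ray[OF root_in_verts] by blast

lemma level_eq: "level T n = (\<lambda>\<xi>. \<xi> n) ` boundary T"
proof -
  have "v \<in> (\<lambda>\<xi>. \<xi> n) ` boundary T" if "v \<in> verts T" "depth T v = n" for v
    using ex_ray[OF that(1)] that(2) by (metis image_eqI)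
  then show ?thesis by (auto simp: level_def boundary_ray)
qed

lemma finite_level: "finite (level T n)"
proof (induction n)
  case 0
  have "level T 0 \<subseteq> {root T}" using depth_0 by (auto simp: level_def)
  then show ?case by (rule finite_subset) simp
next
  case (Suc n)
  have "level T (Suc n) \<subseteq> (\<Union>u\<in>level T n. {w. adj T u w})"
  proof
    fix v assume "v \<in> level T (Suc n)"
    then have v: "v \<in> verts T" "depth T v = Suc n" by (auto simp: level_def)
    show "v \<in> (\<Union>u\<in>level T n. {w. adj T u w})"
      using parent[OF v] by (auto simp: level_def)
  qed
  then show ?case using Suc locally_finite by (elim finite_subset) (auto simp: level_def)
qed

lemma verts_eq: "verts T = (\<Union>n. level T n)"
  by (auto simp: level_def)

lemma countable_verts: "countable (verts T)"
  unfolding verts_eq using finite_level by (intro countable_UN) (auto intro: countable_finite)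

text \<open>This translates descendants into rays, so that rigid stabilizers can later be described
  on the boundary alone.\<close>

lemma subtree_ray:
  assumes "\<xi> \<in> boundary T" "v \<in> verts T"
  shows "\<xi> m \<in> subtree T v \<longleftrightarrow> depth T v \<le> m \<and> \<xi> (depth T v) = v"
proof
  have "depth T v \<le> depth T w \<and> (\<forall>\<eta>\<in>boundary T. \<eta> (depth T w) = w \<longrightarrow> \<eta> (depth T v) = v)"
    if "(v, w) \<in> (child_rel T)\<^sup>*" for w
    using that
  proof induction
    case (step w x)
    have "\<eta> (depth T w) = w" if "\<eta> \<in> boundary T" "\<eta> (depth T x) = x" for \<eta>
      using boundary_ray(3)[OF that(1), of "depth T w"] that(2) step(2) by (simp add: child_rel_iff)
    then show ?case using step by (auto simp: child_rel_iff)
  qed simp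
  from this[of "\<xi> m"] show "depth T v \<le> m \<and> \<xi> (depth T v) = v" if "\<xi> m \<in> subtree T v"
    using that assms boundary_ray by (auto simp: subtree_def)
next
  have "(\<xi> (depth T v), \<xi> (depth T v + k)) \<in> (child_rel T)\<^sup>*" for k
  proof (induction k)
    case (Suc k)
    have "(\<xi> (depth T v + k), \<xi> (depth T v + Suc k)) \<in> child_rel T"
      using boundary_ray assms by (auto simp: child_rel_iff)
    with Suc show ?case by (rule rtrancl_into_rtrancl)
  qed simp
  from this[of "m - depth T v"] show "\<xi> m \<in> subtree T v" if "depth T v \<le> m \<and> \<xi> (depth T v) = v"
    using that by (simp add: subtree_def)
qed

lemma cylinder_eq:
  assumes "v \<in> verts T"
  shows "cylinder T v = {\<xi> \<in> boundary T. \<xi> (depth T v) = v}"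
proof -
  have "v \<in> range \<xi> \<longleftrightarrow> \<xi> (depth T v) = v" if "\<xi> \<in> boundary T" for \<xi>
    using boundary_ray(2)[OF that] by (metis rangeE rangeI)
  then show ?thesis by (auto simp: cylinder_def)
qed

end

section \<open>Subgroups of finite index\<close>

lemma finite_image_reps:
  assumes "finite (f ` A)"
  obtains B where "B \<subseteq> A" "finite B" "f ` A = f ` B"
  using finite_subset_image[OF assms order_refl] by metis

text \<open>For \<open>K \<subseteq> H\<close> this is finite index, but \<open>K\<close> and \<open>H\<close> need not be nested.\<close>

definition finite_cover :: "('a, 'm) monoid_scheme \<Rightarrow> 'a set \<Rightarrow> 'a set \<Rightarrow> bool" where
  "finite_cover G K H \<longleftrightarrow>
     (\<exists>S. finite S \<and> S \<subseteq> carrier G \<and> (\<forall>g\<in>H. \<exists>s\<in>S. g \<otimes>\<^bsub>G\<^esub> inv\<^bsub>G\<^esub> s \<in> K))"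

context group
begin

lemma rcoset_eq_iff:
  assumes "subgroup K G" "g \<in> carrier G" "h \<in> carrier G"
  shows "K #> g = K #> h \<longleftrightarrow> g \<otimes> inv h \<in> K"
proof
  assume "K #> g = K #> h"
  then have "g \<in> K #> h" using rcos_self assms by blast
  then show "g \<otimes> inv h \<in> K"
    using assms subgroup.mem_carrier[OF assms(1)] by (auto simp: r_coset_def m_assoc)
next
  assume "g \<otimes> inv h \<in> K"
  then have "(g \<otimes> inv h) \<otimes> h \<in> K #> h" by (auto simp: r_coset_def)
  then have "g \<in> K #> h" using assms by (simp add: m_assoc)
  then show "K #> g = K #> h" using repr_independence assms by metis
qed

lemma finite_rcosets_iff_finite_cover:
  assumes K: "subgroup K G"
  shows "finite (rcosets K) \<longleftrightarrow> finite_cover G K (carrier G)"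
proof
  assume "finite (rcosets K)"
  then have "finite ((\<lambda>g. K #> g) ` carrier G)" by (simp add: RCOSETS_def UNION_singleton_eq_range)
  then obtain S where S: "S \<subseteq> carrier G" "finite S" "(\<lambda>g. K #> g) ` carrier G = (\<lambda>g. K #> g) ` S"
    by (rule finite_image_reps)
  have "\<exists>s\<in>S. g \<otimes> inv s \<in> K" if "g \<in> carrier G" for g
  proof -
    have "K #> g \<in> (\<lambda>g. K #> g) ` S" using S(3) that by blast
    then show ?thesis using rcoset_eq_iff[OF K that] S(1) by blast
  qed
  then show "finite_cover G K (carrier G)" using S by (auto simp: finite_cover_def)
next
  assume "finite_cover G K (carrier G)"
  then obtain S where S: "finite S" "S \<subseteq> carrier G" "\<forall>g\<in>carrier G. \<exists>s\<in>S. g \<otimes> inv s \<in> K"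
    by (auto simp: finite_cover_def)
  have "rcosets K \<subseteq> (\<lambda>g. K #> g) ` S"
  proof
    fix C assume "C \<in> rcosets K"
    then obtain g where g: "g \<in> carrier G" "C = K #> g" by (auto simp: RCOSETS_def)
    then obtain s where "s \<in> S" "g \<otimes> inv s \<in> K" using S by blast
    then show "C \<in> (\<lambda>g. K #> g) ` S" using rcoset_eq_iff[OF K g(1)] S(2) g by blast
  qed
  then show "finite (rcosets K)" by (rule finite_subset) (use S in simp)
qed

lemma finite_cover_trans:
  assumes "finite_cover G K H" "finite_cover G L K" "H \<subseteq> carrier G"
  shows "finite_cover G L H"
proof -
  obtain S where S: "finite S" "S \<subseteq> carrier G" "\<forall>g\<in>H. \<exists>s\<in>S. g \<otimes> inv s \<in> K"
    using assms by (auto simp: finite_cover_def)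
  obtain R where R: "finite R" "R \<subseteq> carrier G" "\<forall>g\<in>K. \<exists>s\<in>R. g \<otimes> inv s \<in> L"
    using assms by (auto simp: finite_cover_def)
  let ?S = "(\<lambda>(r, s). r \<otimes> s) ` (R \<times> S)"
  have "\<exists>s\<in>?S. g \<otimes> inv s \<in> L" if g: "g \<in> H" for g
  proof -
    obtain s where s: "s \<in> S" "g \<otimes> inv s \<in> K" using S g by blast
    then obtain r where r: "r \<in> R" "g \<otimes> inv s \<otimes> inv r \<in> L" using R by blast
    have "g \<otimes> inv (r \<otimes> s) = g \<otimes> inv s \<otimes> inv r"
      using r s S R g assms(3) by (auto simp: inv_mult_group m_assoc subset_iff)
    then show ?thesis using r s by (intro bexI[of _ "r \<otimes> s"]) auto
  qed
  then show ?thesis unfolding finite_cover_def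
    using S R by (intro exI[of _ ?S]) (auto simp: subset_iff)
qed

lemma finite_cover_mono:
  assumes "finite_cover G K H" "K \<subseteq> K'" "H' \<subseteq> H"
  shows "finite_cover G K' H'"
  using assms unfolding finite_cover_def by (meson subsetD)

text \<open>The intersection is the kernel of q restricted to R, so one element of R for each of the
  finitely many values suffices.\<close>

lemma finite_cover_kernel:
  assumes q: "q \<in> hom G F" "group F" "finite (carrier F)"
    and R: "subgroup R G"
  shows "finite_cover G (R \<inter> kernel G F q) R"
proof -
  interpret F: group F by (rule q(2))
  interpret q: group_hom G F q using q(1) by unfold_locales
  have sub: "R \<subseteq> carrier G" using R by (rule subgroup.subset)
  then have "q ` R \<subseteq> carrier F" by auto
  then have "finite (q ` R)" using q(3) by (rule finite_subset)
  then obtain S where S: "S \<subseteq> R" "finite S" "q ` R = q ` S"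
    by (rule finite_image_reps)
  have "\<exists>s\<in>S. g \<otimes> inv s \<in> R \<inter> kernel G F q" if g: "g \<in> R" for g
  proof -
    obtain s where s: "s \<in> S" "q g = q s" using S(3) g by blast
    then have "s \<in> R" "s \<in> carrier G" "g \<in> carrier G" using S g sub by auto
    then show ?thesis using s g R
      by (intro bexI[of _ s]) (auto simp: kernel_def intro: subgroup.m_closed subgroup.m_inv_closed)
  qed
  then show ?thesis unfolding finite_cover_def using S sub by (intro exI[of _ S]) auto
qed

text \<open>The centralizer of z is a subgroup.\<close>

lemma generate_commute:
  assumes "A \<subseteq> carrier G" "z \<in> carrier G" "\<And>x. x \<in> A \<Longrightarrow> x \<otimes> z = z \<otimes> x" "y \<in> generate G A"
  shows "y \<otimes> z = z \<otimes> y"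
  using assms(4)
proof induction
  case (inv h)
  then have "h \<in> carrier G" "h \<otimes> z = z \<otimes> h" using assms by auto
  then have "inv h \<otimes> (h \<otimes> z) \<otimes> inv h = inv h \<otimes> (z \<otimes> h) \<otimes> inv h" by simp
  moreover have "inv h \<otimes> (h \<otimes> z) \<otimes> inv h = z \<otimes> inv h"
    using \<open>h \<in> carrier G\<close> assms(2) by (simp add: m_assoc[symmetric])
  moreover have "inv h \<otimes> (z \<otimes> h) \<otimes> inv h = inv h \<otimes> z"
    using \<open>h \<in> carrier G\<close> assms(2) by (simp add: m_assoc)
  ultimately show ?case by simp
next
  case (eng h1 h2)
  then have "h1 \<in> carrier G" "h2 \<in> carrier G" using generate_in_carrier assms(1) by auto
  then show ?case using eng.IH assms(2) by (metis m_assoc)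
qed (use assms in auto)

text \<open>As R commutes with A, the products of an element of R and one generated by A already
  form a subgroup.\<close>

lemma generate_Un_commute:
  assumes R: "subgroup R G" and A: "A \<subseteq> carrier G"
    and comm: "\<And>r x. r \<in> R \<Longrightarrow> x \<in> A \<Longrightarrow> x \<otimes> r = r \<otimes> x"
    and z: "z \<in> generate G (R \<union> A)"
  shows "\<exists>r\<in>R. \<exists>y\<in>generate G A. z = r \<otimes> y"
proof -
  have inR: "\<exists>r\<in>R. \<exists>y\<in>generate G A. h = r \<otimes> y" if "h \<in> R" for h
    using that subgroup.mem_carrier[OF R] generate.one[of G A] by (intro bexI[of _ h] bexI[of _ \<one>]) auto
  have inA: "\<exists>r\<in>R. \<exists>y\<in>generate G A. h = r \<otimes> y" if "h \<in> generate G A" for h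
    using that subgroup.one_closed[OF R] generate_in_carrier[OF A that] by (intro bexI[of _ h] bexI[of _ \<one>]) auto
  from z show ?thesis
  proof induction
    case one
    show ?case by (rule inR[OF subgroup.one_closed[OF R]])
  next
    case (incl h)
    then show ?case using inR inA[OF generate.incl] by blast
  next
    case (inv h)
    then show ?case using inR[OF subgroup.m_inv_closed[OF R]] inA[OF generate.inv] by blast
  next
    case (eng h1 h2)
    from eng.IH(1) obtain r1 y1 where 1: "r1 \<in> R" "y1 \<in> generate G A" "h1 = r1 \<otimes> y1" by blast
    from eng.IH(2) obtain r2 y2 where 2: "r2 \<in> R" "y2 \<in> generate G A" "h2 = r2 \<otimes> y2" by blast
    note * = 1 2
    have c: "r1 \<in> carrier G" "r2 \<in> carrier G" "y1 \<in> carrier G" "y2 \<in> carrier G"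
      using * subgroup.mem_carrier[OF R] generate_in_carrier[OF A] by auto
    have "y1 \<otimes> r2 = r2 \<otimes> y1"
      by (rule generate_commute[OF A c(2) _ 1(2)]) (rule comm[OF 2(1)])
    then have "r1 \<otimes> y1 \<otimes> (r2 \<otimes> y2) = (r1 \<otimes> r2) \<otimes> (y1 \<otimes> y2)"
      using c by (simp add: m_assoc) (simp add: m_assoc[symmetric])
    then show ?case using * subgroup.m_closed[OF R] generate.eng by metis
  qed
qed

text \<open>
  The coset representatives of \<open>M i\<close> can be chosen inside \<open>R i\<close>; then they commute with the
  other factors.
\<close>

lemma finite_cover_commuting:
  assumes "finite I"
    and R: "\<And>i. i \<in> I \<Longrightarrow> subgroup (R i) G" and M: "\<And>i. i \<in> I \<Longrightarrow> M i \<subseteq> R i"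
    and fc: "\<And>i. i \<in> I \<Longrightarrow> finite_cover G (M i) (R i)"
    and comm: "\<And>i j x y. i \<in> I \<Longrightarrow> j \<in> I \<Longrightarrow> i \<noteq> j \<Longrightarrow> x \<in> R i \<Longrightarrow> y \<in> R j \<Longrightarrow> x \<otimes> y = y \<otimes> x"
  shows "finite_cover G (generate G (\<Union>i\<in>I. M i)) (generate G (\<Union>i\<in>I. R i))"
  using assms
proof (induction I)
  case empty
  then show ?case unfolding finite_cover_def by (intro exI[of _ "{\<one>}"]) (simp add: generate_empty)
next
  case (insert c I)
  have "finite_cover G (generate G (\<Union>i\<in>I. M i)) (generate G (\<Union>i\<in>I. R i))"
    by (intro insert.IH) (rule insert.prems; simp; fail)+
  then obtain S where S: "finite S" "S \<subseteq> carrier G"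
    "\<And>y. y \<in> generate G (\<Union>i\<in>I. R i) \<Longrightarrow> \<exists>s\<in>S. y \<otimes> inv s \<in> generate G (\<Union>i\<in>I. M i)"
    unfolding finite_cover_def by blast
  have Rc: "subgroup (R c) G" "M c \<subseteq> R c" using insert.prems by auto
  obtain S0 where S0: "finite S0" "S0 \<subseteq> carrier G" "\<forall>y\<in>R c. \<exists>s\<in>S0. y \<otimes> inv s \<in> M c"
    using insert.prems(3)[of c] unfolding finite_cover_def by blast
  \<comment> \<open>Nothing is lost by intersecting with \<open>R c\<close>: a representative s that
    serves y in \<open>R c\<close> equals \<open>inv (y \<otimes> inv s) \<otimes> y\<close>, and
    both factors lie in \<open>R c\<close>.\<close>
  define Sc where "Sc = S0 \<inter> R c"
  have Sc: "finite Sc" "Sc \<subseteq> R c" "Sc \<subseteq> carrier G" using S0 by (auto simp: Sc_def)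
  have Sc': "\<exists>s\<in>Sc. y \<otimes> inv s \<in> M c" if y: "y \<in> R c" for y
  proof -
    obtain s where s: "s \<in> S0" "y \<otimes> inv s \<in> M c" using S0 y by blast
    have c: "s \<in> carrier G" "y \<in> carrier G" using s S0 y subgroup.mem_carrier[OF Rc(1)] by auto
    have "inv (y \<otimes> inv s) \<otimes> y \<in> R c"
      using s Rc y by (auto intro: subgroup.m_closed subgroup.m_inv_closed)
    then have "s \<in> R c" using c by (simp add: inv_mult_group m_assoc)
    then show ?thesis using s by (auto simp: Sc_def)
  qed
  have A: "(\<Union>i\<in>I. R i) \<subseteq> carrier G" "(\<Union>i\<in>I. M i) \<subseteq> carrier G"
    using insert.prems(1,2) subgroup.subset by (force intro: subgroup.mem_carrier)+
  have com: "x \<otimes> r = r \<otimes> x" if "r \<in> R c" "x \<in> (\<Union>i\<in>I. R i)" for r x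
    using that insert.hyps insert.prems(4) by (metis UN_iff insertI1 insertI2)
  let ?S = "(\<lambda>(r, s). r \<otimes> s) ` (Sc \<times> S)"
  let ?M = "generate G (\<Union>i\<in>insert c I. M i)"
  have "\<exists>s\<in>?S. z \<otimes> inv s \<in> ?M" if z: "z \<in> generate G (\<Union>i\<in>insert c I. R i)" for z
  proof -
    obtain r y where ry: "r \<in> R c" "y \<in> generate G (\<Union>i\<in>I. R i)" "z = r \<otimes> y"
      using generate_Un_commute[OF Rc(1) A(1) com, of z] z by auto
    obtain s where s: "s \<in> Sc" "r \<otimes> inv s \<in> M c" using Sc' ry by blast
    obtain t where t: "t \<in> S" "y \<otimes> inv t \<in> generate G (\<Union>i\<in>I. M i)" using S ry by blast
    have c: "r \<in> carrier G" "y \<in> carrier G" "s \<in> carrier G" "t \<in> carrier G"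
      using ry s t Sc S subgroup.mem_carrier[OF Rc(1)] generate_in_carrier[OF A(1)] by auto
    have "s \<in> R c" using s Sc by auto
    have "(y \<otimes> inv t) \<otimes> inv s = inv s \<otimes> (y \<otimes> inv t)"
    proof (rule generate_commute[OF A(2) _ _ t(2)])
      show "inv s \<in> carrier G" using c by simp
      have "inv s \<in> R c" using \<open>s \<in> R c\<close> Rc by (simp add: subgroup.m_inv_closed)
      then show "x \<otimes> inv s = inv s \<otimes> x" if "x \<in> (\<Union>i\<in>I. M i)" for x
        using com that insert.prems(2) by blast
    qed
    then have "z \<otimes> inv (s \<otimes> t) = (r \<otimes> inv s) \<otimes> (y \<otimes> inv t)"
      using c ry(3) by (simp add: inv_mult_group m_assoc)
    moreover have "r \<otimes> inv s \<in> ?M" using s(2) by (auto intro: generate.incl)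
    moreover have "y \<otimes> inv t \<in> ?M"
      using t(2) mono_generate[of "\<Union>i\<in>I. M i" "\<Union>i\<in>insert c I. M i"] by blast
    ultimately have "z \<otimes> inv (s \<otimes> t) \<in> ?M" by (simp add: generate.eng)
    then show ?thesis using s t by (intro bexI[of _ "s \<otimes> t"]) auto
  qed
  moreover have "finite ?S" "?S \<subseteq> carrier G" using S Sc by (auto simp: subset_iff)
  ultimately show ?case unfolding finite_cover_def by blast
qed

end

lemma (in group_hom) finite_rcosets_pullback:
  assumes "inj_on h (carrier G)" "subgroup K G" "finite_cover H (h ` K) (h ` carrier G)"
  shows "finite (rcosets\<^bsub>G\<^esub> K)"
proof -
  obtain S where S: "finite S" "S \<subseteq> carrier H"
    "\<And>g. g \<in> carrier G \<Longrightarrow> \<exists>s\<in>S. h g \<otimes>\<^bsub>H\<^esub> inv\<^bsub>H\<^esub> s \<in> h ` K"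
    using assms(3) by (auto simp: finite_cover_def)
  then obtain s where s: "\<And>g. g \<in> carrier G \<Longrightarrow> s g \<in> S \<and> h g \<otimes>\<^bsub>H\<^esub> inv\<^bsub>H\<^esub> s g \<in> h ` K"
    by metis
  have "finite (s ` carrier G)" using s S(1) by (auto intro: finite_subset)
  then obtain R where R: "R \<subseteq> carrier G" "finite R" "s ` carrier G = s ` R"
    by (rule finite_image_reps)
  have "\<exists>r\<in>R. g \<otimes> inv r \<in> K" if g: "g \<in> carrier G" for g
  proof -
    obtain r where r: "r \<in> R" "s g = s r" using R(3) g by blast
    have rc: "r \<in> carrier G" using r R by auto
    obtain a b where ab: "a \<in> K" "h g \<otimes>\<^bsub>H\<^esub> inv\<^bsub>H\<^esub> s g = h a" "b \<in> K" "h r \<otimes>\<^bsub>H\<^esub> inv\<^bsub>H\<^esub> s g = h b"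
      using s[OF g] s[OF rc] r by auto
    have c: "a \<in> carrier G" "b \<in> carrier G" using ab subgroup.mem_carrier[OF assms(2)] by auto
    have sc: "s g \<in> carrier H" using s[OF g] S by auto
    have "h (a \<otimes> inv b) = (h g \<otimes>\<^bsub>H\<^esub> inv\<^bsub>H\<^esub> s g) \<otimes>\<^bsub>H\<^esub> inv\<^bsub>H\<^esub> (h r \<otimes>\<^bsub>H\<^esub> inv\<^bsub>H\<^esub> s g)"
      using ab c by simp
    also have "\<dots> = h (g \<otimes> inv r)"
    proof -
      have "inv\<^bsub>H\<^esub> s g \<otimes>\<^bsub>H\<^esub> (s g \<otimes>\<^bsub>H\<^esub> y) = y" if "y \<in> carrier H" for y
        using sc that by (simp flip: H.m_assoc)
      then show ?thesis using sc g rc by (simp add: H.inv_mult_group H.m_assoc)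
    qed
    finally have "a \<otimes> inv b = g \<otimes> inv r"
      by (rule inj_onD[OF assms(1)]) (use c g rc in simp_all)
    then show ?thesis using ab assms(2) r
      by (metis subgroup.m_closed subgroup.m_inv_closed)
  qed
  then have "finite_cover G K (carrier G)" using R by (auto simp: finite_cover_def)
  then show ?thesis using G.finite_rcosets_iff_finite_cover[OF assms(2)] by simp
qed

lemma (in group_hom) finite_rcosets_image:
  assumes "inj_on h (carrier G)" "subgroup K G"
  shows "finite (rcosets\<^bsub>H\<lparr>carrier := h ` carrier G\<rparr>\<^esub> (h ` K)) \<longleftrightarrow> finite (rcosets\<^bsub>G\<^esub> K)"
proof -
  have K: "K \<subseteq> carrier G" using subgroup.subset[OF assms(2)] .
  have "rcosets\<^bsub>H\<lparr>carrier := h ` carrier G\<rparr>\<^esub> (h ` K) = (\<lambda>C. h ` C) ` (rcosets\<^bsub>G\<^esub> K)"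
  proof -
    have "h ` K #>\<^bsub>H\<lparr>carrier := h ` carrier G\<rparr>\<^esub> h g = h ` (K #> g)" if "g \<in> carrier G" for g
      using that K by (auto simp: r_coset_def image_iff subset_iff)
    then show ?thesis by (auto simp: RCOSETS_def image_iff)
  qed
  moreover have "inj_on (\<lambda>C. h ` C) (rcosets\<^bsub>G\<^esub> K)"
  proof (rule inj_onI)
    fix C D assume "C \<in> rcosets\<^bsub>G\<^esub> K" "D \<in> rcosets\<^bsub>G\<^esub> K" "h ` C = h ` D"
    then show "C = D"
      using inj_on_image_eq_iff[OF assms(1)] subgroup.rcosets_carrier[OF assms(2) G.group_axioms] by blast
  qed
  ultimately show ?thesis by (simp add: finite_image_iff)
qed

section \<open>Group actions on rooted trees\<close>

lemma one_TreeAuto: "\<one>\<^bsub>TreeAuto T\<^esub> = (\<lambda>v\<in>verts T. v)"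
  by (simp add: TreeAuto_def BijGroup_def)

lemma carrier_TreeAuto: "carrier (TreeAuto T) = tree_auto T"
  by (simp add: TreeAuto_def)

lemma tree_auto_Bij: "f \<in> tree_auto T \<Longrightarrow> f \<in> Bij (verts T)"
  by (simp add: tree_auto_def)

lemma mult_TreeAuto:
  assumes "f \<in> tree_auto T" "g \<in> tree_auto T"
  shows "f \<otimes>\<^bsub>TreeAuto T\<^esub> g = compose (verts T) f g"
  using assms by (simp add: TreeAuto_def BijGroup_def tree_auto_Bij)

lemma tree_auto_closed: "f \<in> tree_auto T \<Longrightarrow> v \<in> verts T \<Longrightarrow> f v \<in> verts T"
  by (auto simp: tree_auto_def Bij_def bij_betw_def)

lemma tree_auto_inj: "f \<in> tree_auto T \<Longrightarrow> inj_on f (verts T)"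
  by (auto simp: tree_auto_def Bij_def bij_betw_def)

lemma tree_auto_adj:
  "f \<in> tree_auto T \<Longrightarrow> u \<in> verts T \<Longrightarrow> v \<in> verts T \<Longrightarrow> adj T (f u) (f v) \<longleftrightarrow> adj T u v"
  by (simp add: tree_auto_def)

context rooted_tree
begin

lemma subgroup_tree_auto: "subgroup (tree_auto T) (BijGroup (verts T))"
proof -
  interpret B: group "BijGroup (verts T)" by (rule group_BijGroup)
  show ?thesis
  proof (rule B.subgroupI)
    show "tree_auto T \<subseteq> carrier (BijGroup (verts T))"
      by (auto simp: tree_auto_def BijGroup_def)
    have "(\<lambda>v\<in>verts T. v) \<in> tree_auto T"
      using root_in_verts by (simp add: tree_auto_def id_Bij)
    then show "tree_auto T \<noteq> {}" by blast
    fix f assume f: "f \<in> tree_auto T"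
    then have fB: "f \<in> Bij (verts T)" "bij_betw f (verts T) (verts T)" "f (root T) = root T"
      by (auto simp: tree_auto_def Bij_def)
    let ?g = "\<lambda>v\<in>verts T. inv_into (verts T) f v"
    have g: "?g v \<in> verts T" "f (?g v) = v" if "v \<in> verts T" for v
      using that fB(2) by (auto simp: bij_betw_def inv_into_into f_inv_into_f)
    have "?g (root T) = root T"
      using fB root_in_verts by (auto simp: bij_betw_def intro: inv_into_f_eq)
    moreover have "adj T (?g u) (?g v) \<longleftrightarrow> adj T u v" if "u \<in> verts T" "v \<in> verts T" for u v
      using g[OF that(1)] g[OF that(2)] tree_auto_adj[OF f, of "?g u" "?g v"] by metis
    ultimately have "?g \<in> tree_auto T"
      unfolding tree_auto_def using restrict_inv_into_Bij[OF fB(1)] by blast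
    then show "inv\<^bsub>BijGroup (verts T)\<^esub> f \<in> tree_auto T" using fB by (simp add: inv_BijGroup)
  next
    fix f g assume fg: "f \<in> tree_auto T" "g \<in> tree_auto T"
    have "compose (verts T) f g \<in> Bij (verts T)" using fg by (intro compose_Bij tree_auto_Bij)
    moreover have "compose (verts T) f g (root T) = root T"
      using fg root_in_verts by (simp add: compose_def tree_auto_def)
    moreover have "adj T (compose (verts T) f g u) (compose (verts T) f g v) \<longleftrightarrow> adj T u v"
      if "u \<in> verts T" "v \<in> verts T" for u v
      using that fg by (simp add: compose_def tree_auto_adj tree_auto_closed)
    ultimately have "compose (verts T) f g \<in> tree_auto T"
      unfolding tree_auto_def by blast
    then show "f \<otimes>\<^bsub>BijGroup (verts T)\<^esub> g \<in> tree_auto T"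
      using fg by (simp add: BijGroup_def tree_auto_Bij)
  qed
qed

lemma group_TreeAuto: "group (TreeAuto T)"
  unfolding TreeAuto_def
  by (rule subgroup.subgroup_is_group[OF subgroup_tree_auto group_BijGroup])

lemma tree_auto_boundary:
  assumes f: "f \<in> tree_auto T" and \<xi>: "\<xi> \<in> boundary T"
  shows "f \<circ> \<xi> \<in> boundary T"
proof -
  have V: "\<xi> n \<in> verts T" for n using boundary_ray(1)[OF \<xi>] .
  have "f (\<xi> (Suc (Suc n))) \<noteq> f (\<xi> n)" for n
    using \<xi> V inj_onD[OF tree_auto_inj[OF f]] by (fastforce simp: boundary_def)
  moreover have "adj T (f (\<xi> n)) (f (\<xi> (Suc n)))" for n
    using \<xi> V tree_auto_adj[OF f] by (simp add: boundary_def)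
  ultimately show ?thesis using f \<xi> by (simp add: boundary_def tree_auto_def)
qed

lemma tree_auto_depth:
  assumes f: "f \<in> tree_auto T" and v: "v \<in> verts T"
  shows "depth T (f v) = depth T v"
proof -
  obtain \<xi> where "\<xi> \<in> boundary T" "\<xi> (depth T v) = v" using ex_ray[OF v] by blast
  then show ?thesis using boundary_ray(2)[OF tree_auto_boundary[OF f], of \<xi> "depth T v"] by simp
qed

lemma tree_auto_ext:
  assumes f: "f \<in> tree_auto T" and g: "g \<in> tree_auto T"
    and eq: "\<And>\<xi>. \<xi> \<in> boundary T \<Longrightarrow> f \<circ> \<xi> = g \<circ> \<xi>"
  shows "f = g"
proof (rule extensionalityI)
  show "f \<in> extensional (verts T)" "g \<in> extensional (verts T)"
    using f g by (auto simp: tree_auto_def Bij_def)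
  fix v assume "v \<in> verts T"
  then obtain \<xi> where "\<xi> \<in> boundary T" "\<xi> (depth T v) = v" using ex_ray by blast
  then show "f v = g v" using eq[of \<xi>] by (metis comp_apply)
qed

text \<open>The vertices outside the subtree include the ancestors of v, and possibly no ray through
  an ancestor avoids v. Ancestors are fixed because v is: if f moved v, it would send a ray through
  v to a ray avoiding v and then fix that image, against injectivity.\<close>

lemma fixes_outside_subtree_iff:
  assumes f: "f \<in> tree_auto T" and v: "v \<in> verts T"
  shows "(\<forall>w\<in>verts T - subtree T v. f w = w) \<longleftrightarrow>
    (\<forall>\<xi>\<in>boundary T. \<xi> (depth T v) \<noteq> v \<longrightarrow> f \<circ> \<xi> = \<xi>)" (is "?L \<longleftrightarrow> ?R")
proof
  assume ?L
  show ?R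
  proof (intro ballI impI ext)
    fix \<xi> n assume "\<xi> \<in> boundary T" "\<xi> (depth T v) \<noteq> v"
    then have "\<xi> n \<in> verts T - subtree T v"
      using subtree_ray[OF _ v, of \<xi> n] boundary_ray(1) by blast
    then show "(f \<circ> \<xi>) n = \<xi> n" using \<open>?L\<close> by simp
  qed
next
  assume ?R
  have fix_v: "f v = v"
  proof (rule ccontr)
    assume "f v \<noteq> v"
    obtain \<xi> where \<xi>: "\<xi> \<in> boundary T" "\<xi> (depth T v) = v" using ex_ray[OF v] by blast
    let ?\<eta> = "f \<circ> \<xi>"
    have "?\<eta> \<in> boundary T" "?\<eta> (depth T v) \<noteq> v"
      using \<xi> \<open>f v \<noteq> v\<close> tree_auto_boundary[OF f] by auto
    then have "f \<circ> ?\<eta> = ?\<eta>" using \<open>?R\<close> by blast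
    then have "f (f v) = f v" using \<xi>(2) by (metis comp_apply)
    then show False using \<open>f v \<noteq> v\<close> inj_onD[OF tree_auto_inj[OF f]] v tree_auto_closed[OF f] by metis
  qed
  show ?L
  proof
    fix w assume w: "w \<in> verts T - subtree T v"
    then obtain \<xi> where \<xi>: "\<xi> \<in> boundary T" "\<xi> (depth T w) = w" using ex_ray by blast
    show "f w = w"
    proof (cases "\<xi> (depth T v) = v")
      case True
      have "\<not> depth T v \<le> depth T w" using subtree_ray[OF \<xi>(1) v, of "depth T w"] \<xi> True w by auto
      moreover have "f \<circ> \<xi> \<in> boundary T" "(f \<circ> \<xi>) (depth T v) = \<xi> (depth T v)"
        using tree_auto_boundary[OF f \<xi>(1)] True fix_v by auto
      ultimately have "(f \<circ> \<xi>) (depth T w) = \<xi> (depth T w)"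
        using ray_prefix[of "f \<circ> \<xi>" \<xi> "depth T v" "depth T w"] \<xi>(1) by linarith
      then show ?thesis using \<xi> by simp
    next
      case False
      then have "f \<circ> \<xi> = \<xi>" using \<open>?R\<close> \<xi> by blast
      then show ?thesis using \<xi>(2) by (metis comp_apply)
    qed
  qed
qed

end

text \<open>The rigid stabilizer is pulled back to the abstract group, where automorphisms of G can
  be applied to it.\<close>

definition Rist :: "('g, 'm) monoid_scheme \<Rightarrow> 'v rooted_graph \<Rightarrow> ('g \<Rightarrow> 'v \<Rightarrow> 'v) \<Rightarrow> 'v \<Rightarrow> 'g set" where
  "Rist G T \<phi> v = {g \<in> carrier G. \<forall>w\<in>verts T - subtree T v. \<phi> g w = w}"

locale tree_action = group G + rooted_tree T
  for G :: "('g, 'm) monoid_scheme" (structure) and T :: "'v rooted_graph" +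
  fixes \<phi> :: "'g \<Rightarrow> 'v \<Rightarrow> 'v"
  assumes \<phi>_mon: "\<phi> \<in> mon G (TreeAuto T)"
begin

lemma \<phi>_inj: "inj_on \<phi> (carrier G)"
  using \<phi>_mon by (simp add: mon_def)

sublocale \<phi>: group_hom G "TreeAuto T" \<phi>
  using \<phi>_mon group_TreeAuto
  by (simp add: mon_def group_hom_def group_hom_axioms_def is_group)

lemma \<phi>_auto: "g \<in> carrier G \<Longrightarrow> \<phi> g \<in> tree_auto T"
  using \<phi>.hom_closed by (simp add: carrier_TreeAuto)

lemma \<phi>_closed: "g \<in> carrier G \<Longrightarrow> v \<in> verts T \<Longrightarrow> \<phi> g v \<in> verts T"
  by (rule tree_auto_closed[OF \<phi>_auto])

lemma \<phi>_mult:
  "g \<in> carrier G \<Longrightarrow> h \<in> carrier G \<Longrightarrow> v \<in> verts T \<Longrightarrow> \<phi> (g \<otimes> h) v = \<phi> g (\<phi> h v)"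
  by (simp add: mult_TreeAuto \<phi>_auto compose_def)

lemma \<phi>_one: "v \<in> verts T \<Longrightarrow> \<phi> \<one> v = v"
  by (simp add: one_TreeAuto)

definition act :: "'g \<Rightarrow> (nat \<Rightarrow> 'v) \<Rightarrow> nat \<Rightarrow> 'v" where
  "act g \<xi> = \<phi> g \<circ> \<xi>"

lemma act_apply: "act g \<xi> n = \<phi> g (\<xi> n)"
  by (simp add: act_def)

lemma act_closed [simp]: "g \<in> carrier G \<Longrightarrow> \<xi> \<in> boundary T \<Longrightarrow> act g \<xi> \<in> boundary T"
  by (simp add: act_def tree_auto_boundary \<phi>_auto)

lemma act_mult:
  "g \<in> carrier G \<Longrightarrow> h \<in> carrier G \<Longrightarrow> \<xi> \<in> boundary T \<Longrightarrow> act (g \<otimes> h) \<xi> = act g (act h \<xi>)"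
  by (rule ext) (simp add: act_def \<phi>_mult boundary_ray(1) del: \<phi>.hom_mult)

lemma act_one [simp]: "\<xi> \<in> boundary T \<Longrightarrow> act \<one> \<xi> = \<xi>"
  by (rule ext) (simp add: act_def \<phi>_one boundary_ray(1) del: \<phi>.hom_one)

lemma act_inv:
  "g \<in> carrier G \<Longrightarrow> \<xi> \<in> boundary T \<Longrightarrow> act (inv g) (act g \<xi>) = \<xi>"
  "g \<in> carrier G \<Longrightarrow> \<xi> \<in> boundary T \<Longrightarrow> act g (act (inv g) \<xi>) = \<xi>"
  by (simp_all flip: act_mult)

lemma act_eq_iff:
  "g \<in> carrier G \<Longrightarrow> \<xi> \<in> boundary T \<Longrightarrow> \<eta> \<in> boundary T \<Longrightarrow> act g \<xi> n = act g \<eta> n \<longleftrightarrow> \<xi> n = \<eta> n"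
  using inj_onD[OF tree_auto_inj[OF \<phi>_auto]] by (auto simp: act_apply boundary_ray(1))

lemma faithful:
  assumes "g \<in> carrier G" "h \<in> carrier G" "\<And>\<xi>. \<xi> \<in> boundary T \<Longrightarrow> act g \<xi> = act h \<xi>"
  shows "g = h"
  using tree_auto_ext[of "\<phi> g" "\<phi> h"] assms \<phi>_auto inj_onD[OF \<phi>_inj] by (simp add: act_def)

lemma Rist_iff:
  assumes "v \<in> verts T"
  shows "g \<in> Rist G T \<phi> v \<longleftrightarrow>
    g \<in> carrier G \<and> (\<forall>\<xi>\<in>boundary T. \<xi> (depth T v) \<noteq> v \<longrightarrow> act g \<xi> = \<xi>)"
  using fixes_outside_subtree_iff[OF \<phi>_auto assms] by (auto simp: Rist_def act_def)

lemma subgroup_Rist: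
  assumes v: "v \<in> verts T"
  shows "subgroup (Rist G T \<phi> v) G"
proof (rule subgroupI)
  show "Rist G T \<phi> v \<subseteq> carrier G" by (auto simp: Rist_def)
  have "\<one> \<in> Rist G T \<phi> v" by (simp add: Rist_iff[OF v])
  then show "Rist G T \<phi> v \<noteq> {}" by blast
  fix g assume g: "g \<in> Rist G T \<phi> v"
  show "inv g \<in> Rist G T \<phi> v" using g act_inv(1)[of g] by (force simp: Rist_iff[OF v])
  fix h assume h: "h \<in> Rist G T \<phi> v"
  show "g \<otimes> h \<in> Rist G T \<phi> v" using g h by (auto simp: Rist_iff[OF v] act_mult)
qed

lemma Rist_level_subset: "(\<Union>v\<in>level T n. Rist G T \<phi> v) \<subseteq> carrier G"
  by (auto simp: Rist_def)

lemma rist_image: "rist T (\<phi> ` carrier G) v = \<phi> ` Rist G T \<phi> v"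
  by (auto simp: rist_def Rist_def)

lemma rist_level_image:
  "rist_level T (\<phi> ` carrier G) n = \<phi> ` generate G (\<Union>v\<in>level T n. Rist G T \<phi> v)"
  using \<phi>.generate_img[OF Rist_level_subset] by (simp add: rist_level_def rist_image image_UN)

lemma rist_trivial_iff:
  assumes "v \<in> verts T"
  shows "rist T (\<phi> ` carrier G) v \<noteq> {\<one>\<^bsub>TreeAuto T\<^esub>} \<longleftrightarrow> (\<exists>g\<in>Rist G T \<phi> v. g \<noteq> \<one>)"
proof -
  have 1: "\<one> \<in> Rist G T \<phi> v" using subgroup.one_closed[OF subgroup_Rist[OF assms]] .
  have c: "Rist G T \<phi> v \<subseteq> carrier G" by (auto simp: Rist_def)
  show ?thesis
  proof
    assume "rist T (\<phi> ` carrier G) v \<noteq> {\<one>\<^bsub>TreeAuto T\<^esub>}"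
    moreover have "\<phi> ` Rist G T \<phi> v = {\<phi> \<one>}" if "\<forall>g\<in>Rist G T \<phi> v. g = \<one>"
    proof -
      have "Rist G T \<phi> v = {\<one>}" using that 1 by blast
      then show ?thesis by (simp del: \<phi>.hom_one)
    qed
    ultimately show "\<exists>g\<in>Rist G T \<phi> v. g \<noteq> \<one>" unfolding rist_image by auto
  next
    assume "\<exists>g\<in>Rist G T \<phi> v. g \<noteq> \<one>"
    then obtain g where g: "g \<in> Rist G T \<phi> v" "g \<noteq> \<one>" by blast
    then have "\<phi> g \<noteq> \<phi> \<one>" using c inj_onD[OF \<phi>_inj] by blast
    then show "rist T (\<phi> ` carrier G) v \<noteq> {\<one>\<^bsub>TreeAuto T\<^esub>}" using g(1) by (auto simp: rist_image)
  qed
qed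

lemma level_transitive_iff:
  "level_transitive T (\<phi> ` carrier G) \<longleftrightarrow>
    (\<forall>n. \<forall>\<xi>\<in>boundary T. \<forall>\<eta>\<in>boundary T. \<exists>g\<in>carrier G. act g \<xi> n = \<eta> n)"
  by (auto simp: level_transitive_def level_eq act_apply)

lemma weakly_branch_on_iff:
  "weakly_branch_on T (\<phi> ` carrier G) \<longleftrightarrow>
    (\<forall>n. \<forall>\<xi>\<in>boundary T. \<forall>\<eta>\<in>boundary T. \<exists>g\<in>carrier G. act g \<xi> n = \<eta> n) \<and>
    (\<forall>v\<in>verts T. \<exists>g\<in>Rist G T \<phi> v. g \<noteq> \<one>)"
  unfolding weakly_branch_on_def level_transitive_iff using \<phi>.img_is_subgroup rist_trivial_iff by auto

lemma branch_on_iff: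
  "branch_on T (\<phi> ` carrier G) \<longleftrightarrow>
    (\<forall>n. \<forall>\<xi>\<in>boundary T. \<forall>\<eta>\<in>boundary T. \<exists>g\<in>carrier G. act g \<xi> n = \<eta> n) \<and>
    (\<forall>n. finite (rcosets (generate G (\<Union>v\<in>level T n. Rist G T \<phi> v))))"
  unfolding branch_on_def level_transitive_iff rist_level_image
  using \<phi>.img_is_subgroup \<phi>.finite_rcosets_image[OF \<phi>_inj generate_is_subgroup[OF Rist_level_subset]]
  by simp

end

lemma tree_action_iff:
  "tree_action G T \<phi> \<longleftrightarrow> group G \<and> rooted_tree T \<and> \<phi> \<in> mon G (TreeAuto T)"
  by (simp add: tree_action_def tree_action_axioms_def)

section \<open>The topology of the boundary\<close>

lemma (in rooted_tree) topspace_boundary: "topspace (boundary_topology T) = boundary T"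
proof -
  have "\<xi> \<in> cylinder T (\<xi> 0)" if "\<xi> \<in> boundary T" for \<xi>
    using that by (simp add: cylinder_def)
  then show ?thesis using boundary_ray(1)
    by (fastforce simp: boundary_topology_def cylinder_def)
qed

text \<open>Cylinders generate the topology, and membership in the cylinder of v is read off from
  one coordinate. Local constancy of every coordinate is therefore enough.\<close>

lemma (in rooted_tree) continuous_map_boundary:
  assumes f: "\<And>y. y \<in> boundary T \<Longrightarrow> f y \<in> boundary T"
    and cont: "\<And>y n. y \<in> boundary T \<Longrightarrow> \<exists>k. \<forall>z\<in>boundary T. z k = y k \<longrightarrow> f z n = f y n"
  shows "continuous_map (boundary_topology T) (boundary_topology T) f"
proof -
  have "openin (boundary_topology T) (f -` cylinder T v \<inter> boundary T)" if v: "v \<in> verts T" for v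
  proof (subst openin_subopen, intro ballI)
    fix y assume y: "y \<in> f -` cylinder T v \<inter> boundary T"
    obtain k where k: "\<And>z. z \<in> boundary T \<Longrightarrow> z k = y k \<Longrightarrow> f z (depth T v) = f y (depth T v)"
      using cont[of y "depth T v"] y by blast
    have V: "y k \<in> verts T" "depth T (y k) = k" using y boundary_ray by auto
    have "openin (boundary_topology T) (cylinder T (y k))"
      unfolding boundary_topology_def using V by (intro topology_generated_by_Basis) auto
    moreover have "y \<in> cylinder T (y k)" using y V by (simp add: cylinder_eq)
    moreover have "cylinder T (y k) \<subseteq> f -` cylinder T v \<inter> boundary T"
      using k y f V v by (auto simp: cylinder_eq)
    ultimately show "\<exists>U. openin (boundary_topology T) U \<and> y \<in> U \<and> U \<subseteq> f -` cylinder T v \<inter> boundary T"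
      by blast
  qed
  moreover have "(\<Union>v\<in>verts T. cylinder T v) = boundary T"
    using topspace_boundary by (simp add: boundary_topology_def)
  ultimately show ?thesis
    unfolding boundary_topology_def using f topspace_boundary
    by (subst continuous_on_generated_topo_iff) (auto simp: boundary_topology_def)
qed

section \<open>Weakly branch actions\<close>

locale wb_action = tree_action +
  assumes trans: "\<xi> \<in> boundary T \<Longrightarrow> \<eta> \<in> boundary T \<Longrightarrow> \<exists>g\<in>carrier G. act g \<xi> n = \<eta> n"
    and rist_ne: "v \<in> verts T \<Longrightarrow> \<exists>g\<in>Rist G T \<phi> v. g \<noteq> \<one>"

lemma weakly_branch_action_iff:
  assumes "group G"
  shows "weakly_branch_action G T \<phi> \<longleftrightarrow> wb_action G T \<phi>"
proof -
  have "weakly_branch_on T (\<phi> ` carrier G) \<longleftrightarrow> wb_action_axioms G T \<phi>" if "tree_action G T \<phi>"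
    using tree_action.weakly_branch_on_iff[OF that] by (auto simp: wb_action_axioms_def)
  then show ?thesis
    using assms by (auto simp: weakly_branch_action_def wb_action_def tree_action_iff)
qed

lemma AutoGroup_simps:
  "carrier (AutoGroup G) = auto G"
  "\<one>\<^bsub>AutoGroup G\<^esub> = (\<lambda>x\<in>carrier G. x)"
  by (auto simp: AutoGroup_def BijGroup_def)

lemma mult_AutoGroup:
  "\<alpha> \<in> auto G \<Longrightarrow> \<beta> \<in> auto G \<Longrightarrow> \<alpha> \<otimes>\<^bsub>AutoGroup G\<^esub> \<beta> = compose (carrier G) \<alpha> \<beta>"
  by (auto simp: AutoGroup_def BijGroup_def auto_def)

section \<open>Rigid stabilizers indexed by rays\<close>

context tree_action
begin

text \<open>This is the rigid stabilizer of the vertex x n, and it depends on x through that vertex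
  only. Naming the vertex by a ray lets the group act on the index by \<open>act\<close>.\<close>

definition rist_ray :: "nat \<Rightarrow> (nat \<Rightarrow> 'v) \<Rightarrow> 'g set" where
  "rist_ray n x = {g \<in> carrier G. \<forall>\<xi>\<in>boundary T. \<xi> n \<noteq> x n \<longrightarrow> act g \<xi> = \<xi>}"

lemma rist_ray_eq: "x \<in> boundary T \<Longrightarrow> Rist G T \<phi> (x n) = rist_ray n x"
  by (auto simp: Rist_iff boundary_ray rist_ray_def)

lemma rist_ray_carrier: "g \<in> rist_ray n x \<Longrightarrow> g \<in> carrier G"
  by (simp add: rist_ray_def)

lemma rist_ray_fix: "g \<in> rist_ray n x \<Longrightarrow> \<xi> \<in> boundary T \<Longrightarrow> \<xi> n \<noteq> x n \<Longrightarrow> act g \<xi> = \<xi>"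
  by (simp add: rist_ray_def)

lemma rist_ray_cong: "x n = y n \<Longrightarrow> rist_ray n x = rist_ray n y"
  by (simp add: rist_ray_def)

lemma subgroup_rist_ray: "x \<in> boundary T \<Longrightarrow> subgroup (rist_ray n x) G"
  using subgroup_Rist[of "x n"] by (simp add: rist_ray_eq boundary_ray)

lemma rist_ray_mono:
  assumes "m \<le> n" "x \<in> boundary T"
  shows "rist_ray n x \<subseteq> rist_ray m x"
proof -
  have "\<xi> n \<noteq> x n" if "\<xi> \<in> boundary T" "\<xi> m \<noteq> x m" for \<xi>
    using ray_prefix[OF that(1) assms(2) _ assms(1)] that(2) by blast
  then show ?thesis by (auto simp: rist_ray_def)
qed

text \<open>A ray outside the cylinder of x n is fixed by h, so by injectivity it is not the image
  of a different ray.\<close>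

lemma rist_ray_preserve:
  assumes h: "h \<in> rist_ray n x" and \<xi>: "\<xi> \<in> boundary T" "\<xi> n = x n"
  shows "act h \<xi> n = x n"
proof (rule ccontr)
  assume *: "act h \<xi> n \<noteq> x n"
  have c: "h \<in> carrier G" using h by (rule rist_ray_carrier)
  then have "act h (act h \<xi>) = act h \<xi>" using rist_ray_fix[OF h, of "act h \<xi>"] * \<xi> by simp
  then have "act h \<xi> = \<xi>" using act_inv(1)[OF c] \<xi>(1) act_closed[OF c] by metis
  then show False using * \<xi> by simp
qed

lemma rist_ray_fix_level:
  assumes "h \<in> rist_ray n x" "m \<le> n" "\<xi> \<in> boundary T"
  shows "act h \<xi> m = \<xi> m"
proof (cases "\<xi> n = x n")
  case True
  then have "act h \<xi> n = \<xi> n" using rist_ray_preserve assms by metis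
  then show ?thesis using ray_prefix[of "act h \<xi>" \<xi> n m] rist_ray_carrier assms by simp
next
  case False
  then show ?thesis using rist_ray_fix assms by metis
qed

lemma rist_ray_conj:
  assumes g: "g \<in> carrier G" and x: "x \<in> boundary T" and h: "h \<in> rist_ray n x"
  shows "g \<otimes> h \<otimes> inv g \<in> rist_ray n (act g x)"
proof -
  have c: "h \<in> carrier G" using h by (rule rist_ray_carrier)
  have "act (g \<otimes> h \<otimes> inv g) \<xi> = \<xi>" if \<xi>: "\<xi> \<in> boundary T" "\<xi> n \<noteq> act g x n" for \<xi>
  proof -
    have "act (inv g) \<xi> n \<noteq> x n"
      using act_eq_iff[of g "act (inv g) \<xi>" x n] \<xi> g x by (simp add: act_inv)
    then have "act h (act (inv g) \<xi>) = act (inv g) \<xi>" using rist_ray_fix[OF h] \<xi> g by simp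
    then show ?thesis using \<xi> g c by (simp add: act_mult act_inv)
  qed
  then show ?thesis using g c by (simp add: rist_ray_def)
qed

lemma rist_ray_commute:
  assumes x: "x \<in> boundary T" "x' \<in> boundary T" "x n \<noteq> x' n" and g: "g \<in> rist_ray n x" and h: "h \<in> rist_ray n x'"
  shows "g \<otimes> h = h \<otimes> g"
proof (rule faithful)
  have c: "g \<in> carrier G" "h \<in> carrier G" using g h rist_ray_carrier by auto
  then show "g \<otimes> h \<in> carrier G" "h \<otimes> g \<in> carrier G" by auto
  fix \<xi> assume \<xi>: "\<xi> \<in> boundary T"
  show "act (g \<otimes> h) \<xi> = act (h \<otimes> g) \<xi>"
  proof (cases "\<xi> n = x n")
    case True
    then have "act g \<xi> n = x n" using rist_ray_preserve[OF g \<xi>] by simp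
    then show ?thesis
      using rist_ray_fix[OF h \<xi>] rist_ray_fix[OF h, of "act g \<xi>"] True x \<xi> c by (simp add: act_mult)
  next
    case False
    have "act h \<xi> n \<noteq> x n" using rist_ray_fix_level[OF h order_refl \<xi>] False by simp
    then show ?thesis
      using rist_ray_fix[OF g \<xi>] rist_ray_fix[OF g, of "act h \<xi>"] False \<xi> c by (simp add: act_mult)
  qed
qed

text \<open>If \<open>z\<close> moves the vertex, it conjugates \<open>h\<close> to an element with disjoint support.\<close>

lemma rist_ray_commute_trivial:
  assumes z: "z \<in> carrier G" and x: "x \<in> boundary T" and moved: "act z x n \<noteq> x n"
    and h: "h \<in> rist_ray n x" and comm: "z \<otimes> h = h \<otimes> z"
  shows "h = \<one>"
proof (rule faithful)
  have c: "h \<in> carrier G" using h by (rule rist_ray_carrier)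
  show "h \<in> carrier G" "\<one> \<in> carrier G" using c by auto
  have "z \<otimes> h \<otimes> inv z = h" using comm z c by (simp add: m_assoc)
  then have h': "h \<in> rist_ray n (act z x)" using rist_ray_conj[OF z x h] by simp
  fix \<xi> assume \<xi>: "\<xi> \<in> boundary T"
  show "act h \<xi> = act \<one> \<xi>"
  proof (cases "\<xi> n = x n")
    case True
    then show ?thesis using rist_ray_fix[OF h' \<xi>] moved \<xi> by simp
  next
    case False
    then show ?thesis using rist_ray_fix[OF h \<xi>] \<xi> by simp
  qed
qed

end

section \<open>Consequences of nontrivial rigid stabilizers\<close>

context wb_action
begin

lemma rist_ray_ne: "x \<in> boundary T \<Longrightarrow> \<exists>g\<in>rist_ray n x. g \<noteq> \<one>"
  using rist_ne[of "x n"] by (simp add: rist_ray_eq boundary_ray)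

lemma moved_ex:
  assumes "g \<in> carrier G" "g \<noteq> \<one>"
  shows "\<exists>\<xi>\<in>boundary T. \<exists>m. act g \<xi> m \<noteq> \<xi> m"
  using faithful[OF assms(1), of \<one>] assms(2) by force

text \<open>Were it finite, all its nontrivial elements would already act nontrivially on the levels
  up to some M. A nontrivial element of the rigid stabilizer at level M of the same ray contradicts
  this, since it fixes all these levels.\<close>

lemma infinite_rist_ray:
  assumes x: "x \<in> boundary T"
  shows "infinite (rist_ray n x)"
proof
  assume fin: "finite (rist_ray n x)"
  have "\<forall>g\<in>rist_ray n x - {\<one>}. \<exists>m. \<exists>\<xi>\<in>boundary T. act g \<xi> m \<noteq> \<xi> m"
    using moved_ex rist_ray_carrier by blast
  then obtain m where m: "\<And>g. g \<in> rist_ray n x \<Longrightarrow> g \<noteq> \<one> \<Longrightarrow> \<exists>\<xi>\<in>boundary T. act g \<xi> (m g) \<noteq> \<xi> (m g)"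
    by (metis DiffI singletonD)
  define M where "M = Max (insert n (m ` rist_ray n x))"
  have M: "n \<le> M" "\<And>g. g \<in> rist_ray n x \<Longrightarrow> m g \<le> M" using fin by (auto simp: M_def)
  obtain h where h: "h \<in> rist_ray M x" "h \<noteq> \<one>" using rist_ray_ne[OF x] by blast
  have "h \<in> rist_ray n x" using rist_ray_mono[OF M(1) x] h by blast
  then show False using m[OF _ h(2)] M(2)[of h] rist_ray_fix_level[OF h(1)] by blast
qed

text \<open>Pigeonhole on an infinite set. In the applications, equal values of f make the quotient
  an element of a chosen subgroup, so that subgroup meets every rigid stabilizer
  nontrivially.\<close>

lemma rist_ray_finite_range:
  assumes x: "x \<in> boundary T" and f: "finite (f ` carrier G)"
  shows "\<exists>g h. g \<in> rist_ray n x \<and> h \<in> rist_ray n x \<and> f g = f h \<and> inv g \<otimes> h \<in> rist_ray n x \<and> inv g \<otimes> h \<noteq> \<one>"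
proof -
  have "f ` rist_ray n x \<subseteq> f ` carrier G" using rist_ray_carrier by blast
  then have "finite (f ` rist_ray n x)" using f by (rule finite_subset)
  then have "\<not> inj_on f (rist_ray n x)" using infinite_rist_ray[OF x] finite_imageD by blast
  then obtain g h where gh: "g \<in> rist_ray n x" "h \<in> rist_ray n x" "f g = f h" "g \<noteq> h" by (auto simp: inj_on_def)
  have c: "g \<in> carrier G" "h \<in> carrier G" using gh rist_ray_carrier by auto
  have "inv g \<otimes> h \<noteq> \<one>" using gh(4) c by (metis inv_equality inv_inv inv_closed)
  moreover have "inv g \<otimes> h \<in> rist_ray n x"
    using gh subgroup_rist_ray[OF x] by (simp add: subgroup.m_closed subgroup.m_inv_closed)
  ultimately show ?thesis using gh by blast
qed

lemma infinite_carrier: "infinite (carrier G)"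
proof -
  obtain x where "x \<in> boundary T" using boundary_nonempty by blast
  moreover have "rist_ray 0 x \<subseteq> carrier G" using rist_ray_carrier by blast
  ultimately show ?thesis using infinite_rist_ray infinite_super by blast
qed

lemma center_trivial:
  assumes z: "z \<in> carrier G" and comm: "\<And>g. g \<in> carrier G \<Longrightarrow> z \<otimes> g = g \<otimes> z"
  shows "z = \<one>"
proof (rule ccontr)
  assume "z \<noteq> \<one>"
  then obtain x m where x: "x \<in> boundary T" "act z x m \<noteq> x m" using moved_ex[OF z] by blast
  obtain h where "h \<in> rist_ray m x" "h \<noteq> \<one>" using rist_ray_ne[OF x(1)] by blast
  then show False using rist_ray_commute_trivial[OF z x] comm rist_ray_carrier by blast
qed

text \<open>
  The quotients of elements in a common fibre of \<open>f\<close> play the role of a subgroup of finite index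
  normalizing \<open>A\<close> and \<open>B\<close>. If \<open>d\<close> and \<open>e\<close> are such quotients and lie in the rigid stabilizer of a
  small neighbourhood of \<open>y\<close>, then the commutators of \<open>a\<close> with \<open>d\<close> and of \<open>b\<close> with \<open>e\<close> lie in
  \<open>A\<close> and \<open>B\<close>, but act near \<open>y\<close> as \<open>d\<close> and \<open>e\<close>. Hence \<open>d\<close> and \<open>e\<close> commute, which fails for
  suitable choices.
\<close>

lemma no_common_support:
  assumes A: "subgroup A G" and B: "subgroup B G"
    and comm: "\<And>a b. a \<in> A \<Longrightarrow> b \<in> B \<Longrightarrow> a \<otimes> b = b \<otimes> a"
    and f: "finite (f ` carrier G)"
    and norm: "\<And>C g h a. C \<in> {A, B} \<Longrightarrow> g \<in> carrier G \<Longrightarrow> h \<in> carrier G \<Longrightarrow> f g = f h \<Longrightarrow>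
      a \<in> C \<Longrightarrow> inv (inv g \<otimes> h) \<otimes> a \<otimes> (inv g \<otimes> h) \<in> C"
    and y: "y \<in> boundary T" and a: "a \<in> A" "act a y \<noteq> y" and b: "b \<in> B" "act b y \<noteq> y"
  shows False
proof -
  have cA: "A \<subseteq> carrier G" and cB: "B \<subseteq> carrier G" using A B subgroup.subset by auto
  have ca: "a \<in> carrier G" and cb: "b \<in> carrier G" using a b cA cB by auto
  obtain m1 m2 where m: "act a y m1 \<noteq> y m1" "act b y m2 \<noteq> y m2" using a b by (metis ext)
  define n where "n = max m1 m2"
  have n: "act a y n \<noteq> y n" "act b y n \<noteq> y n"
    using m ray_prefix[of "act a y" y n m1] ray_prefix[of "act b y" y n m2] y ca cb
    by (auto simp: n_def)
  \<comment> \<open>The conjugate of \<open>inv d\<close> by c is supported in the cylinder of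
    \<open>act c y n\<close>. This is disjoint from the cylinder of y n, so on the latter only the
    last factor d of the commutator is visible.\<close>
  have local_act: "act (c \<otimes> inv d \<otimes> inv c \<otimes> d) \<xi> = act d \<xi>"
    if c: "c \<in> carrier G" "act c y n \<noteq> y n" and d: "d \<in> rist_ray n y" and \<xi>: "\<xi> \<in> boundary T" "\<xi> n = y n"
    for c d \<xi>
  proof -
    have cd: "d \<in> carrier G" using d rist_ray_carrier by blast
    have di: "inv d \<in> rist_ray n y" using d subgroup_rist_ray[OF y] by (simp add: subgroup.m_inv_closed)
    let ?\<eta> = "act d \<xi>"
    have \<eta>: "?\<eta> \<in> boundary T" "?\<eta> n = y n" using rist_ray_preserve[OF d \<xi>] \<xi> cd by auto
    have "act (inv c) ?\<eta> n \<noteq> y n"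
      using c \<eta> y act_eq_iff[of c "act (inv c) ?\<eta>" y n] by (auto simp: act_inv)
    then have "act (inv d) (act (inv c) ?\<eta>) = act (inv c) ?\<eta>" using rist_ray_fix[OF di] \<eta> c by simp
    then show ?thesis using c cd \<xi> \<eta> by (simp add: act_mult act_inv)
  qed
  have comm_loc: "d \<otimes> e = e \<otimes> d"
    if d: "d \<in> rist_ray n y" "c \<otimes> inv d \<otimes> inv c \<otimes> d \<in> A" and c: "c \<in> carrier G" "act c y n \<noteq> y n"
    and e: "e \<in> rist_ray n y" "c' \<otimes> inv e \<otimes> inv c' \<otimes> e \<in> B" and c': "c' \<in> carrier G" "act c' y n \<noteq> y n"
    for d e c c'
  proof (rule faithful)
    have cde: "d \<in> carrier G" "e \<in> carrier G" using d e rist_ray_carrier by auto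
    then show "d \<otimes> e \<in> carrier G" "e \<otimes> d \<in> carrier G" by auto
    fix \<xi> assume \<xi>: "\<xi> \<in> boundary T"
    show "act (d \<otimes> e) \<xi> = act (e \<otimes> d) \<xi>"
    proof (cases "\<xi> n = y n")
      case True
      let ?u = "c \<otimes> inv d \<otimes> inv c \<otimes> d" and ?v = "c' \<otimes> inv e \<otimes> inv c' \<otimes> e"
      have uv: "?u \<in> carrier G" "?v \<in> carrier G" using c c' cde by auto
      have "act (d \<otimes> e) \<xi> = act ?u (act ?v \<xi>)"
        using local_act[OF c d(1), of "act e \<xi>"] local_act[OF c' e(1) \<xi> True]
          rist_ray_preserve[OF e(1) \<xi> True] \<xi> cde by (simp add: act_mult)
      also have "\<dots> = act (?u \<otimes> ?v) \<xi>" using act_mult[OF uv \<xi>] by simp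
      also have "\<dots> = act (?v \<otimes> ?u) \<xi>" using comm[OF d(2) e(2)] by simp
      also have "\<dots> = act ?v (act ?u \<xi>)" using act_mult[OF uv(2,1) \<xi>] by simp
      also have "\<dots> = act (e \<otimes> d) \<xi>"
        using local_act[OF c' e(1), of "act d \<xi>"] local_act[OF c d(1) \<xi> True]
          rist_ray_preserve[OF d(1) \<xi> True] \<xi> cde by (simp add: act_mult)
      finally show ?thesis .
    next
      case False
      then show ?thesis using rist_ray_fix[OF d(1) \<xi>] rist_ray_fix[OF e(1) \<xi>] \<xi> cde by (simp add: act_mult)
    qed
  qed
  have N: "c \<otimes> inv u \<otimes> inv c \<otimes> u \<in> H"
    if H: "subgroup H G" "c \<in> H" and u: "u \<in> carrier G" "\<And>a. a \<in> H \<Longrightarrow> inv u \<otimes> a \<otimes> u \<in> H" for c u H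
  proof -
    have "c \<in> carrier G" "inv c \<in> H" using H by (auto simp: subgroup.mem_carrier subgroup.m_inv_closed)
    then have "c \<otimes> (inv u \<otimes> inv c \<otimes> u) \<in> H" using H u by (simp add: subgroup.m_closed)
    then show ?thesis using \<open>c \<in> carrier G\<close> u by (simp add: m_assoc)
  qed
  obtain d1 d2 where d12: "d1 \<in> rist_ray n y" "d2 \<in> rist_ray n y" "f d1 = f d2"
    "inv d1 \<otimes> d2 \<in> rist_ray n y" "inv d1 \<otimes> d2 \<noteq> \<one>"
    using rist_ray_finite_range[OF y f] by blast
  define d where "d = inv d1 \<otimes> d2"
  have cd: "d1 \<in> carrier G" "d2 \<in> carrier G" "d \<in> carrier G"
    using d12 rist_ray_carrier by (auto simp: d_def)
  obtain z k where z: "z \<in> boundary T" "act d z k \<noteq> z k"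
    using moved_ex[OF cd(3)] d12 by (auto simp: d_def)
  have dR: "d \<in> rist_ray n y" using d12 by (simp add: d_def)
  have zn: "z n = y n" using rist_ray_fix[OF dR z(1)] z(2) by metis
  have "n \<le> k" using rist_ray_fix_level[OF dR _ z(1), of k] z(2) by linarith
  \<comment> \<open>The support of e lies in the cylinder of z k, which d moves off itself, so e
    could commute with d only if it were trivial. As z passes through y n and n \<le> k, e still
    belongs to the rigid stabilizer of y n.\<close>
  obtain e1 e2 where e12: "e1 \<in> rist_ray k z" "e2 \<in> rist_ray k z" "f e1 = f e2"
    "inv e1 \<otimes> e2 \<in> rist_ray k z" "inv e1 \<otimes> e2 \<noteq> \<one>"
    using rist_ray_finite_range[OF z(1) f] by blast
  define e where "e = inv e1 \<otimes> e2"
  have ce: "e1 \<in> carrier G" "e2 \<in> carrier G" "e \<in> carrier G"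
    using e12 rist_ray_carrier by (auto simp: e_def)
  have eR: "e \<in> rist_ray n y"
    using e12(4) rist_ray_mono[OF \<open>n \<le> k\<close> z(1)] rist_ray_cong[of z n y] zn by (auto simp: e_def)
  have "d \<otimes> e = e \<otimes> d"
  proof (rule comm_loc[OF dR _ ca n(1) eR _ cb n(2)])
    show "a \<otimes> inv d \<otimes> inv a \<otimes> d \<in> A"
      using norm[OF _ cd(1,2) d12(3)] by (intro N[OF A a(1) cd(3)]) (simp add: d_def)
    show "b \<otimes> inv e \<otimes> inv b \<otimes> e \<in> B"
      using norm[OF _ ce(1,2) e12(3)] by (intro N[OF B b(1) ce(3)]) (simp add: e_def)
  qed
  then have "e = \<one>" using rist_ray_commute_trivial[OF cd(3) z] e12(4) by (simp add: e_def)
  then show False using e12(5) by (simp add: e_def)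
qed

text \<open>The ray z = k y is fixed by everything that fixes y, in particular by the rigid
  stabilizer of a vertex on z that y avoids. Transitivity produces an element of that stabilizer
  which moves z.\<close>

lemma equivariant_id:
  assumes k: "\<And>y. y \<in> boundary T \<Longrightarrow> k y \<in> boundary T"
    and eq: "\<And>g y. g \<in> carrier G \<Longrightarrow> y \<in> boundary T \<Longrightarrow> k (act g y) = act g (k y)"
    and y: "y \<in> boundary T"
  shows "k y = y"
proof (rule ccontr)
  assume "k y \<noteq> y"
  define z where "z = k y"
  have z: "z \<in> boundary T" using k y by (simp add: z_def)
  obtain n where n: "z n \<noteq> y n" using \<open>k y \<noteq> y\<close> by (auto simp: z_def fun_eq_iff)
  have fix_z: "act g z = z" if g: "g \<in> rist_ray n z" for g
    using eq[OF rist_ray_carrier[OF g] y] rist_ray_fix[OF g y] n by (simp add: z_def)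
  obtain h where h: "h \<in> rist_ray n z" "h \<noteq> \<one>" using rist_ray_ne[OF z] by blast
  have ch: "h \<in> carrier G" using h rist_ray_carrier by blast
  obtain w m where w: "w \<in> boundary T" "act h w m \<noteq> w m" using moved_ex[OF ch h(2)] by blast
  have mn: "n \<le> m" using rist_ray_fix_level[OF h(1) _ w(1), of m] w(2) by linarith
  have wn: "w n = z n" using rist_ray_fix[OF h(1) w(1)] w(2) by metis
  \<comment> \<open>Since w and z agree at level n and t takes w to z down to level m, conjugation
    by t keeps h in the rigid stabilizer of z n. It carries the movement of w at level m over to
    z.\<close>
  obtain t where t: "t \<in> carrier G" "act t w m = z m" using trans[OF w(1) z] by blast
  have tn: "act t w n = z n" using ray_prefix[of "act t w" z m n] w z t mn by simp
  have "t \<otimes> h \<otimes> inv t \<in> rist_ray n (act t w)" using h rist_ray_cong[of w n z] wn by (intro rist_ray_conj t w) simp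
  then have "t \<otimes> h \<otimes> inv t \<in> rist_ray n z" using rist_ray_cong[of "act t w" n z] tn by simp
  then have "act t (act h (act (inv t) z)) = z" using fix_z[of "t \<otimes> h \<otimes> inv t"] t ch z by (simp add: act_mult)
  then have "act h (act (inv t) z) = act (inv t) z" using t ch z by (metis act_closed act_inv(1) inv_closed)
  moreover have "act (inv t) z m = w m"
    using act_eq_iff[of t "act (inv t) z" w m] t z w by (simp add: act_inv)
  ultimately have "act h w m = w m"
    using act_eq_iff[of h "act (inv t) z" w m] ch t z w by simp
  then show False using w by simp
qed

end

section \<open>The boundary action of the automorphism group\<close>

lemma (in group) auto_group_hom: "\<alpha> \<in> auto G \<Longrightarrow> group_hom G G \<alpha>"
  by (simp add: group_hom_def group_hom_axioms_def auto_def is_group)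

lemma (in group) auto_bij: "\<alpha> \<in> auto G \<Longrightarrow> bij_betw \<alpha> (carrier G) (carrier G)"
  by (simp add: auto_def Bij_def)

lemma (in group) auto_closed: "\<alpha> \<in> auto G \<Longrightarrow> g \<in> carrier G \<Longrightarrow> \<alpha> g \<in> carrier G"
  using auto_bij by (rule bij_betwE[rule_format])

lemma (in group) auto_inverse:
  assumes "\<alpha> \<in> auto G"
  obtains \<beta> where "\<beta> \<in> auto G" "\<And>g. g \<in> carrier G \<Longrightarrow> \<beta> (\<alpha> g) = g" "\<And>g. g \<in> carrier G \<Longrightarrow> \<alpha> (\<beta> g) = g"
proof
  let ?\<beta> = "\<lambda>x\<in>carrier G. inv_into (carrier G) \<alpha> x"
  have b: "bij_betw \<alpha> (carrier G) (carrier G)" using auto_bij assms .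
  have "\<alpha> \<in> hom G G" "\<alpha> \<in> Bij (carrier G)" using assms by (auto simp: auto_def)
  then show "?\<beta> \<in> auto G"
    unfolding auto_def using restrict_inv_into_hom restrict_inv_into_Bij by blast
  show "?\<beta> (\<alpha> g) = g" if "g \<in> carrier G" for g
    using that b auto_closed[OF assms] by (simp add: bij_betw_def)
  show "\<alpha> (?\<beta> g) = g" if "g \<in> carrier G" for g
    using that b by (simp add: bij_betw_def f_inv_into_f)
qed

lemma (in group) compose_auto:
  assumes "\<alpha> \<in> auto G" "\<beta> \<in> auto G"
  shows "compose (carrier G) \<alpha> \<beta> \<in> auto G"
  using group.is_monoid[OF AutoGroup] monoid.m_closed[of "AutoGroup G" \<alpha> \<beta>] assms
  by (simp add: AutoGroup_simps mult_AutoGroup)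

context wb_action
begin

lemma restrict_level: "g \<in> carrier G \<Longrightarrow> (\<lambda>v\<in>level T n. \<phi> g v) \<in> level T n \<rightarrow>\<^sub>E level T n"
  using \<phi>_closed[of g] tree_auto_depth[OF \<phi>_auto[of g]]
  by (intro restrict_PiE_iff[THEN iffD2] ballI) (simp add: level_def)

text \<open>This is the set U(v) of the overview for v = x n. Requiring \<open>\<alpha> g\<close> to
  be in the rigid stabilizer expresses its preimage without naming an inverse automorphism.\<close>

definition moved_by :: "('a \<Rightarrow> 'a) \<Rightarrow> nat \<Rightarrow> (nat \<Rightarrow> 'c) \<Rightarrow> (nat \<Rightarrow> 'c) set" where
  "moved_by \<alpha> n x = {y \<in> boundary T. \<exists>g\<in>carrier G. \<alpha> g \<in> rist_ray n x \<and> act g y \<noteq> y}"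

lemma moved_by_cong: "x n = x' n \<Longrightarrow> moved_by \<alpha> n x = moved_by \<alpha> n x'"
  using rist_ray_cong[of x n x'] by (simp add: moved_by_def)

lemma moved_by_mono: "m \<le> n \<Longrightarrow> x \<in> boundary T \<Longrightarrow> moved_by \<alpha> n x \<subseteq> moved_by \<alpha> m x"
  using rist_ray_mono[of m n x] by (auto simp: moved_by_def)

lemma moved_by_open:
  assumes "y \<in> moved_by \<alpha> n x"
  shows "\<exists>k. \<forall>z\<in>boundary T. z k = y k \<longrightarrow> z \<in> moved_by \<alpha> n x"
proof -
  obtain g where g: "y \<in> boundary T" "g \<in> carrier G" "\<alpha> g \<in> rist_ray n x" "act g y \<noteq> y"
    using assms by (auto simp: moved_by_def)
  then obtain k where k: "act g y k \<noteq> y k" by (auto simp: fun_eq_iff)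
  have "z \<in> moved_by \<alpha> n x" if z: "z \<in> boundary T" "z k = y k" for z
  proof -
    have "act g z k \<noteq> z k" using k z by (simp add: act_apply)
    then have "act g z \<noteq> z" by metis
    then show ?thesis using g z by (auto simp: moved_by_def)
  qed
  then show ?thesis by blast
qed

text \<open>If h moves y, then its conjugate by g moves \<open>act g y\<close>, and \<alpha> turns
  this conjugation into conjugation by \<alpha> g.\<close>

lemma moved_by_act:
  assumes \<alpha>: "\<alpha> \<in> auto G" and g: "g \<in> carrier G" and x: "x \<in> boundary T" and y: "y \<in> moved_by \<alpha> n x"
  shows "act g y \<in> moved_by \<alpha> n (act (\<alpha> g) x)"
proof -
  interpret \<alpha>: group_hom G G \<alpha> by (rule auto_group_hom[OF \<alpha>])
  obtain h where h: "y \<in> boundary T" "h \<in> carrier G" "\<alpha> h \<in> rist_ray n x" "act h y \<noteq> y"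
    using y by (auto simp: moved_by_def)
  have "\<alpha> (g \<otimes> h \<otimes> inv g) \<in> rist_ray n (act (\<alpha> g) x)"
    using rist_ray_conj[OF \<alpha>.hom_closed[OF g] x h(3)] g h by simp
  moreover have "act (g \<otimes> h \<otimes> inv g) (act g y) = act g (act h y)"
    using g h by (simp add: act_mult act_inv)
  moreover have "act g (act h y) \<noteq> act g y"
    using g h by (metis act_closed act_inv(1))
  ultimately show ?thesis using g h by (auto simp: moved_by_def intro!: bexI[of _ "g \<otimes> h \<otimes> inv g"])
qed

lemma moved_by_disjoint:
  assumes \<alpha>: "\<alpha> \<in> auto G" and x: "x \<in> boundary T" "x' \<in> boundary T" "x n \<noteq> x' n"
    and y: "y \<in> moved_by \<alpha> n x" "y \<in> moved_by \<alpha> n x'"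
  shows False
proof -
  interpret \<alpha>: group_hom G G \<alpha> by (rule auto_group_hom[OF \<alpha>])
  define S where "S z = {g \<in> carrier G. \<alpha> g \<in> rist_ray n z}" for z
  have inj: "inj_on \<alpha> (carrier G)" using auto_bij[OF \<alpha>] by (simp add: bij_betw_def)
  have S: "subgroup (S z) G" if z: "z \<in> boundary T" for z
  proof (rule subgroupI)
    show "S z \<subseteq> carrier G" by (auto simp: S_def)
    have "\<one> \<in> S z" using subgroup.one_closed[OF subgroup_rist_ray[OF z]] by (simp add: S_def)
    then show "S z \<noteq> {}" by blast
    show "inv g \<in> S z" if "g \<in> S z" for g
      using that subgroup.m_inv_closed[OF subgroup_rist_ray[OF z]] by (simp add: S_def)
    show "g \<otimes> h \<in> S z" if "g \<in> S z" "h \<in> S z" for g h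
      using that subgroup.m_closed[OF subgroup_rist_ray[OF z]] by (simp add: S_def)
  qed
  \<comment> \<open>f records how \<alpha> g permutes level n, which leaves finitely many values. If
    g and h share one, then \<alpha> maps their quotient to an element fixing level n, so the
    quotient normalizes every S z.\<close>
  define f where "f g = (\<lambda>v\<in>level T n. \<phi> (\<alpha> g) v)" for g
  have "f ` carrier G \<subseteq> level T n \<rightarrow>\<^sub>E level T n"
    unfolding f_def using restrict_level[OF \<alpha>.hom_closed] by blast
  then have fin: "finite (f ` carrier G)"
    by (rule finite_subset) (intro finite_PiE finite_level)
  have norm: "inv (inv g \<otimes> h) \<otimes> a \<otimes> (inv g \<otimes> h) \<in> S z"
    if z: "z \<in> boundary T" and gh: "g \<in> carrier G" "h \<in> carrier G" "f g = f h" and a: "a \<in> S z" for g h a z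
  proof -
    let ?u = "inv (inv g \<otimes> h)"
    have u: "?u \<in> carrier G" using gh by simp
    have "z n \<in> level T n" using z by (auto simp: level_eq)
    then have "\<phi> (\<alpha> g) (z n) = \<phi> (\<alpha> h) (z n)"
      using fun_cong[OF gh(3), of "z n"] by (simp add: f_def)
    then have "act (\<alpha> g) z n = act (\<alpha> h) z n" by (simp add: act_apply)
    moreover have "act (\<alpha> ?u) z = act (inv (\<alpha> h)) (act (\<alpha> g) z)"
      using gh z by (simp add: inv_mult_group act_mult)
    moreover have "act (inv (\<alpha> h)) (act (\<alpha> g) z) n = act (inv (\<alpha> h)) (act (\<alpha> h) z) n \<longleftrightarrow>
        act (\<alpha> g) z n = act (\<alpha> h) z n"
      using gh z by (intro act_eq_iff) auto
    ultimately have "act (\<alpha> ?u) z n = z n" using gh z by (simp add: act_inv)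
    then have "\<alpha> ?u \<otimes> \<alpha> a \<otimes> inv (\<alpha> ?u) \<in> rist_ray n z"
      using rist_ray_conj[of "\<alpha> ?u" z "\<alpha> a" n] rist_ray_cong[of "act (\<alpha> ?u) z" n z] u a z by (simp add: S_def)
    moreover have ca: "a \<in> carrier G" using a by (simp add: S_def)
    ultimately have "\<alpha> (?u \<otimes> a \<otimes> inv ?u) \<in> rist_ray n z" using u by simp
    then show ?thesis using gh ca by (simp add: S_def)
  qed
  have comm: "a \<otimes> b = b \<otimes> a" if ab: "a \<in> S x" "b \<in> S x'" for a b
  proof -
    have c: "a \<in> carrier G" "b \<in> carrier G" "\<alpha> a \<in> rist_ray n x" "\<alpha> b \<in> rist_ray n x'" using ab by (auto simp: S_def)
    have "\<alpha> a \<otimes> \<alpha> b = \<alpha> b \<otimes> \<alpha> a" by (rule rist_ray_commute[OF x c(3,4)])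
    then show ?thesis using inj_onD[OF inj, of "a \<otimes> b" "b \<otimes> a"] c by simp
  qed
  obtain a where a: "a \<in> S x" "act a y \<noteq> y" using y(1) by (auto simp: moved_by_def S_def)
  obtain b where b: "b \<in> S x'" "act b y \<noteq> y" using y(2) by (auto simp: moved_by_def S_def)
  have yb: "y \<in> boundary T" using y(1) by (simp add: moved_by_def)
  show False
  proof (rule no_common_support[OF S[OF x(1)] S[OF x(2)] comm fin _ yb a b])
    fix C g h c assume C: "C \<in> {S x, S x'}"
      and gh: "g \<in> carrier G" "h \<in> carrier G" "f g = f h" "c \<in> C"
    from C obtain z where "z \<in> boundary T" "C = S z" using x by blast
    with gh show "inv (inv g \<otimes> h) \<otimes> c \<otimes> (inv g \<otimes> h) \<in> C" by (simp only: norm)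
  qed
qed

text \<open>Surjectivity of \<alpha> makes at least one of these sets nonempty. An element that
  moves some ray z at level k moves every ray agreeing with z at level k, and level transitivity
  brings y into that position.\<close>

lemma moved_by_cover:
  assumes \<alpha>: "\<alpha> \<in> auto G" and y: "y \<in> boundary T"
  shows "\<exists>x\<in>boundary T. y \<in> moved_by \<alpha> n x"
proof -
  interpret \<alpha>: group_hom G G \<alpha> by (rule auto_group_hom[OF \<alpha>])
  obtain x where x: "x \<in> boundary T" using boundary_nonempty by blast
  obtain h where h: "h \<in> rist_ray n x" "h \<noteq> \<one>" using rist_ray_ne[OF x] by blast
  then obtain g where g: "g \<in> carrier G" "\<alpha> g = h"
    using auto_bij[OF \<alpha>] rist_ray_carrier by (metis bij_betw_def imageE)
  then have "g \<noteq> \<one>" using h by auto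
  then obtain z k where z: "z \<in> boundary T" "act g z k \<noteq> z k" using moved_ex[OF g(1)] by blast
  obtain t where t: "t \<in> carrier G" "act t z k = y k" using trans[OF z(1) y] by blast
  have "act (inv t) y k = z k"
    using act_eq_iff[of t "act (inv t) y" z k] t y z by (simp add: act_inv)
  then have "act g (act (inv t) y) \<noteq> act (inv t) y" using z by (metis act_apply)
  then have "act (inv t) y \<in> moved_by \<alpha> n x" using g h t y by (auto simp: moved_by_def)
  then have "act t (act (inv t) y) \<in> moved_by \<alpha> n (act (\<alpha> t) x)" by (rule moved_by_act[OF \<alpha> t(1) x])
  then show ?thesis using t x y by (intro bexI[of _ "act (\<alpha> t) x"]) (auto simp: act_inv)
qed

section \<open>The homeomorphism attached to an automorphism\<close>

definition bmap :: "('a \<Rightarrow> 'a) \<Rightarrow> (nat \<Rightarrow> 'c) \<Rightarrow> nat \<Rightarrow> 'c" where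
  "bmap \<alpha> y n = (SOME x. x \<in> boundary T \<and> y \<in> moved_by \<alpha> n x) n"

text \<open>The ray selected in \<open>bmap\<close> may change with n, but its vertex at level n
  does not depend on the selection: covering gives existence and disjointness gives
  uniqueness.\<close>

lemma bmap_iff:
  assumes \<alpha>: "\<alpha> \<in> auto G" and y: "y \<in> boundary T" and x: "x \<in> boundary T"
  shows "bmap \<alpha> y n = x n \<longleftrightarrow> y \<in> moved_by \<alpha> n x"
proof -
  let ?x = "SOME x. x \<in> boundary T \<and> y \<in> moved_by \<alpha> n x"
  have *: "?x \<in> boundary T \<and> y \<in> moved_by \<alpha> n ?x"
    using someI_ex[of "\<lambda>x. x \<in> boundary T \<and> y \<in> moved_by \<alpha> n x"] moved_by_cover[OF \<alpha> y, of n] by blast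
  show ?thesis
  proof
    assume "bmap \<alpha> y n = x n"
    then show "y \<in> moved_by \<alpha> n x" using * moved_by_cong[of ?x n x] by (simp add: bmap_def)
  next
    assume "y \<in> moved_by \<alpha> n x"
    then show "bmap \<alpha> y n = x n" using moved_by_disjoint[OF \<alpha> _ x] * unfolding bmap_def by blast
  qed
qed

lemma bmap_closed:
  assumes \<alpha>: "\<alpha> \<in> auto G" and y: "y \<in> boundary T"
  shows "bmap \<alpha> y \<in> boundary T"
proof -
  have "bmap \<alpha> y n \<in> verts T \<and> depth T (bmap \<alpha> y n) = n \<and> parent (bmap \<alpha> y (Suc n)) = bmap \<alpha> y n" for n
  proof -
    obtain x where x: "x \<in> boundary T" "y \<in> moved_by \<alpha> (Suc n) x" using moved_by_cover[OF \<alpha> y] by blast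
    have "y \<in> moved_by \<alpha> n x" using moved_by_mono[OF _ x(1), of n "Suc n"] x by auto
    then have "bmap \<alpha> y (Suc n) = x (Suc n)" "bmap \<alpha> y n = x n" using bmap_iff[OF \<alpha> y x(1)] x by auto
    then show ?thesis using boundary_ray[OF x(1)] by simp
  qed
  then show ?thesis by (simp add: boundary_iff)
qed

lemma bmap_act:
  assumes \<alpha>: "\<alpha> \<in> auto G" and g: "g \<in> carrier G" and y: "y \<in> boundary T"
  shows "bmap \<alpha> (act g y) = act (\<alpha> g) (bmap \<alpha> y)"
proof
  fix n
  have c: "bmap \<alpha> y \<in> boundary T" "\<alpha> g \<in> carrier G" using bmap_closed auto_closed assms by auto
  have "y \<in> moved_by \<alpha> n (bmap \<alpha> y)" using bmap_iff[OF \<alpha> y c(1)] by blast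
  then have "act g y \<in> moved_by \<alpha> n (act (\<alpha> g) (bmap \<alpha> y))" by (rule moved_by_act[OF \<alpha> g c(1)])
  then show "bmap \<alpha> (act g y) n = act (\<alpha> g) (bmap \<alpha> y) n"
    using bmap_iff[OF \<alpha>, of "act g y" "act (\<alpha> g) (bmap \<alpha> y)" n] c y g by simp
qed

lemma bmap_continuous:
  assumes \<alpha>: "\<alpha> \<in> auto G" and y: "y \<in> boundary T"
  shows "\<exists>k. \<forall>z\<in>boundary T. z k = y k \<longrightarrow> bmap \<alpha> z n = bmap \<alpha> y n"
proof -
  have c: "bmap \<alpha> y \<in> boundary T" using bmap_closed assms by auto
  have "y \<in> moved_by \<alpha> n (bmap \<alpha> y)" using bmap_iff[OF \<alpha> y c] by blast
  then obtain k where "\<forall>z\<in>boundary T. z k = y k \<longrightarrow> z \<in> moved_by \<alpha> n (bmap \<alpha> y)"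
    using moved_by_open by blast
  then show ?thesis using bmap_iff[OF \<alpha> _ c] by blast
qed

text \<open>For the inverse automorphism \<beta> both composites commute with the action of G, so
  \<open>equivariant_id\<close> makes them the identity.\<close>

lemma bmap_inverse:
  assumes \<alpha>: "\<alpha> \<in> auto G"
  obtains \<beta> where "\<beta> \<in> auto G" "\<And>g. g \<in> carrier G \<Longrightarrow> \<beta> (\<alpha> g) = g"
    "\<And>z. z \<in> boundary T \<Longrightarrow> bmap \<alpha> (bmap \<beta> z) = z" "\<And>z. z \<in> boundary T \<Longrightarrow> bmap \<beta> (bmap \<alpha> z) = z"
proof -
  obtain \<beta> where \<beta>: "\<beta> \<in> auto G" "\<And>g. g \<in> carrier G \<Longrightarrow> \<beta> (\<alpha> g) = g" "\<And>g. g \<in> carrier G \<Longrightarrow> \<alpha> (\<beta> g) = g"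
    using auto_inverse[OF \<alpha>] by blast
  have "bmap \<alpha> (bmap \<beta> z) = z" "bmap \<beta> (bmap \<alpha> z) = z" if z: "z \<in> boundary T" for z
    by (rule equivariant_id[OF _ _ z]; simp add: bmap_closed bmap_act \<alpha> \<beta> auto_closed)+
  then show thesis using that \<beta>(1,2) by blast
qed

text \<open>Followed by the map of the inverse automorphism, h commutes with G. The rules for
  identity, composition and inner automorphisms all come from here, as only equivariance has to be
  checked.\<close>

lemma bmap_unique:
  assumes \<alpha>: "\<alpha> \<in> auto G"
    and h: "\<And>y. y \<in> boundary T \<Longrightarrow> h y \<in> boundary T"
    and eq: "\<And>g y. g \<in> carrier G \<Longrightarrow> y \<in> boundary T \<Longrightarrow> h (act g y) = act (\<alpha> g) (h y)"
    and y: "y \<in> boundary T"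
  shows "h y = bmap \<alpha> y"
proof -
  obtain \<beta> where \<beta>: "\<beta> \<in> auto G" "\<And>g. g \<in> carrier G \<Longrightarrow> \<beta> (\<alpha> g) = g"
    "\<And>z. z \<in> boundary T \<Longrightarrow> bmap \<alpha> (bmap \<beta> z) = z" "\<And>z. z \<in> boundary T \<Longrightarrow> bmap \<beta> (bmap \<alpha> z) = z"
    using bmap_inverse[OF \<alpha>] by blast
  have "bmap \<beta> (h y) = y"
    by (rule equivariant_id[OF _ _ y]) (simp_all add: bmap_closed bmap_act \<alpha> \<beta> auto_closed h eq)
  then show ?thesis using \<beta>(3)[OF h[OF y]] by simp
qed

lemma bmap_one: "y \<in> boundary T \<Longrightarrow> bmap (\<lambda>x\<in>carrier G. x) y = y"
  by (rule bmap_unique[OF id_in_auto, symmetric]) auto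

lemma bmap_compose:
  assumes \<alpha>: "\<alpha> \<in> auto G" and \<beta>: "\<beta> \<in> auto G" and y: "y \<in> boundary T"
  shows "bmap (compose (carrier G) \<alpha> \<beta>) y = bmap \<alpha> (bmap \<beta> y)"
proof -
  show ?thesis
    using compose_auto[OF \<alpha> \<beta>] bmap_unique[of "compose (carrier G) \<alpha> \<beta>" "\<lambda>y. bmap \<alpha> (bmap \<beta> y)" y] \<alpha> \<beta> y
    by (simp add: bmap_closed bmap_act auto_closed compose_eq)
qed

text \<open>\<open>act g\<close> is equivariant with respect to conjugation by g. Through this fact
  the action of \<Gamma> on the boundary extends that of G.\<close>

lemma bmap_conj:
  assumes g: "g \<in> carrier G" and \<alpha>: "\<alpha> \<in> auto G"
    and conj: "\<And>h. h \<in> carrier G \<Longrightarrow> \<alpha> h = g \<otimes> h \<otimes> inv g" and y: "y \<in> boundary T"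
  shows "bmap \<alpha> y = act g y"
  by (rule bmap_unique[OF \<alpha>, symmetric]) (use g y in \<open>simp_all add: conj act_mult act_inv\<close>)

lemma boundary_act_eq:
  assumes \<alpha>: "\<alpha> \<in> auto G"
  shows "boundary_act G T \<phi> \<alpha> = restrict (bmap \<alpha>) (boundary T)"
  unfolding boundary_act_def
proof (rule the_equality)
  obtain \<beta> where \<beta>: "\<beta> \<in> auto G" "\<And>g. g \<in> carrier G \<Longrightarrow> \<beta> (\<alpha> g) = g"
    and inv1: "\<And>z. z \<in> boundary T \<Longrightarrow> bmap \<alpha> (bmap \<beta> z) = z"
    and inv2: "\<And>z. z \<in> boundary T \<Longrightarrow> bmap \<beta> (bmap \<alpha> z) = z"
    using bmap_inverse[OF \<alpha>] by blast
  have cont: "continuous_map (boundary_topology T) (boundary_topology T) (bmap \<gamma>)" if "\<gamma> \<in> auto G" for \<gamma>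
    using that by (intro continuous_map_boundary bmap_closed bmap_continuous)
  have "homeomorphic_maps (boundary_topology T) (boundary_topology T) (bmap \<alpha>) (bmap \<beta>)"
    using cont \<alpha> \<beta>(1) inv1 inv2 by (simp add: homeomorphic_maps_def topspace_boundary)
  then have "homeomorphic_map (boundary_topology T) (boundary_topology T) (bmap \<alpha>)"
    by (rule homeomorphic_maps_imp_map)
  then have "homeomorphic_map (boundary_topology T) (boundary_topology T) (restrict (bmap \<alpha>) (boundary T))"
    by (rule homeomorphic_map_eq) (simp add: topspace_boundary)
  then show "restrict (bmap \<alpha>) (boundary T) \<in> extensional (boundary T) \<and>
    homeomorphic_map (boundary_topology T) (boundary_topology T) (restrict (bmap \<alpha>) (boundary T)) \<and>
    (\<forall>g\<in>carrier G. \<forall>\<xi>\<in>boundary T.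
      restrict (bmap \<alpha>) (boundary T) (\<phi> g \<circ> \<xi>) = \<phi> (\<alpha> g) \<circ> restrict (bmap \<alpha>) (boundary T) \<xi>)"
    using bmap_act[OF \<alpha>] act_closed by (auto simp flip: act_def)
next
  fix h assume h: "h \<in> extensional (boundary T) \<and>
    homeomorphic_map (boundary_topology T) (boundary_topology T) h \<and>
    (\<forall>g\<in>carrier G. \<forall>\<xi>\<in>boundary T. h (\<phi> g \<circ> \<xi>) = \<phi> (\<alpha> g) \<circ> h \<xi>)"
  then have im: "h ` boundary T = boundary T"
    using homeomorphic_imp_surjective_map topspace_boundary by metis
  show "h = restrict (bmap \<alpha>) (boundary T)"
  proof (rule extensionalityI)
    show "h \<in> extensional (boundary T)" using h by blast
    fix y assume y: "y \<in> boundary T"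
    have "h y = bmap \<alpha> y"
      by (rule bmap_unique[OF \<alpha> _ _ y]) (use h im in \<open>auto simp: act_def simp del: comp_apply o_apply\<close>)
    then show "h y = restrict (bmap \<alpha>) (boundary T) y" using y by simp
  qed simp
qed

text \<open>
  For finitely generated \<open>G\<close> only finitely many homomorphisms \<open>G \<rightarrow> Sym (level T n)\<close> arise by
  restricting some \<open>\<phi> \<circ> \<alpha>\<close>, so their common kernel \<open>K\<close> has finite index. Preimages of cylinders
  under the maps \<open>bmap \<alpha>\<close> are open \<open>K\<close>-invariant sets. The \<open>K\<close>-orbits on \<open>level T m\<close> split only
  finitely often as \<open>m\<close> grows; once they do not split any more, from level \<open>N\<close> on, every open
  \<open>K\<close>-invariant set is a union of cylinders of level \<open>N\<close>.
\<close>

lemma equicontinuous: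
  assumes fg: "finitely_generated G"
  shows "\<exists>N. \<forall>\<xi>\<in>boundary T. \<forall>\<eta>\<in>boundary T. \<xi> N = \<eta> N \<longrightarrow>
    (\<forall>\<alpha>\<in>auto G. bmap \<alpha> \<xi> n = bmap \<alpha> \<eta> n)"
proof -
  define L where "L = level T n"
  have finL: "finite L" by (simp add: L_def finite_level)
  define r where "r \<alpha> g = (\<lambda>v\<in>L. \<phi> (\<alpha> g) v)" for \<alpha> :: "'a \<Rightarrow> 'a" and g
  have r_L: "r \<alpha> g \<in> L \<rightarrow>\<^sub>E L" if "\<alpha> \<in> auto G" "g \<in> carrier G" for \<alpha> g
    unfolding r_def L_def by (rule restrict_level) (rule auto_closed[OF that])
  have finE: "finite (L \<rightarrow>\<^sub>E L)" using finL by (intro finite_PiE)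
  obtain S where S: "S \<subseteq> carrier G" "finite S" "generate G S = carrier G"
    using fg by (auto simp: finitely_generated_def)
  have r_mult: "r \<alpha> (g \<otimes> h) v = r \<alpha> g (r \<alpha> h v)"
    if "\<alpha> \<in> auto G" "g \<in> carrier G" "h \<in> carrier G" "v \<in> L" for \<alpha> g h v
  proof -
    interpret \<alpha>: group_hom G G \<alpha> by (rule auto_group_hom[OF that(1)])
    have "\<phi> (\<alpha> h) v \<in> L" using r_L[OF that(1,3)] that(4) by (auto simp: r_def)
    then show ?thesis using that by (simp add: r_def \<phi>_mult L_def level_def del: \<phi>.hom_mult)
  qed
  have r_one: "r \<alpha> \<one> v = v" if "\<alpha> \<in> auto G" "v \<in> L" for \<alpha> v
  proof -
    interpret \<alpha>: group_hom G G \<alpha> by (rule auto_group_hom[OF that(1)])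
    show ?thesis using that by (simp add: r_def \<phi>_one L_def level_def del: \<phi>.hom_one)
  qed
  have r_ext: "r \<alpha> g = r \<beta> g" if "\<alpha> \<in> auto G" "\<beta> \<in> auto G" "g \<in> carrier G"
    "\<And>v. v \<in> L \<Longrightarrow> r \<alpha> g v = r \<beta> g v" for \<alpha> \<beta> g
    by (rule extensionalityI[of _ L]) (use that in \<open>auto simp: r_def\<close>)
  \<comment> \<open>\<open>r \<alpha>\<close> is an action of G on the finite set L, hence
    determined by its values on the generators; so only finitely many actions arise.\<close>
  have det: "r \<alpha> g = r \<beta> g"
    if ab: "\<alpha> \<in> auto G" "\<beta> \<in> auto G" "\<And>s. s \<in> S \<Longrightarrow> r \<alpha> s = r \<beta> s" and "g \<in> carrier G" for \<alpha> \<beta> g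
  proof -
    have "g \<in> generate G S" using that(4) S(3) by simp
    then show ?thesis
    proof induction
      case one
      show ?case using ab by (intro r_ext) (auto simp: r_one)
    next
      case (incl h)
      then show ?case using ab by simp
    next
      case (inv h)
      have h: "h \<in> carrier G" using inv S by auto
      have "r \<alpha> (inv h) v = r \<beta> (inv h) v" if v: "v \<in> L" for v
      proof -
        let ?w = "r \<alpha> (inv h) v"
        have w: "?w \<in> L" using r_L[OF ab(1), of "inv h"] h v by auto
        have "r \<beta> h ?w = r \<alpha> h ?w" using ab(3)[OF inv] by simp
        also have "\<dots> = v" using r_mult[OF ab(1) h, of "inv h" v] r_one[OF ab(1) v] h v by simp
        finally have "r \<beta> (inv h) (r \<beta> h ?w) = r \<beta> (inv h) v" by simp
        then show ?thesis using r_mult[OF ab(2) _ h, of "inv h" ?w] r_one[OF ab(2) w] h w by simp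
      qed
      then show ?case using ab h by (intro r_ext) auto
    next
      case (eng h1 h2)
      have c: "h1 \<in> carrier G" "h2 \<in> carrier G" using eng.hyps S by auto
      show ?case using ab c eng.IH by (intro r_ext) (auto simp: r_mult)
    qed
  qed
  define Rs where "Rs = (\<lambda>\<alpha>. \<lambda>g\<in>carrier G. r \<alpha> g) ` auto G"
  have finR: "finite Rs"
  proof -
    have "finite ((\<lambda>\<alpha>. \<lambda>s\<in>S. r \<alpha> s) ` auto G)"
    proof (rule finite_subset)
      show "(\<lambda>\<alpha>. \<lambda>s\<in>S. r \<alpha> s) ` auto G \<subseteq> S \<rightarrow>\<^sub>E (L \<rightarrow>\<^sub>E L)"
        using r_L S(1) by (intro image_subsetI restrict_PiE_iff[THEN iffD2]) blast
      show "finite (S \<rightarrow>\<^sub>E (L \<rightarrow>\<^sub>E L))" using S(2) finE by (rule finite_PiE)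
    qed
    then obtain A where A: "A \<subseteq> auto G" "finite A"
      "(\<lambda>\<alpha>. \<lambda>s\<in>S. r \<alpha> s) ` auto G = (\<lambda>\<alpha>. \<lambda>s\<in>S. r \<alpha> s) ` A"
      by (rule finite_image_reps)
    have "Rs \<subseteq> (\<lambda>\<alpha>. \<lambda>g\<in>carrier G. r \<alpha> g) ` A"
    proof
      fix \<rho> assume "\<rho> \<in> Rs"
      then obtain \<alpha> where \<alpha>: "\<alpha> \<in> auto G" "\<rho> = (\<lambda>g\<in>carrier G. r \<alpha> g)" by (auto simp: Rs_def)
      then obtain \<beta> where \<beta>: "\<beta> \<in> A" "(\<lambda>s\<in>S. r \<alpha> s) = (\<lambda>s\<in>S. r \<beta> s)" using A(3) by blast
      have "r \<alpha> s = r \<beta> s" if "s \<in> S" for s using fun_cong[OF \<beta>(2), of s] that by simp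
      then have "\<rho> = (\<lambda>g\<in>carrier G. r \<beta> g)"
        unfolding \<alpha>(2) using det[OF \<alpha>(1)] \<beta> A(1) by (intro restrict_ext) blast
      then show "\<rho> \<in> (\<lambda>\<alpha>. \<lambda>g\<in>carrier G. r \<alpha> g) ` A" using \<beta> by blast
    qed
    then show ?thesis by (rule finite_subset) (use A in simp)
  qed
  \<comment> \<open>f collects the values of all these actions, so elements with the same value
    differ by an element of K and I represents the cosets of K.\<close>
  define f where "f g = (\<lambda>\<rho>\<in>Rs. \<rho> g)" for g
  have Rs_L: "\<rho> g \<in> L \<rightarrow>\<^sub>E L" if \<rho>: "\<rho> \<in> Rs" "g \<in> carrier G" for \<rho> g
  proof -
    obtain \<alpha> where "\<alpha> \<in> auto G" "\<rho> = (\<lambda>g\<in>carrier G. r \<alpha> g)" using \<rho> by (auto simp: Rs_def)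
    then show ?thesis using r_L \<rho>(2) by simp
  qed
  have "f ` carrier G \<subseteq> Rs \<rightarrow>\<^sub>E (L \<rightarrow>\<^sub>E L)"
    unfolding f_def by (intro image_subsetI restrict_PiE_iff[THEN iffD2] ballI Rs_L)
  then have finf: "finite (f ` carrier G)"
    by (rule finite_subset) (intro finite_PiE finR finE)
  define K where "K = {k \<in> carrier G. \<forall>\<alpha>\<in>auto G. \<forall>v\<in>L. r \<alpha> k v = v}"
  have f_r: "r \<alpha> g = r \<alpha> h" if "f g = f h" "\<alpha> \<in> auto G" "g \<in> carrier G" "h \<in> carrier G" for g h \<alpha>
  proof -
    have "(\<lambda>g\<in>carrier G. r \<alpha> g) \<in> Rs" using that by (auto simp: Rs_def)
    then show ?thesis using fun_cong[OF that(1), of "\<lambda>g\<in>carrier G. r \<alpha> g"] that by (simp add: f_def)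
  qed
  have f_K: "g \<otimes> inv h \<in> K" if gh: "f g = f h" "g \<in> carrier G" "h \<in> carrier G" for g h
  proof -
    have "r \<alpha> (g \<otimes> inv h) v = v" if \<alpha>: "\<alpha> \<in> auto G" and v: "v \<in> L" for \<alpha> v
    proof -
      have "r \<alpha> (g \<otimes> inv h) v = r \<alpha> g (r \<alpha> (inv h) v)" using r_mult \<alpha> v gh by simp
      also have "\<dots> = r \<alpha> h (r \<alpha> (inv h) v)" using f_r[OF gh(1) \<alpha> gh(2,3)] by simp
      also have "\<dots> = r \<alpha> (h \<otimes> inv h) v" using r_mult[OF \<alpha> gh(3), of "inv h" v] v gh by simp
      also have "\<dots> = v" using r_one \<alpha> v gh by simp
      finally show ?thesis .
    qed
    then show ?thesis using gh by (simp add: K_def)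
  qed
  have K_mult: "k \<otimes> l \<in> K" if "k \<in> K" "l \<in> K" for k l
    using that r_mult by (simp add: K_def)
  have K_inv: "inv k \<in> K" if "k \<in> K" for k
  proof -
    have k: "k \<in> carrier G" using that by (simp add: K_def)
    have "r \<alpha> (inv k) v = v" if \<alpha>: "\<alpha> \<in> auto G" and v: "v \<in> L" for \<alpha> v
      using r_mult[OF \<alpha> _ k, of "inv k" v] r_one[OF \<alpha> v] \<open>k \<in> K\<close> \<alpha> v k by (simp add: K_def)
    then show ?thesis using k by (simp add: K_def)
  qed
  have K_carrier: "k \<in> carrier G" if "k \<in> K" for k using that by (simp add: K_def)
  obtain x where x: "x \<in> boundary T" using boundary_nonempty by blast
  obtain I where I: "I \<subseteq> carrier G" "finite I" "f ` carrier G = f ` I"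
    by (rule finite_image_reps[OF finf])
  \<comment> \<open>\<open>P m i j\<close> says that i x and j x have the same K-orbit at level m.
    It is inherited by smaller m, so each of the finitely many pairs separates at some level or
    never.\<close>
  define P where "P m i j \<longleftrightarrow> (\<exists>k\<in>K. act k (act i x) m = act j x m)" for m i j
  have P_mono: "P m i j" if "P m' i j" "m \<le> m'" "i \<in> I" "j \<in> I" for m m' i j
  proof -
    obtain k where k: "k \<in> K" "act k (act i x) m' = act j x m'" using \<open>P m' i j\<close> by (auto simp: P_def)
    have "act k (act i x) m = act j x m"
    proof (rule ray_prefix[where n = m'])
      show "act k (act i x) m' = act j x m'" by (rule k(2))
      show "m \<le> m'" by (rule that(2))
      show "act k (act i x) \<in> boundary T" "act j x \<in> boundary T"
        using k(1) that I x K_carrier by auto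
    qed
    then show ?thesis using k by (auto simp: P_def)
  qed
  have "\<exists>N. \<forall>(i, j)\<in>I \<times> I. P N i j \<longrightarrow> (\<forall>m. P m i j)"
  proof -
    \<comment> \<open>b i j is a level at which P fails, if there is one. P then fails at all later
      levels too, so the maximum of these levels serves every pair.\<close>
    define b where "b i j = (SOME b. P b i j \<longrightarrow> (\<forall>m. P m i j))" for i j
    have b: "P (b i j) i j \<longrightarrow> (\<forall>m. P m i j)" for i j
      unfolding b_def by (rule someI_ex) blast
    define N where "N = Max (insert 0 ((\<lambda>(i, j). b i j) ` (I \<times> I)))"
    have "b i j \<le> N" if "i \<in> I" "j \<in> I" for i j
      unfolding N_def using I(2) that by (intro Max_ge) auto
    then show ?thesis using b P_mono by (intro exI[of _ N]) blast
  qed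
  then obtain N where N: "\<And>i j m. i \<in> I \<Longrightarrow> j \<in> I \<Longrightarrow> P N i j \<Longrightarrow> P m i j" by blast
  have rep: "\<exists>i\<in>I. \<exists>k\<in>K. \<xi> m = act k (act i x) m" if \<xi>: "\<xi> \<in> boundary T" for \<xi> m
  proof -
    obtain g where g: "g \<in> carrier G" "act g x m = \<xi> m" using trans[OF x \<xi>] by blast
    then obtain i where i: "i \<in> I" "f g = f i" using I(3) by blast
    have ci: "i \<in> carrier G" using i I by auto
    have "act (g \<otimes> inv i) (act i x) = act g x" using g ci x by (simp add: act_mult act_inv)
    then show ?thesis using f_K[OF i(2) g(1) ci] i(1) g by metis
  qed
  have orbit: "\<exists>k\<in>K. act k \<xi> m = \<eta> m"
    if \<xi>: "\<xi> \<in> boundary T" and \<eta>: "\<eta> \<in> boundary T" and eq: "\<xi> N = \<eta> N" and m: "N \<le> m" for \<xi> \<eta> m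
  proof -
    obtain i k where i: "i \<in> I" "k \<in> K" "\<xi> m = act k (act i x) m" using rep[OF \<xi>] by blast
    obtain j l where j: "j \<in> I" "l \<in> K" "\<eta> m = act l (act j x) m" using rep[OF \<eta>] by blast
    have c: "i \<in> carrier G" "j \<in> carrier G" "k \<in> carrier G" "l \<in> carrier G"
      using i j I K_carrier by auto
    have "\<xi> N = act k (act i x) N" using ray_prefix[of \<xi> "act k (act i x)" m N] \<xi> i(3) m c x by simp
    moreover have "\<eta> N = act l (act j x) N" using ray_prefix[of \<eta> "act l (act j x)" m N] \<eta> j(3) m c x by simp
    ultimately have "act l (act j x) N = act k (act i x) N" using eq by simp
    then have "act (inv l) (act k (act i x)) N = act j x N"
      using act_eq_iff[of l "act (inv l) (act k (act i x))" "act j x" N] c x by (simp add: act_inv)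
    then have "act (inv l \<otimes> k) (act i x) N = act j x N" using c x by (simp add: act_mult)
    then have "P N i j" using K_mult[OF K_inv[OF j(2)] i(2)] by (auto simp: P_def)
    then have "P m i j" using N i j by blast
    then obtain s where s: "s \<in> K" "act s (act i x) m = act j x m" by (auto simp: P_def)
    have cs: "s \<in> carrier G" using s K_carrier by blast
    have "act (inv k) \<xi> m = act i x m"
      using act_eq_iff[of k "act (inv k) \<xi>" "act i x" m] i(3) c x \<xi> by (simp add: act_inv)
    then have "act s (act (inv k) \<xi>) m = act s (act i x) m" using cs c x \<xi> act_eq_iff by simp
    then have "act l (act s (act (inv k) \<xi>)) m = act l (act j x) m" using cs c x \<xi> act_eq_iff s by simp
    then have "act (l \<otimes> s \<otimes> inv k) \<xi> m = \<eta> m" using j(3) cs c \<xi> by (simp add: act_mult)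
    moreover have "l \<otimes> s \<otimes> inv k \<in> K" using i j s K_mult K_inv by simp
    ultimately show ?thesis by blast
  qed
  have "bmap \<alpha> \<xi> n = bmap \<alpha> \<eta> n"
    if \<xi>: "\<xi> \<in> boundary T" and \<eta>: "\<eta> \<in> boundary T" and eq: "\<xi> N = \<eta> N" and \<alpha>: "\<alpha> \<in> auto G" for \<xi> \<eta> \<alpha>
  proof -
    \<comment> \<open>The level k0 of local constancy depends on \<alpha> and \<xi>. That does no
      harm: some element of K moves \<eta> as close to \<xi> as desired, and elements of K do not
      change the level-n value of \<open>bmap \<alpha>\<close>.\<close>
    obtain k0 where k0: "\<And>z. z \<in> boundary T \<Longrightarrow> z k0 = \<xi> k0 \<Longrightarrow> bmap \<alpha> z n = bmap \<alpha> \<xi> n"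
      using bmap_continuous[OF \<alpha> \<xi>] by blast
    define m where "m = max k0 N"
    obtain k where k: "k \<in> K" "act k \<eta> m = \<xi> m"
      using orbit[OF \<eta> \<xi> eq[symmetric], of m] by (auto simp: m_def)
    have ck: "k \<in> carrier G" using k K_carrier by blast
    have "act k \<eta> k0 = \<xi> k0" using ray_prefix[of "act k \<eta>" \<xi> m k0] \<xi> k(2) ck \<eta> by (simp add: m_def)
    then have "bmap \<alpha> (act k \<eta>) n = bmap \<alpha> \<xi> n" using k0 ck \<eta> by simp
    moreover have "bmap \<alpha> (act k \<eta>) n = bmap \<alpha> \<eta> n"
    proof -
      have "bmap \<alpha> \<eta> n \<in> L" using bmap_closed[OF \<alpha> \<eta>] by (auto simp: L_def level_eq)
      then have "\<phi> (\<alpha> k) (bmap \<alpha> \<eta> n) = bmap \<alpha> \<eta> n" using k(1) \<alpha> by (auto simp: K_def r_def)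
      then show ?thesis using bmap_act[OF \<alpha> ck \<eta>] by (simp add: act_apply)
    qed
    ultimately show ?thesis by simp
  qed
  then show ?thesis by blast
qed

end

section \<open>The hat tree\<close>

lemma (in rooted_tree) confluence_ge_iff:
  assumes "\<xi> \<in> boundary T" "\<eta> \<in> boundary T"
  shows "enat n \<le> confluence \<xi> \<eta> \<longleftrightarrow> \<xi> n = \<eta> n"
proof
  assume "\<xi> n = \<eta> n"
  then have "n \<in> {n. \<forall>i\<le>n. \<xi> i = \<eta> i}" using ray_prefix[OF assms] by auto
  then show "enat n \<le> confluence \<xi> \<eta>" unfolding confluence_def by (rule SUP_upper)
next
  assume le: "enat n \<le> confluence \<xi> \<eta>"
  show "\<xi> n = \<eta> n"
  proof (rule ccontr)
    assume ne: "\<xi> n \<noteq> \<eta> n"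
    \<comment> \<open>Both rays start at the root, so n is positive and n - 1 is a true
      predecessor.\<close>
    have "\<xi> 0 = \<eta> 0" using assms by (simp add: boundary_def)
    then have "n \<noteq> 0" using ne by metis
    have "confluence \<xi> \<eta> \<le> enat (n - 1)"
      unfolding confluence_def
    proof (rule SUP_least)
      fix m assume "m \<in> {m. \<forall>i\<le>m. \<xi> i = \<eta> i}"
      then have "\<forall>i\<le>m. \<xi> i = \<eta> i" by simp
      then have "m < n" using ne not_le by blast
      then show "enat m \<le> enat (n - 1)" by simp
    qed
    then have "enat n \<le> enat (n - 1)" using le by order
    then show False using \<open>n \<noteq> 0\<close> by simp
  qed
qed

locale fg_wb_action = wb_action +
  assumes fg: "finitely_generated G"
begin

definition hat_eq :: "nat \<Rightarrow> (nat \<Rightarrow> 'c) \<Rightarrow> (nat \<Rightarrow> 'c) \<Rightarrow> bool" where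
  "hat_eq n \<xi> \<eta> \<longleftrightarrow> (\<forall>\<alpha>\<in>auto G. bmap \<alpha> \<xi> n = bmap \<alpha> \<eta> n)"

definition hat_cls :: "nat \<Rightarrow> (nat \<Rightarrow> 'c) \<Rightarrow> (nat \<Rightarrow> 'c) set" where
  "hat_cls n \<xi> = {\<eta> \<in> boundary T. hat_eq n \<xi> \<eta>}"

lemma hat_confluence_ge_iff:
  assumes "\<xi> \<in> boundary T" "\<eta> \<in> boundary T"
  shows "enat n \<le> hat_confluence G T \<phi> \<xi> \<eta> \<longleftrightarrow> hat_eq n \<xi> \<eta>"
  unfolding hat_confluence_def le_INF_iff hat_eq_def
  using assms by (simp add: AutoGroup_simps boundary_act_eq confluence_ge_iff bmap_closed)

lemma hat_classes_eq: "hat_classes G T \<phi> n = hat_cls n ` boundary T"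
proof -
  have "{(\<xi>, \<eta>). \<xi> \<in> boundary T \<and> \<eta> \<in> boundary T \<and> enat n \<le> hat_confluence G T \<phi> \<xi> \<eta>} `` {\<xi>} = hat_cls n \<xi>"
    if "\<xi> \<in> boundary T" for \<xi>
    using that hat_confluence_ge_iff[OF that] by (auto simp: hat_cls_def)
  then show ?thesis by (auto simp: hat_classes_def quotient_def)
qed

lemma hat_eq_refl [simp]: "hat_eq n \<xi> \<xi>"
  by (simp add: hat_eq_def)

lemma hat_eq_mono:
  assumes "hat_eq n \<xi> \<eta>" "m \<le> n" "\<xi> \<in> boundary T" "\<eta> \<in> boundary T"
  shows "hat_eq m \<xi> \<eta>"
  unfolding hat_eq_def
proof
  fix \<alpha> assume \<alpha>: "\<alpha> \<in> auto G"
  show "bmap \<alpha> \<xi> m = bmap \<alpha> \<eta> m"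
    by (rule ray_prefix[OF bmap_closed[OF \<alpha> assms(3)] bmap_closed[OF \<alpha> assms(4)] _ assms(2)])
      (use assms(1) \<alpha> in \<open>simp add: hat_eq_def\<close>)
qed

lemma hat_eq_imp_eq:
  assumes "hat_eq n \<xi> \<eta>" "\<xi> \<in> boundary T" "\<eta> \<in> boundary T"
  shows "\<xi> n = \<eta> n"
proof -
  have "bmap (\<lambda>x\<in>carrier G. x) \<xi> n = bmap (\<lambda>x\<in>carrier G. x) \<eta> n"
    using assms(1) id_in_auto unfolding hat_eq_def by blast
  then show ?thesis by (simp only: bmap_one[OF assms(2)] bmap_one[OF assms(3)])
qed

lemma hat_eq_0:
  assumes "\<xi> \<in> boundary T" "\<eta> \<in> boundary T"
  shows "hat_eq 0 \<xi> \<eta>"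
proof -
  have "bmap \<alpha> \<zeta> 0 = root T" if "\<alpha> \<in> auto G" "\<zeta> \<in> boundary T" for \<alpha> \<zeta>
    using bmap_closed[OF that] by (simp add: boundary_def)
  then show ?thesis using assms by (simp add: hat_eq_def)
qed

lemma hat_eq_uniform: "\<exists>N. \<forall>\<xi>\<in>boundary T. \<forall>\<eta>\<in>boundary T. \<xi> N = \<eta> N \<longrightarrow> hat_eq n \<xi> \<eta>"
  using equicontinuous[OF fg, of n] by (simp only: hat_eq_def)

text \<open>The quantifier in \<open>hat_eq\<close> runs over all of Aut(G), which is closed under
  composition with \<alpha>.\<close>

lemma hat_eq_bmap:
  assumes "\<alpha> \<in> auto G" "hat_eq n \<xi> \<eta>" "\<xi> \<in> boundary T" "\<eta> \<in> boundary T"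
  shows "hat_eq n (bmap \<alpha> \<xi>) (bmap \<alpha> \<eta>)"
  unfolding hat_eq_def
proof
  fix \<beta> assume \<beta>: "\<beta> \<in> auto G"
  have "bmap (compose (carrier G) \<beta> \<alpha>) \<xi> n = bmap (compose (carrier G) \<beta> \<alpha>) \<eta> n"
    using assms(2) compose_auto[OF \<beta> assms(1)] unfolding hat_eq_def by blast
  then show "bmap \<beta> (bmap \<alpha> \<xi>) n = bmap \<beta> (bmap \<alpha> \<eta>) n"
    using bmap_compose[OF \<beta> assms(1,3)] bmap_compose[OF \<beta> assms(1,4)] by simp
qed

lemma hat_cls_self [simp]: "\<xi> \<in> boundary T \<Longrightarrow> \<xi> \<in> hat_cls n \<xi>"
  by (simp add: hat_cls_def)

lemma hat_cls_subset: "hat_cls n \<xi> \<subseteq> boundary T"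
  by (auto simp: hat_cls_def)

lemma hat_cls_cong: "hat_eq n \<xi> \<eta> \<Longrightarrow> hat_cls n \<xi> = hat_cls n \<eta>"
  by (simp add: hat_cls_def hat_eq_def)

lemma hat_cls_eq: "\<eta> \<in> hat_cls n \<xi> \<Longrightarrow> hat_cls n \<eta> = hat_cls n \<xi>"
  by (rule hat_cls_cong) (simp add: hat_cls_def hat_eq_def)

lemma hat_cls_mono:
  assumes "m \<le> n" "\<xi> \<in> boundary T"
  shows "hat_cls n \<xi> \<subseteq> hat_cls m \<xi>"
  using hat_eq_mono[OF _ assms] unfolding hat_cls_def by blast

lemma hat_cls_0: "\<xi> \<in> boundary T \<Longrightarrow> hat_cls 0 \<xi> = boundary T"
  using hat_eq_0[of \<xi>] unfolding hat_cls_def by blast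

text \<open>By equicontinuity a class of level n is determined by the vertex of any of its rays at a
  fixed level N.\<close>

lemma finite_classes: "finite (hat_cls n ` boundary T)"
proof -
  obtain N where N: "\<And>\<xi> \<eta>. \<xi> \<in> boundary T \<Longrightarrow> \<eta> \<in> boundary T \<Longrightarrow> \<xi> N = \<eta> N \<Longrightarrow> hat_eq n \<xi> \<eta>"
    using hat_eq_uniform by blast
  have "hat_cls n ` boundary T \<subseteq> (\<lambda>v. hat_cls n (SOME \<xi>. \<xi> \<in> boundary T \<and> \<xi> N = v)) ` level T N"
  proof
    fix C assume "C \<in> hat_cls n ` boundary T"
    then obtain \<xi> where \<xi>: "\<xi> \<in> boundary T" "C = hat_cls n \<xi>" by blast
    let ?\<eta> = "SOME \<eta>. \<eta> \<in> boundary T \<and> \<eta> N = \<xi> N"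
    have "?\<eta> \<in> boundary T \<and> ?\<eta> N = \<xi> N"
      by (rule someI[of "\<lambda>\<eta>. \<eta> \<in> boundary T \<and> \<eta> N = \<xi> N" \<xi>]) (use \<xi> in simp)
    then have "C = hat_cls n ?\<eta>" using N[OF \<xi>(1), of ?\<eta>] hat_cls_cong \<xi> by simp
    moreover have "\<xi> N \<in> level T N" using \<xi> by (auto simp: level_eq)
    ultimately show "C \<in> (\<lambda>v. hat_cls n (SOME \<xi>. \<xi> \<in> boundary T \<and> \<xi> N = v)) ` level T N" by blast
  qed
  then show ?thesis by (rule finite_subset) (simp add: finite_level)
qed

section \<open>The classes as a rooted tree\<close>

abbreviation hat :: "(nat \<times> (nat \<Rightarrow> 'c) set) rooted_graph" where
  "hat \<equiv> hat_tree G T \<phi>"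

lemma verts_hat: "(n, C) \<in> verts hat \<longleftrightarrow> C \<in> hat_cls n ` boundary T"
  by (simp add: hat_tree_def hat_classes_eq)

lemma verts_hatE:
  assumes "u \<in> verts hat"
  obtains n \<xi> where "u = (n, hat_cls n \<xi>)" "\<xi> \<in> boundary T"
  using assms by (cases u) (auto simp: verts_hat)

lemma hat_cls_in_hat [simp]: "\<xi> \<in> boundary T \<Longrightarrow> (n, hat_cls n \<xi>) \<in> verts hat"
  by (simp add: verts_hat)

text \<open>A class lies in exactly one class of the preceding level, so any of its rays finds that
  class. At the root the truncated subtraction returns the root itself.\<close>

definition hat_parent :: "nat \<times> (nat \<Rightarrow> 'c) set \<Rightarrow> nat \<times> (nat \<Rightarrow> 'c) set" where
  "hat_parent u = (fst u - 1, hat_cls (fst u - 1) (SOME \<xi>. \<xi> \<in> snd u))"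

lemma hat_parent_hat_cls:
  assumes "\<xi> \<in> boundary T"
  shows "hat_parent (Suc n, hat_cls (Suc n) \<xi>) = (n, hat_cls n \<xi>)"
proof -
  have "(SOME \<eta>. \<eta> \<in> hat_cls (Suc n) \<xi>) \<in> hat_cls (Suc n) \<xi>"
    by (rule someI[of "\<lambda>\<eta>. \<eta> \<in> hat_cls (Suc n) \<xi>"]) (rule hat_cls_self[OF assms])
  then have "(SOME \<eta>. \<eta> \<in> hat_cls (Suc n) \<xi>) \<in> hat_cls n \<xi>" using hat_cls_mono[OF _ assms, of n "Suc n"] by auto
  then show ?thesis using hat_cls_eq by (simp add: hat_parent_def)
qed

lemma adj_hat:
  "adj hat u v \<longleftrightarrow> u \<in> verts hat \<and> v \<in> verts hat \<and>
    (fst v = Suc (fst u) \<and> hat_parent v = u \<or> fst u = Suc (fst v) \<and> hat_parent u = v)"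
proof -
  have *: "fst v = Suc (fst u) \<and> snd v \<subseteq> snd u \<longleftrightarrow> fst v = Suc (fst u) \<and> hat_parent v = u"
    if V: "u \<in> verts hat" "v \<in> verts hat" for u v
  proof -
    obtain n \<xi> where u: "u = (n, hat_cls n \<xi>)" "\<xi> \<in> boundary T" using verts_hatE[OF V(1)] .
    obtain m \<eta> where v: "v = (m, hat_cls m \<eta>)" "\<eta> \<in> boundary T" using verts_hatE[OF V(2)] .
    show ?thesis
    proof (cases "m = Suc n")
      case True
      have "hat_cls (Suc n) \<eta> \<subseteq> hat_cls n \<xi> \<longleftrightarrow> hat_cls n \<eta> = hat_cls n \<xi>"
      proof
        assume "hat_cls (Suc n) \<eta> \<subseteq> hat_cls n \<xi>"
        then have "\<eta> \<in> hat_cls n \<xi>" using hat_cls_self[OF v(2)] by blast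
        then show "hat_cls n \<eta> = hat_cls n \<xi>" by (rule hat_cls_eq)
      next
        assume "hat_cls n \<eta> = hat_cls n \<xi>"
        then show "hat_cls (Suc n) \<eta> \<subseteq> hat_cls n \<xi>" using hat_cls_mono[OF _ v(2), of n "Suc n"] by simp
      qed
      then show ?thesis using u v True hat_parent_hat_cls by simp
    qed (use u v in simp)
  qed
  show ?thesis
  proof (cases "u \<in> verts hat \<and> v \<in> verts hat")
    case True
    obtain n C m D where "u = (n, C)" "v = (m, D)" by (metis surj_pair)
    then show ?thesis using True *[of u v] *[of v u] by (auto simp: hat_tree_def)
  next
    case False
    then show ?thesis by (cases u; cases v) (auto simp: hat_tree_def)
  qed
qed

lemma hat_ranked: "ranked_tree hat fst hat_parent"
proof
  show "root hat \<in> verts hat" "fst (root hat) = 0"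
    using boundary_nonempty hat_cls_0 by (auto simp: hat_tree_def hat_classes_eq)
  show "u = root hat" if "u \<in> verts hat" "fst u = 0" for u
    using verts_hatE[OF that(1)] that(2) hat_cls_0 by (force simp: hat_tree_def)
  show "hat_parent u \<in> verts hat \<and> fst (hat_parent u) = n" if "u \<in> verts hat" "fst u = Suc n" for u n
    using verts_hatE[OF that(1)] that(2) hat_parent_hat_cls by (metis hat_cls_in_hat fst_conv)
  show "finite {w \<in> verts hat. fst w = Suc (fst u) \<and> hat_parent w = u}" if "u \<in> verts hat" for u
  proof (rule finite_subset)
    show "{w \<in> verts hat. fst w = Suc (fst u) \<and> hat_parent w = u} \<subseteq> {Suc (fst u)} \<times> hat_cls (Suc (fst u)) ` boundary T"
      by (auto simp: verts_hat)
  qed (simp add: finite_classes)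
  show "\<exists>w\<in>verts hat. fst w = Suc (fst u) \<and> hat_parent w = u" if V: "u \<in> verts hat" for u
  proof -
    obtain n \<xi> where "u = (n, hat_cls n \<xi>)" "\<xi> \<in> boundary T" using verts_hatE[OF V] .
    then show ?thesis using hat_parent_hat_cls by (intro bexI[of _ "(Suc n, hat_cls (Suc n) \<xi>)"]) auto
  qed
qed (rule adj_hat)

lemmas rooted_tree_hat = ranked_tree.rooted_tree[OF hat_ranked]
lemmas depth_hat = ranked_tree.depth_eq[OF hat_ranked]
lemmas child_rel_hat = ranked_tree.child_rel_iff[OF hat_ranked]

lemma level_hat: "level hat n = {n} \<times> hat_cls n ` boundary T"
  using depth_hat by (auto simp: level_def verts_hat)

text \<open>Both conditions are needed: one set of rays can be a class at several levels, and
  inclusion does not tell which of these vertices is the ancestor.\<close>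

lemma subtree_hat:
  assumes u: "(n, C) \<in> verts hat" and w: "(m, D) \<in> verts hat"
  shows "(m, D) \<in> subtree hat (n, C) \<longleftrightarrow> n \<le> m \<and> D \<subseteq> C"
proof
  have "fst u \<le> fst w \<and> snd w \<subseteq> snd u" if "(u, w) \<in> (child_rel hat)\<^sup>*" for u w
    using that
  proof induction
    case (step x y)
    obtain k \<xi> where y: "y = (k, hat_cls k \<xi>)" "\<xi> \<in> boundary T"
      using step(2) verts_hatE[of y] by (auto simp: child_rel_hat)
    define j where "j = fst x"
    have "k = Suc j" "x = (j, hat_cls j \<xi>)"
      using step(2) y hat_parent_hat_cls[OF y(2), of j] by (auto simp: child_rel_hat j_def)
    then show ?case using step.IH y hat_cls_mono[of j k \<xi>] by auto
  qed simp
  from this[of "(n, C)" "(m, D)"] show "n \<le> m \<and> D \<subseteq> C" if "(m, D) \<in> subtree hat (n, C)"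
    using that by (simp add: subtree_def)
next
  assume le: "n \<le> m \<and> D \<subseteq> C"
  obtain \<xi> where \<xi>: "D = hat_cls m \<xi>" "\<xi> \<in> boundary T" using w by (auto simp: verts_hat)
  obtain \<eta> where \<eta>: "C = hat_cls n \<eta>" using u by (auto simp: verts_hat)
  have "\<xi> \<in> hat_cls n \<eta>" using le \<xi> \<eta> hat_cls_self by blast
  then have C: "C = hat_cls n \<xi>" using hat_cls_eq \<eta> by simp
  have "((n, hat_cls n \<xi>), (n + k, hat_cls (n + k) \<xi>)) \<in> (child_rel hat)\<^sup>*" for k
  proof (induction k)
    case (Suc k)
    have "((n + k, hat_cls (n + k) \<xi>), (n + Suc k, hat_cls (n + Suc k) \<xi>)) \<in> child_rel hat"
      using \<xi> hat_parent_hat_cls by (simp add: child_rel_hat)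
    with Suc show ?case by (rule rtrancl_into_rtrancl)
  qed simp
  from this[of "m - n"] show "(m, D) \<in> subtree hat (n, C)"
    using le \<xi> C by (simp add: subtree_def)
qed

lemma classes_meet:
  assumes "C \<in> hat_cls n ` boundary T" "D \<in> hat_cls m ` boundary T" "C \<inter> D \<noteq> {}" "n \<le> m"
  shows "D \<subseteq> C"
proof -
  obtain \<zeta> where \<zeta>: "\<zeta> \<in> C" "\<zeta> \<in> D" using assms by blast
  then have "C = hat_cls n \<zeta>" "D = hat_cls m \<zeta>" "\<zeta> \<in> boundary T"
    using assms(1,2) hat_cls_eq hat_cls_subset by blast+
  then show ?thesis using hat_cls_mono assms by simp
qed

section \<open>The action of Aut(G) on the hat tree\<close>

lemma bmap_hat_cls:
  assumes \<alpha>: "\<alpha> \<in> auto G" and \<xi>: "\<xi> \<in> boundary T"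
  shows "bmap \<alpha> ` hat_cls n \<xi> = hat_cls n (bmap \<alpha> \<xi>)"
proof -
  obtain \<beta> where \<beta>: "\<beta> \<in> auto G" "\<And>g. g \<in> carrier G \<Longrightarrow> \<beta> (\<alpha> g) = g"
    and inv1: "\<And>z. z \<in> boundary T \<Longrightarrow> bmap \<alpha> (bmap \<beta> z) = z"
    and inv2: "\<And>z. z \<in> boundary T \<Longrightarrow> bmap \<beta> (bmap \<alpha> z) = z"
    using bmap_inverse[OF \<alpha>] by blast
  show ?thesis
  proof
    show "bmap \<alpha> ` hat_cls n \<xi> \<subseteq> hat_cls n (bmap \<alpha> \<xi>)"
      using \<alpha> \<xi> by (auto simp: hat_cls_def bmap_closed hat_eq_bmap)
    show "hat_cls n (bmap \<alpha> \<xi>) \<subseteq> bmap \<alpha> ` hat_cls n \<xi>"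
    proof
      fix \<eta> assume "\<eta> \<in> hat_cls n (bmap \<alpha> \<xi>)"
      then have \<eta>: "\<eta> \<in> boundary T" "hat_eq n (bmap \<alpha> \<xi>) \<eta>" by (auto simp: hat_cls_def)
      then have "hat_eq n \<xi> (bmap \<beta> \<eta>)"
        using hat_eq_bmap[OF \<beta>(1) \<eta>(2)] \<xi> \<alpha> inv2 by (simp add: bmap_closed)
      then have "bmap \<beta> \<eta> \<in> hat_cls n \<xi>" using \<eta> \<beta>(1) by (simp add: hat_cls_def bmap_closed)
      then show "\<eta> \<in> bmap \<alpha> ` hat_cls n \<xi>" using inv1[OF \<eta>(1)] by force
    qed
  qed
qed

lemma hat_act_hat_cls:
  assumes \<alpha>: "\<alpha> \<in> auto G" and \<xi>: "\<xi> \<in> boundary T"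
  shows "hat_act G T \<phi> \<alpha> (n, hat_cls n \<xi>) = (n, hat_cls n (bmap \<alpha> \<xi>))"
proof -
  have "boundary_act G T \<phi> \<alpha> ` hat_cls n \<xi> = bmap \<alpha> ` hat_cls n \<xi>"
    using hat_cls_subset by (intro image_cong) (auto simp: boundary_act_eq[OF \<alpha>])
  then show ?thesis using \<xi> by (simp add: hat_act_def bmap_hat_cls[OF \<alpha> \<xi>])
qed

lemma hat_act_one: "hat_act G T \<phi> (\<lambda>x\<in>carrier G. x) = (\<lambda>u\<in>verts hat. u)"
proof (rule extensionalityI)
  fix u assume "u \<in> verts hat"
  then show "hat_act G T \<phi> (\<lambda>x\<in>carrier G. x) u = (\<lambda>u\<in>verts hat. u) u"
    by (elim verts_hatE) (simp add: hat_act_hat_cls id_in_auto bmap_one)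
qed (auto simp: hat_act_def)

lemma hat_act_compose:
  assumes \<alpha>: "\<alpha> \<in> auto G" and \<beta>: "\<beta> \<in> auto G"
  shows "hat_act G T \<phi> (compose (carrier G) \<alpha> \<beta>) =
    compose (verts hat) (hat_act G T \<phi> \<alpha>) (hat_act G T \<phi> \<beta>)"
proof (rule extensionalityI)
  fix u assume "u \<in> verts hat"
  then show "hat_act G T \<phi> (compose (carrier G) \<alpha> \<beta>) u =
      compose (verts hat) (hat_act G T \<phi> \<alpha>) (hat_act G T \<phi> \<beta>) u"
    using assms
    by (elim verts_hatE) (simp add: hat_act_hat_cls compose_auto bmap_compose bmap_closed compose_eq)
qed (auto simp: hat_act_def)

lemma hat_act_adj:
  assumes \<alpha>: "\<alpha> \<in> auto G" and "adj hat u v"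
  shows "adj hat (hat_act G T \<phi> \<alpha> u) (hat_act G T \<phi> \<alpha> v)"
proof -
  have *: "hat_parent (hat_act G T \<phi> \<alpha> v) = hat_act G T \<phi> \<alpha> u \<and> fst (hat_act G T \<phi> \<alpha> v) = Suc (fst (hat_act G T \<phi> \<alpha> u))"
    if v: "v \<in> verts hat" "fst v = Suc (fst u)" "hat_parent v = u" for u v
  proof -
    obtain m \<xi> where m: "v = (m, hat_cls m \<xi>)" "\<xi> \<in> boundary T" using verts_hatE[OF v(1)] .
    define n where "n = fst u"
    have n: "m = Suc n" "u = (n, hat_cls n \<xi>)"
      using m(1) v(2,3) hat_parent_hat_cls[OF m(2), of n] by (auto simp: n_def)
    show ?thesis using m n \<alpha> by (simp add: hat_act_hat_cls hat_parent_hat_cls bmap_closed)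
  qed
  have "hat_act G T \<phi> \<alpha> w \<in> verts hat" if "w \<in> verts hat" for w
    using that \<alpha> by (elim verts_hatE) (simp add: hat_act_hat_cls bmap_closed)
  then show ?thesis using assms(2) *[of v u] *[of u v] unfolding adj_hat by metis
qed

lemma hat_act_auto:
  assumes \<alpha>: "\<alpha> \<in> auto G"
  shows "hat_act G T \<phi> \<alpha> \<in> tree_auto hat"
proof -
  interpret A: group "AutoGroup G" by (rule AutoGroup)
  let ?f = "hat_act G T \<phi>"
  have "\<exists>\<beta>\<in>auto G. compose (carrier G) \<alpha> \<beta> = (\<lambda>x\<in>carrier G. x) \<and> compose (carrier G) \<beta> \<alpha> = (\<lambda>x\<in>carrier G. x)"
    using A.inv_closed[of \<alpha>] A.r_inv[of \<alpha>] A.l_inv[of \<alpha>] \<alpha>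
    by (auto simp: AutoGroup_simps mult_AutoGroup intro!: bexI[of _ "inv\<^bsub>AutoGroup G\<^esub> \<alpha>"])
  then obtain \<beta> where \<beta>: "\<beta> \<in> auto G" "compose (carrier G) \<alpha> \<beta> = (\<lambda>x\<in>carrier G. x)"
    "compose (carrier G) \<beta> \<alpha> = (\<lambda>x\<in>carrier G. x)" by blast
  have closed: "?f \<gamma> u \<in> verts hat" if "u \<in> verts hat" "\<gamma> \<in> auto G" for u \<gamma>
    using that by (elim verts_hatE) (simp add: hat_act_hat_cls bmap_closed)
  have 1: "?f \<alpha> (?f \<beta> u) = u" "?f \<beta> (?f \<alpha> u) = u" if u: "u \<in> verts hat" for u
    using fun_cong[OF hat_act_compose[OF \<alpha> \<beta>(1)], of u] fun_cong[OF hat_act_compose[OF \<beta>(1) \<alpha>], of u]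
    by (simp_all add: \<beta>(2,3) u hat_act_one compose_eq)
  have "bij_betw (?f \<alpha>) (verts hat) (verts hat)"
    using 1 closed \<alpha> \<beta>(1) by (intro bij_betwI[where g = "?f \<beta>"]) auto
  moreover have "?f \<alpha> \<in> extensional (verts hat)" by (simp add: hat_act_def)
  moreover have "?f \<alpha> (root hat) = root hat"
  proof -
    obtain \<xi> where \<xi>: "\<xi> \<in> boundary T" using boundary_nonempty by blast
    then have "root hat = (0, hat_cls 0 \<xi>)" by (simp add: hat_tree_def hat_cls_0)
    then show ?thesis using hat_act_hat_cls[OF \<alpha> \<xi>, of 0] \<xi> \<alpha> by (simp add: hat_cls_0 bmap_closed)
  qed
  moreover have "adj hat (?f \<alpha> u) (?f \<alpha> v) \<longleftrightarrow> adj hat u v" if "u \<in> verts hat" "v \<in> verts hat" for u v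
    using hat_act_adj[OF \<alpha>, of u v] hat_act_adj[OF \<beta>(1), of "?f \<alpha> u" "?f \<alpha> v"] 1 that by auto
  ultimately show ?thesis by (simp add: tree_auto_def Bij_def)
qed

lemma hat_act_hom: "hat_act G T \<phi> \<in> hom (AutoGroup G) (TreeAuto hat)"
  by (rule homI) (simp_all add: AutoGroup_simps carrier_TreeAuto hat_act_auto mult_AutoGroup
    hat_act_compose mult_TreeAuto)

lemma bmap_inj:
  assumes "\<alpha> \<in> auto G" "\<xi> \<in> boundary T" "\<eta> \<in> boundary T" "bmap \<alpha> \<xi> = bmap \<alpha> \<eta>"
  shows "\<xi> = \<eta>"
proof -
  obtain \<beta> where \<beta>: "\<beta> \<in> auto G" "\<And>g. g \<in> carrier G \<Longrightarrow> \<beta> (\<alpha> g) = g"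
    "\<And>z. z \<in> boundary T \<Longrightarrow> bmap \<alpha> (bmap \<beta> z) = z" "\<And>z. z \<in> boundary T \<Longrightarrow> bmap \<beta> (bmap \<alpha> z) = z"
    using bmap_inverse[OF assms(1)] by blast
  from \<beta>(4) show ?thesis using assms by metis
qed

lemma hat_cls_all_eq:
  assumes "\<xi> \<in> boundary T" "\<eta> \<in> boundary T" "\<And>m. n \<le> m \<Longrightarrow> hat_cls m \<xi> = hat_cls m \<eta>"
  shows "\<xi> = \<eta>"
proof
  fix k
  have "\<eta> \<in> hat_cls (max n k) \<xi>" using assms(3)[of "max n k"] hat_cls_self[OF assms(2), of "max n k"] by simp
  then have "\<xi> (max n k) = \<eta> (max n k)" using hat_eq_imp_eq assms(1,2) by (simp add: hat_cls_def)
  then show "\<xi> k = \<eta> k" by (rule ray_prefix[OF assms(1,2)]) simp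
qed

text \<open>The classes of a ray at all levels determine the ray, so the action on the hat tree
  determines \<open>bmap \<alpha>\<close>. Equivariance then describes the action of \<alpha> g on
  rays, and faithfulness of G gives \<alpha> g.\<close>

lemma hat_act_inj: "inj_on (hat_act G T \<phi>) (auto G)"
proof (rule inj_onI)
  fix \<alpha> \<beta> assume ab: "\<alpha> \<in> auto G" "\<beta> \<in> auto G" "hat_act G T \<phi> \<alpha> = hat_act G T \<phi> \<beta>"
  have bm: "bmap \<alpha> \<xi> = bmap \<beta> \<xi>" if \<xi>: "\<xi> \<in> boundary T" for \<xi>
  proof (rule hat_cls_all_eq)
    show "bmap \<alpha> \<xi> \<in> boundary T" "bmap \<beta> \<xi> \<in> boundary T" using ab \<xi> by (auto simp: bmap_closed)
    show "hat_cls m (bmap \<alpha> \<xi>) = hat_cls m (bmap \<beta> \<xi>)" for m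
      using hat_act_hat_cls[OF ab(1) \<xi>, of m] hat_act_hat_cls[OF ab(2) \<xi>, of m] ab(3) by simp
  qed
  show "\<alpha> = \<beta>"
  proof (rule extensionalityI)
    show "\<alpha> \<in> extensional (carrier G)" "\<beta> \<in> extensional (carrier G)"
      using ab by (auto simp: auto_def Bij_def)
    fix g assume g: "g \<in> carrier G"
    obtain \<gamma> where \<gamma>: "\<gamma> \<in> auto G" "\<And>g. g \<in> carrier G \<Longrightarrow> \<gamma> (\<alpha> g) = g"
      and inv: "\<And>z. z \<in> boundary T \<Longrightarrow> bmap \<alpha> (bmap \<gamma> z) = z" "\<And>z. z \<in> boundary T \<Longrightarrow> bmap \<gamma> (bmap \<alpha> z) = z"
      using bmap_inverse[OF ab(1)] by blast
    show "\<alpha> g = \<beta> g"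
    proof (rule faithful)
      show "\<alpha> g \<in> carrier G" "\<beta> g \<in> carrier G" using ab g auto_closed by auto
      fix \<xi> assume \<xi>: "\<xi> \<in> boundary T"
      let ?\<eta> = "bmap \<gamma> \<xi>"
      have \<eta>: "?\<eta> \<in> boundary T" "bmap \<alpha> ?\<eta> = \<xi>" "bmap \<beta> ?\<eta> = \<xi>"
        using \<xi> \<gamma>(1) inv(1) bm[of ?\<eta>] by (auto simp: bmap_closed)
      have "act (\<alpha> g) \<xi> = bmap \<alpha> (act g ?\<eta>)" using bmap_act[OF ab(1) g \<eta>(1)] \<eta> by simp
      also have "\<dots> = act (\<beta> g) \<xi>" using bmap_act[OF ab(2) g \<eta>(1)] bm[of "act g ?\<eta>"] g \<eta> by simp
      finally show "act (\<alpha> g) \<xi> = act (\<beta> g) \<xi>" .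
    qed
  qed
qed

lemma fixes_outside_class_iff:
  assumes \<alpha>: "\<alpha> \<in> auto G" and C: "(n, C) \<in> verts hat"
  shows "(\<forall>w\<in>verts hat - subtree hat (n, C). hat_act G T \<phi> \<alpha> w = w) \<longleftrightarrow>
    (\<forall>\<xi>\<in>boundary T - C. bmap \<alpha> \<xi> = \<xi>)"
proof
  assume L: "\<forall>w\<in>verts hat - subtree hat (n, C). hat_act G T \<phi> \<alpha> w = w"
  show "\<forall>\<xi>\<in>boundary T - C. bmap \<alpha> \<xi> = \<xi>"
  proof
    fix \<xi> assume \<xi>: "\<xi> \<in> boundary T - C"
    then have \<xi>b: "\<xi> \<in> boundary T" by simp
    show "bmap \<alpha> \<xi> = \<xi>"
    proof (rule hat_cls_all_eq)
      show "bmap \<alpha> \<xi> \<in> boundary T" "\<xi> \<in> boundary T" using \<xi> \<alpha> by (auto simp: bmap_closed)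
      fix m assume "n \<le> m"
      have "(m, hat_cls m \<xi>) \<in> verts hat - subtree hat (n, C)"
        using subtree_hat[OF C hat_cls_in_hat[OF \<xi>b]] \<xi> hat_cls_self[OF \<xi>b, of m] hat_cls_in_hat[OF \<xi>b] by blast
      then have "hat_act G T \<phi> \<alpha> (m, hat_cls m \<xi>) = (m, hat_cls m \<xi>)" using L by blast
      then show "hat_cls m (bmap \<alpha> \<xi>) = hat_cls m \<xi>" using hat_act_hat_cls[OF \<alpha> \<xi>b] by simp
    qed
  qed
next
  assume R: "\<forall>\<xi>\<in>boundary T - C. bmap \<alpha> \<xi> = \<xi>"
  show "\<forall>w\<in>verts hat - subtree hat (n, C). hat_act G T \<phi> \<alpha> w = w"
  proof
    fix w assume w: "w \<in> verts hat - subtree hat (n, C)"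
    then obtain m \<eta> where m: "w = (m, hat_cls m \<eta>)" "\<eta> \<in> boundary T" using verts_hatE by blast
    \<comment> \<open>Classes go to classes, so it is enough that one ray of the class stays in it.
      If the class is not inside C, a ray off C does. Otherwise the class equals C as a set, and a
      ray of C cannot leave C: its image would be a fixed point, hence the ray itself.\<close>
    have "\<exists>\<zeta>\<in>hat_cls m \<eta>. bmap \<alpha> \<zeta> \<in> hat_cls m \<eta>"
    proof (cases "hat_cls m \<eta> \<subseteq> C")
      case False
      then obtain \<zeta> where "\<zeta> \<in> hat_cls m \<eta>" "\<zeta> \<notin> C" by blast
      then have "\<zeta> \<in> boundary T - C" using hat_cls_subset by blast
      then have "bmap \<alpha> \<zeta> = \<zeta>" using R by blast
      then show ?thesis using \<open>\<zeta> \<in> hat_cls m \<eta>\<close> by (intro bexI[of _ \<zeta>]) auto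
    next
      case True
      then have "m \<le> n" using w m subtree_hat[OF C, of m "hat_cls m \<eta>"] by auto
      moreover have "C \<in> hat_cls n ` boundary T" using C by (simp add: verts_hat)
      moreover have "\<eta> \<in> C" using True hat_cls_self[OF m(2)] by blast
      ultimately have "C \<subseteq> hat_cls m \<eta>"
        using classes_meet[of "hat_cls m \<eta>" m C n] m(2) hat_cls_self[OF m(2)] by blast
      have "bmap \<alpha> \<eta> \<in> C"
      proof (rule ccontr)
        assume *: "bmap \<alpha> \<eta> \<notin> C"
        then have "bmap \<alpha> (bmap \<alpha> \<eta>) = bmap \<alpha> \<eta>" using R \<alpha> m(2) by (simp add: bmap_closed)
        then have "bmap \<alpha> \<eta> = \<eta>" using bmap_inj[OF \<alpha>] \<alpha> m(2) by (simp add: bmap_closed)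
        then show False using * \<open>\<eta> \<in> C\<close> by simp
      qed
      then show ?thesis using \<open>C \<subseteq> hat_cls m \<eta>\<close> m(2) by (intro bexI[of _ \<eta>]) auto
    qed
    then obtain \<zeta> where \<zeta>: "\<zeta> \<in> hat_cls m \<eta>" "bmap \<alpha> \<zeta> \<in> hat_cls m \<eta>" by blast
    then have "\<zeta> \<in> boundary T" using hat_cls_subset by blast
    then show "hat_act G T \<phi> \<alpha> w = w"
      using hat_act_hat_cls[OF \<alpha>, of \<zeta> m] hat_cls_eq[OF \<zeta>(1)] hat_cls_eq[OF \<zeta>(2)] m(1) by simp
  qed
qed

end

section \<open>The monodromy of an extension\<close>

context group_extension
begin

lemma group_hom_\<iota>: "group_hom G \<Gamma> \<iota>"
  using \<iota>_mon group_G group_\<Gamma> by (simp add: group_hom_def group_hom_axioms_def mon_def)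

lemma group_hom_q: "group_hom \<Gamma> F q"
  using q_epi group_F group_\<Gamma> by (simp add: group_hom_def group_hom_axioms_def epi_def)

lemma group_hom_\<rho>: "group_hom \<Gamma> (AutoGroup G) (conj_auto G \<iota> \<Gamma>)"
  using conj_auto_hom group.AutoGroup[OF group_G] group_\<Gamma> by (simp add: group_hom_def group_hom_axioms_def)

lemma inj_\<iota>: "inj_on \<iota> (carrier G)"
  using \<iota>_mon by (simp add: mon_def)

sublocale G: group G by (rule group_G)
sublocale \<Gamma>: group \<Gamma> by (rule group_\<Gamma>)
sublocale A: group "AutoGroup G" by (rule G.AutoGroup)
sublocale \<iota>: group_hom G \<Gamma> \<iota> by (rule group_hom_\<iota>)
sublocale q: group_hom \<Gamma> F q by (rule group_hom_q)
sublocale \<rho>: group_hom \<Gamma> "AutoGroup G" "conj_auto G \<iota> \<Gamma>" by (rule group_hom_\<rho>)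
sublocale Inn: normal "inner_auto G" "AutoGroup G" by (rule G.normal_inner_auto)

abbreviation \<rho> :: "'e \<Rightarrow> 'g \<Rightarrow> 'g" where "\<rho> \<equiv> conj_auto G \<iota> \<Gamma>"
abbreviation \<mu> :: "'f \<Rightarrow> ('g \<Rightarrow> 'g) set" where "\<mu> \<equiv> monodromy G \<iota> \<Gamma> q"

lemma conj_auto_inner:
  assumes "g \<in> carrier G" "x \<in> carrier G"
  shows "conj_auto G \<iota> \<Gamma> (\<iota> g) x = g \<otimes>\<^bsub>G\<^esub> x \<otimes>\<^bsub>G\<^esub> inv\<^bsub>G\<^esub> g"
  using assms by (intro conj_auto_eqI) simp_all

lemma inner_auto_eq: "inner_auto G = (\<lambda>g. \<rho> (\<iota> g)) ` carrier G"
proof -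
  have "(\<lambda>x\<in>carrier G. g \<otimes>\<^bsub>G\<^esub> x \<otimes>\<^bsub>G\<^esub> inv\<^bsub>G\<^esub> g) = \<rho> (\<iota> g)" if "g \<in> carrier G" for g
  proof (rule extensionalityI[of _ "carrier G"])
    show "\<rho> (\<iota> g) \<in> extensional (carrier G)" by (simp add: conj_auto_def)
  qed (simp_all add: conj_auto_inner that)
  then show ?thesis by (auto simp: inner_auto_def image_iff)
qed

lemma \<rho>_one_iff:
  assumes "\<gamma> \<in> carrier \<Gamma>"
  shows "\<rho> \<gamma> = \<one>\<^bsub>AutoGroup G\<^esub> \<longleftrightarrow> (\<forall>g\<in>carrier G. \<gamma> \<otimes>\<^bsub>\<Gamma>\<^esub> \<iota> g = \<iota> g \<otimes>\<^bsub>\<Gamma>\<^esub> \<gamma>)"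
proof -
  have *: "\<rho> \<gamma> g = g \<longleftrightarrow> \<gamma> \<otimes>\<^bsub>\<Gamma>\<^esub> \<iota> g = \<iota> g \<otimes>\<^bsub>\<Gamma>\<^esub> \<gamma>" if g: "g \<in> carrier G" for g
  proof -
    have "\<rho> \<gamma> g = g \<longleftrightarrow> \<iota> (\<rho> \<gamma> g) = \<iota> g"
      using inj_on_eq_iff[OF inj_\<iota> conj_auto_\<iota>(1)[OF assms g] g] by simp
    also have "\<dots> \<longleftrightarrow> \<gamma> \<otimes>\<^bsub>\<Gamma>\<^esub> \<iota> g \<otimes>\<^bsub>\<Gamma>\<^esub> inv\<^bsub>\<Gamma>\<^esub> \<gamma> = \<iota> g" by (simp add: conj_auto_\<iota>(2)[OF assms g])
    also have "\<dots> \<longleftrightarrow> \<gamma> \<otimes>\<^bsub>\<Gamma>\<^esub> \<iota> g = \<iota> g \<otimes>\<^bsub>\<Gamma>\<^esub> \<gamma>"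
      using assms g \<Gamma>.inv_solve_right[of "\<iota> g" "\<gamma> \<otimes>\<^bsub>\<Gamma>\<^esub> \<iota> g" \<gamma>] by auto
    finally show ?thesis .
  qed
  have ext: "\<rho> \<gamma> \<in> extensional (carrier G)" by (simp add: conj_auto_def)
  have "\<rho> \<gamma> = \<one>\<^bsub>AutoGroup G\<^esub> \<longleftrightarrow> (\<forall>g\<in>carrier G. \<rho> \<gamma> g = g)"
  proof
    assume "\<forall>g\<in>carrier G. \<rho> \<gamma> g = g"
    then show "\<rho> \<gamma> = \<one>\<^bsub>AutoGroup G\<^esub>"
      unfolding AutoGroup_simps using ext by (intro extensionalityI[of _ "carrier G"]) auto
  qed (simp add: AutoGroup_simps)
  then show ?thesis using * by simp
qed

text \<open>The image of \<rho> contains all inner automorphisms, as \<rho> restricted to G gives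
  them, so it is a union of their cosets. Surjectivity of \<rho> onto the preimage of the image of
  \<mu> rests on this.\<close>

lemma out_class_range_iff:
  assumes \<alpha>: "\<alpha> \<in> carrier (AutoGroup G)"
  shows "out_class G \<alpha> \<in> \<mu> ` carrier F \<longleftrightarrow> \<alpha> \<in> \<rho> ` carrier \<Gamma>"
proof
  assume "out_class G \<alpha> \<in> \<mu> ` carrier F"
  moreover have "carrier F = q ` carrier \<Gamma>" using q_epi by (simp add: epi_def)
  ultimately obtain \<gamma> where \<gamma>: "\<gamma> \<in> carrier \<Gamma>" "out_class G \<alpha> = out_class G (\<rho> \<gamma>)"
    using monodromy_eq by auto
  have "\<alpha> \<in> out_class G \<alpha>" unfolding out_class_def using A.rcos_self[OF \<alpha> Inn.subgroup_axioms] .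
  then obtain g where g: "g \<in> carrier G" "\<alpha> = \<rho> (\<iota> g) \<otimes>\<^bsub>AutoGroup G\<^esub> \<rho> \<gamma>"
    using \<gamma>(2) by (auto simp: out_class_def r_coset_def inner_auto_eq)
  then have "\<alpha> = \<rho> (\<iota> g \<otimes>\<^bsub>\<Gamma>\<^esub> \<gamma>)" using \<gamma>(1) by simp
  moreover have "\<iota> g \<otimes>\<^bsub>\<Gamma>\<^esub> \<gamma> \<in> carrier \<Gamma>" using g(1) \<gamma>(1) by simp
  ultimately show "\<alpha> \<in> \<rho> ` carrier \<Gamma>" by (rule image_eqI)
next
  assume "\<alpha> \<in> \<rho> ` carrier \<Gamma>"
  then obtain \<gamma> where \<gamma>: "\<gamma> \<in> carrier \<Gamma>" "\<alpha> = \<rho> \<gamma>" by blast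
  then show "out_class G \<alpha> \<in> \<mu> ` carrier F"
    using monodromy_eq[OF \<gamma>(1)] by (intro image_eqI[of _ _ "q \<gamma>"]) auto
qed

lemma \<mu>_one_iff:
  assumes \<gamma>: "\<gamma> \<in> carrier \<Gamma>"
  shows "\<mu> (q \<gamma>) = \<one>\<^bsub>OutGroup G\<^esub> \<longleftrightarrow> (\<exists>g\<in>carrier G. \<rho> \<gamma> = \<rho> (\<iota> g))"
proof -
  have "\<mu> (q \<gamma>) = \<one>\<^bsub>OutGroup G\<^esub> \<longleftrightarrow> inner_auto G #>\<^bsub>AutoGroup G\<^esub> \<rho> \<gamma> = inner_auto G"
    by (simp add: monodromy_eq[OF \<gamma>] out_class_def OutGroup_def FactGroup_def)
  also have "\<dots> \<longleftrightarrow> \<rho> \<gamma> \<in> inner_auto G"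
    using A.coset_join1[OF _ \<rho>.hom_closed[OF \<gamma>] Inn.subgroup_axioms]
      A.coset_join2[OF \<rho>.hom_closed[OF \<gamma>] Inn.subgroup_axioms] by blast
  finally show ?thesis by (auto simp: inner_auto_eq)
qed

lemma q_one_iff: "\<gamma> \<in> carrier \<Gamma> \<Longrightarrow> q \<gamma> = \<one>\<^bsub>F\<^esub> \<longleftrightarrow> \<gamma> \<in> \<iota> ` carrier G"
  using exact by (auto simp: kernel_def)

text \<open>
  An element acting trivially on \<open>G\<close> by conjugation commutes with a nontrivial element of each
  rigid stabilizer of \<open>\<Gamma>\<close>, because \<open>G\<close> has finite index.
\<close>

lemma wb_action_imp_inj:
  assumes wb: "wb_action \<Gamma> T \<psi>" and F: "finite (carrier F)"
  shows "inj_on \<rho> (carrier \<Gamma>)"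
proof -
  interpret W: wb_action \<Gamma> T \<psi> by (rule wb)
  have "\<gamma> = \<one>\<^bsub>\<Gamma>\<^esub>" if \<gamma>: "\<gamma> \<in> carrier \<Gamma>" "\<rho> \<gamma> = \<one>\<^bsub>AutoGroup G\<^esub>" for \<gamma>
  proof (rule ccontr)
    assume "\<gamma> \<noteq> \<one>\<^bsub>\<Gamma>\<^esub>"
    then obtain x m where x: "x \<in> boundary T" "W.act \<gamma> x m \<noteq> x m" using W.moved_ex[OF \<gamma>(1)] by blast
    have "q ` carrier \<Gamma> \<subseteq> carrier F" by auto
    then have fin: "finite (q ` carrier \<Gamma>)" using F by (rule finite_subset)
    \<comment> \<open>The pigeonhole is applied with q: the quotient of two elements with the same
      image in F lies in G.\<close>
    obtain g h where gh: "g \<in> W.rist_ray m x" "h \<in> W.rist_ray m x" "q g = q h" "inv\<^bsub>\<Gamma>\<^esub> g \<otimes>\<^bsub>\<Gamma>\<^esub> h \<in> W.rist_ray m x"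
      "inv\<^bsub>\<Gamma>\<^esub> g \<otimes>\<^bsub>\<Gamma>\<^esub> h \<noteq> \<one>\<^bsub>\<Gamma>\<^esub>"
      using W.rist_ray_finite_range[OF x(1) fin] by blast
    have c: "g \<in> carrier \<Gamma>" "h \<in> carrier \<Gamma>" using gh W.rist_ray_carrier by auto
    have "q (inv\<^bsub>\<Gamma>\<^esub> g \<otimes>\<^bsub>\<Gamma>\<^esub> h) = \<one>\<^bsub>F\<^esub>" using c gh(3) by simp
    then obtain k where k: "k \<in> carrier G" "inv\<^bsub>\<Gamma>\<^esub> g \<otimes>\<^bsub>\<Gamma>\<^esub> h = \<iota> k"
      using q_one_iff[of "inv\<^bsub>\<Gamma>\<^esub> g \<otimes>\<^bsub>\<Gamma>\<^esub> h"] c by auto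
    have "\<gamma> \<otimes>\<^bsub>\<Gamma>\<^esub> \<iota> k = \<iota> k \<otimes>\<^bsub>\<Gamma>\<^esub> \<gamma>" using \<rho>_one_iff[OF \<gamma>(1)] \<gamma>(2) k(1) by blast
    then have "\<iota> k = \<one>\<^bsub>\<Gamma>\<^esub>" using W.rist_ray_commute_trivial[OF \<gamma>(1) x] gh(4) k(2) by simp
    then show False using gh(5) k(2) by simp
  qed
  then show ?thesis using \<rho>.inj_iff_trivial_ker by (auto simp: kernel_def)
qed

end

text \<open>The kernel of \<rho> meets G in the centre of G. If that is trivial, q is injective on
  the kernel of \<rho>.\<close>

locale centerless_extension = group_extension +
  assumes centerless: "z \<in> carrier G \<Longrightarrow> (\<And>g. g \<in> carrier G \<Longrightarrow> z \<otimes>\<^bsub>G\<^esub> g = g \<otimes>\<^bsub>G\<^esub> z) \<Longrightarrow> z = \<one>\<^bsub>G\<^esub>"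
begin

lemma \<rho>_\<iota>_trivial: "g \<in> carrier G \<Longrightarrow> \<rho> (\<iota> g) = \<one>\<^bsub>AutoGroup G\<^esub> \<Longrightarrow> g = \<one>\<^bsub>G\<^esub>"
proof (rule centerless)
  assume g: "g \<in> carrier G" "\<rho> (\<iota> g) = \<one>\<^bsub>AutoGroup G\<^esub>"
  fix h assume h: "h \<in> carrier G"
  have "\<iota> (g \<otimes>\<^bsub>G\<^esub> h) = \<iota> (h \<otimes>\<^bsub>G\<^esub> g)" using \<rho>_one_iff[of "\<iota> g"] g h by simp
  then show "g \<otimes>\<^bsub>G\<^esub> h = h \<otimes>\<^bsub>G\<^esub> g" using inj_onD[OF inj_\<iota>] g h by simp
qed

text \<open>Every element over the kernel of \<open>\<mu>\<close> can be corrected by an element of \<open>G\<close> to centralize \<open>G\<close>.\<close>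

lemma bij_kernels:
  "bij_betw q {\<gamma> \<in> carrier \<Gamma>. \<rho> \<gamma> = \<one>\<^bsub>AutoGroup G\<^esub>} {f \<in> carrier F. \<mu> f = \<one>\<^bsub>OutGroup G\<^esub>}"
  (is "bij_betw q ?K ?L")
  unfolding bij_betw_def
proof
  show "inj_on q ?K"
  proof (rule inj_onI)
    fix \<gamma> \<delta> assume *: "\<gamma> \<in> ?K" "\<delta> \<in> ?K" "q \<gamma> = q \<delta>"
    then have c: "\<gamma> \<in> carrier \<Gamma>" "\<delta> \<in> carrier \<Gamma>" by auto
    then have "q (\<gamma> \<otimes>\<^bsub>\<Gamma>\<^esub> inv\<^bsub>\<Gamma>\<^esub> \<delta>) = \<one>\<^bsub>F\<^esub>" using * by simp
    then obtain g where g: "g \<in> carrier G" "\<gamma> \<otimes>\<^bsub>\<Gamma>\<^esub> inv\<^bsub>\<Gamma>\<^esub> \<delta> = \<iota> g"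
      using q_one_iff[of "\<gamma> \<otimes>\<^bsub>\<Gamma>\<^esub> inv\<^bsub>\<Gamma>\<^esub> \<delta>"] c by auto
    have "\<rho> (\<gamma> \<otimes>\<^bsub>\<Gamma>\<^esub> inv\<^bsub>\<Gamma>\<^esub> \<delta>) = \<one>\<^bsub>AutoGroup G\<^esub>" using * c by simp
    then have "g = \<one>\<^bsub>G\<^esub>" using \<rho>_\<iota>_trivial g by simp
    then have "\<gamma> \<otimes>\<^bsub>\<Gamma>\<^esub> inv\<^bsub>\<Gamma>\<^esub> \<delta> = \<one>\<^bsub>\<Gamma>\<^esub>" using g by simp
    then show "\<gamma> = \<delta>" using c \<Gamma>.inv_equality[of \<gamma> "inv\<^bsub>\<Gamma>\<^esub> \<delta>"] by simp
  qed
  show "q ` ?K = ?L"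
  proof
    show "q ` ?K \<subseteq> ?L"
    proof
      fix f assume "f \<in> q ` ?K"
      then obtain \<gamma> where \<gamma>: "\<gamma> \<in> carrier \<Gamma>" "\<rho> \<gamma> = \<one>\<^bsub>AutoGroup G\<^esub>" "f = q \<gamma>" by blast
      have "\<rho> \<gamma> = \<rho> (\<iota> \<one>\<^bsub>G\<^esub>)" using \<gamma>(2) by simp
      then have "\<mu> (q \<gamma>) = \<one>\<^bsub>OutGroup G\<^esub>" using \<mu>_one_iff[OF \<gamma>(1)] G.one_closed by blast
      then show "f \<in> ?L" using \<gamma>(1,3) by simp
    qed
    show "?L \<subseteq> q ` ?K"
    proof
      fix f assume f: "f \<in> ?L"
      then have "f \<in> q ` carrier \<Gamma>" using q_epi by (simp add: epi_def)
      then obtain \<gamma> where \<gamma>: "\<gamma> \<in> carrier \<Gamma>" "f = q \<gamma>" by blast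
      then obtain g where g: "g \<in> carrier G" "\<rho> \<gamma> = \<rho> (\<iota> g)" using \<mu>_one_iff[OF \<gamma>(1)] f by blast
      let ?\<delta> = "inv\<^bsub>\<Gamma>\<^esub> \<iota> g \<otimes>\<^bsub>\<Gamma>\<^esub> \<gamma>"
      have "?\<delta> \<in> ?K" using g \<gamma> by (simp del: \<iota>.hom_inv)
      moreover have "q ?\<delta> = f" using g \<gamma> q_one_iff[of "\<iota> g"] by (simp del: \<iota>.hom_inv)
      ultimately show "f \<in> q ` ?K" by blast
    qed
  qed
qed

lemma inj_\<mu>_iff: "inj_on \<mu> (carrier F) \<longleftrightarrow> inj_on \<rho> (carrier \<Gamma>)"
proof -
  interpret Out: group "OutGroup G" unfolding OutGroup_def by (rule Inn.factorgroup_is_group)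
  interpret \<mu>: group_hom F "OutGroup G" \<mu> using monodromy_hom by unfold_locales
  let ?K = "{\<gamma> \<in> carrier \<Gamma>. \<rho> \<gamma> = \<one>\<^bsub>AutoGroup G\<^esub>}" and ?L = "{f \<in> carrier F. \<mu> f = \<one>\<^bsub>OutGroup G\<^esub>}"
  have b: "bij_betw q ?K ?L" by (rule bij_kernels)
  have "inj_on \<rho> (carrier \<Gamma>) \<longleftrightarrow> ?K = {\<one>\<^bsub>\<Gamma>\<^esub>}"
    using \<rho>.inj_iff_trivial_ker by (simp add: kernel_def)
  also have "\<dots> \<longleftrightarrow> ?L = {\<one>\<^bsub>F\<^esub>}"
  proof
    assume "?K = {\<one>\<^bsub>\<Gamma>\<^esub>}"
    then show "?L = {\<one>\<^bsub>F\<^esub>}" using bij_betw_imp_surj_on[OF b] by simp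
  next
    assume L: "?L = {\<one>\<^bsub>F\<^esub>}"
    have "\<gamma> = \<one>\<^bsub>\<Gamma>\<^esub>" if \<gamma>: "\<gamma> \<in> ?K" for \<gamma>
    proof (rule inj_onD[OF bij_betw_imp_inj_on[OF b] _ \<gamma>])
      show "q \<gamma> = q \<one>\<^bsub>\<Gamma>\<^esub>" using bij_betwE[OF b] \<gamma> L by auto
    qed simp
    then show "?K = {\<one>\<^bsub>\<Gamma>\<^esub>}" by auto
  qed
  also have "\<dots> \<longleftrightarrow> inj_on \<mu> (carrier F)"
    using \<mu>.inj_iff_trivial_ker by (simp add: kernel_def)
  finally show ?thesis by simp
qed

end

section \<open>Extensions acting on the hat tree\<close>

lemma (in group_hom) finite_cover_image:
  assumes "finite_cover G K L" "L \<subseteq> carrier G"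
  shows "finite_cover H (h ` K) (h ` L)"
proof -
  obtain S where S: "finite S" "S \<subseteq> carrier G" "\<And>g. g \<in> L \<Longrightarrow> \<exists>s\<in>S. g \<otimes> inv s \<in> K"
    using assms(1) by (auto simp: finite_cover_def)
  have "\<exists>s\<in>h ` S. h g \<otimes>\<^bsub>H\<^esub> inv\<^bsub>H\<^esub> s \<in> h ` K" if g: "g \<in> L" for g
  proof -
    obtain s where s: "s \<in> S" "g \<otimes> inv s \<in> K" using S(3)[OF g] by blast
    have "h (g \<otimes> inv s) = h g \<otimes>\<^bsub>H\<^esub> inv\<^bsub>H\<^esub> h s" using s(1) g S(2) assms(2) by (simp add: subset_iff)
    then show ?thesis using s by (metis imageI)
  qed
  then show ?thesis unfolding finite_cover_def using S by (intro exI[of _ "h ` S"]) auto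
qed

text \<open>Injectivity is assumed for \<rho> because in this form it yields faithfulness of
  \<Gamma> on the hat tree.\<close>

locale ext_action = fg_wb_action G T \<phi> + group_extension G \<iota> \<Gamma> q F
  for G :: "('g, 'm) monoid_scheme" (structure) and T :: "'v rooted_graph" and \<phi>
    and \<iota> :: "'g \<Rightarrow> 'e" and \<Gamma> :: "('e, 'n) monoid_scheme" and q :: "'e \<Rightarrow> 'f"
    and F :: "('f, 'k) monoid_scheme" +
  assumes finite_F: "finite (carrier F)"
    and inj_\<rho>: "inj_on (conj_auto G \<iota> \<Gamma>) (carrier \<Gamma>)"
begin

abbreviation \<Phi> :: "'e \<Rightarrow> nat \<times> (nat \<Rightarrow> 'v) set \<Rightarrow> nat \<times> (nat \<Rightarrow> 'v) set" where
  "\<Phi> \<gamma> \<equiv> hat_act G T \<phi> (\<rho> \<gamma>)"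

lemma \<rho>_auto: "\<gamma> \<in> carrier \<Gamma> \<Longrightarrow> \<rho> \<gamma> \<in> auto G"
  using \<rho>.hom_closed by (simp add: AutoGroup_simps)

lemma bmap_\<iota>: "g \<in> carrier G \<Longrightarrow> \<xi> \<in> boundary T \<Longrightarrow> bmap (\<rho> (\<iota> g)) \<xi> = act g \<xi>"
  by (rule bmap_conj) (simp_all add: \<rho>_auto conj_auto_inner)

lemma \<Phi>_mon: "\<Phi> \<in> mon \<Gamma> (TreeAuto hat)"
proof -
  have "hat_act G T \<phi> \<circ> \<rho> \<in> hom \<Gamma> (TreeAuto hat)"
    using conj_auto_hom hat_act_hom by (rule Group.hom_compose)
  moreover have "inj_on (hat_act G T \<phi> \<circ> \<rho>) (carrier \<Gamma>)"
    using inj_\<rho> \<rho>_auto by (intro comp_inj_on inj_on_subset[OF hat_act_inj]) auto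
  ultimately show ?thesis by (simp add: mon_def comp_def)
qed

sublocale H: tree_action \<Gamma> hat \<Phi>
  using \<Phi>_mon rooted_tree_hat group_\<Gamma> by (simp add: tree_action_iff)

text \<open>G alone is already transitive: the class of a ray at level n depends only on its vertex
  at a level N of T, and G is transitive there.\<close>

lemma level_transitive_hat: "level_transitive hat (\<Phi> ` carrier \<Gamma>)"
  unfolding level_transitive_def
proof (intro allI ballI)
  fix n u v assume "u \<in> level hat n" "v \<in> level hat n"
  then obtain \<xi> \<eta> where u: "u = (n, hat_cls n \<xi>)" "\<xi> \<in> boundary T" and v: "v = (n, hat_cls n \<eta>)" "\<eta> \<in> boundary T"
    unfolding level_hat by blast
  obtain N where N: "\<forall>\<xi>\<in>boundary T. \<forall>\<eta>\<in>boundary T. \<xi> N = \<eta> N \<longrightarrow> hat_eq n \<xi> \<eta>"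
    using hat_eq_uniform by blast
  obtain g where g: "g \<in> carrier G" "act g \<xi> N = \<eta> N" using trans[OF u(2) v(2)] by blast
  have "\<Phi> (\<iota> g) u = (n, hat_cls n (act g \<xi>))"
    using hat_act_hat_cls[OF \<rho>_auto u(2), of "\<iota> g" n] bmap_\<iota>[OF g(1) u(2)] g u by simp
  also have "\<dots> = v" using hat_cls_cong[of n "act g \<xi>" \<eta>] N g u v by simp
  finally have "\<Phi> (\<iota> g) u = v" .
  then show "\<exists>f\<in>\<Phi> ` carrier \<Gamma>. f u = v" using g by (intro bexI[of _ "\<Phi> (\<iota> g)"]) auto
qed

lemma rist_hat_iff:
  assumes "(n, C) \<in> verts hat"
  shows "\<gamma> \<in> Rist \<Gamma> hat \<Phi> (n, C) \<longleftrightarrow>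
    \<gamma> \<in> carrier \<Gamma> \<and> (\<forall>\<xi>\<in>boundary T - C. bmap (\<rho> \<gamma>) \<xi> = \<xi>)"
proof (cases "\<gamma> \<in> carrier \<Gamma>")
  case True
  then show ?thesis using fixes_outside_class_iff[OF \<rho>_auto[OF True] assms] by (simp add: Rist_def)
qed (simp add: Rist_def)

lemma rist_hat_\<iota>_iff:
  assumes g: "g \<in> carrier G" and x: "x \<in> boundary T"
  shows "\<iota> g \<in> Rist \<Gamma> hat \<Phi> (n, hat_cls n x) \<longleftrightarrow> (\<forall>\<xi>\<in>boundary T. \<not> hat_eq n x \<xi> \<longrightarrow> act g \<xi> = \<xi>)"
proof -
  have "boundary T - hat_cls n x = {\<xi> \<in> boundary T. \<not> hat_eq n x \<xi>}" by (auto simp: hat_cls_def)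
  then show ?thesis using rist_hat_iff[OF hat_cls_in_hat[OF x], of "\<iota> g" n] bmap_\<iota>[OF g] g by auto
qed

text \<open>The cylinder of x N lies in the class of x at level n, so support in the former is
  support in the latter.\<close>

lemma rist_ray_imp_rist_hat:
  assumes N: "\<forall>\<xi>\<in>boundary T. \<forall>\<eta>\<in>boundary T. \<xi> N = \<eta> N \<longrightarrow> hat_eq n \<xi> \<eta>"
    and x: "x \<in> boundary T" and g: "g \<in> rist_ray N x"
  shows "\<iota> g \<in> Rist \<Gamma> hat \<Phi> (n, hat_cls n x)"
proof -
  have "act g \<xi> = \<xi>" if \<xi>: "\<xi> \<in> boundary T" "\<not> hat_eq n x \<xi>" for \<xi>
    using rist_ray_fix[OF g \<xi>(1)] N x \<xi> by metis
  then show ?thesis using rist_hat_\<iota>_iff[OF rist_ray_carrier[OF g] x] by blast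
qed

text \<open>In this direction the level stays the same, because the class of x at level n lies in
  the cylinder of x n.\<close>

lemma rist_hat_imp_rist_ray:
  assumes x: "x \<in> boundary T" and g: "g \<in> carrier G" "\<iota> g \<in> Rist \<Gamma> hat \<Phi> (n, hat_cls n x)"
  shows "g \<in> rist_ray n x"
proof -
  have *: "\<forall>\<xi>\<in>boundary T. \<not> hat_eq n x \<xi> \<longrightarrow> act g \<xi> = \<xi>"
    using rist_hat_\<iota>_iff[OF g(1) x] g(2) by simp
  have "act g \<xi> = \<xi>" if \<xi>: "\<xi> \<in> boundary T" "\<xi> n \<noteq> x n" for \<xi>
  proof -
    have "\<not> hat_eq n x \<xi>" using hat_eq_imp_eq[OF _ x \<xi>(1), of n] \<xi>(2) by auto
    then show ?thesis using * \<xi>(1) by blast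
  qed
  then show ?thesis using g(1) by (simp add: rist_ray_def)
qed

lemma wb_action_hat: "wb_action \<Gamma> hat \<Phi>"
proof -
  have "\<exists>\<gamma>\<in>Rist \<Gamma> hat \<Phi> u. \<gamma> \<noteq> \<one>\<^bsub>\<Gamma>\<^esub>" if u: "u \<in> verts hat" for u
  proof -
    obtain n x where x: "u = (n, hat_cls n x)" "x \<in> boundary T" using verts_hatE[OF u] .
    obtain N where N: "\<forall>\<xi>\<in>boundary T. \<forall>\<eta>\<in>boundary T. \<xi> N = \<eta> N \<longrightarrow> hat_eq n \<xi> \<eta>"
      using hat_eq_uniform by blast
    obtain g where g: "g \<in> rist_ray N x" "g \<noteq> \<one>" using rist_ray_ne[OF x(2)] by blast
    have "\<iota> g \<in> Rist \<Gamma> hat \<Phi> u" using rist_ray_imp_rist_hat[OF N x(2) g(1)] x(1) by simp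
    moreover have "\<iota> g \<noteq> \<one>\<^bsub>\<Gamma>\<^esub>"
      using g(2) inj_onD[OF inj_\<iota>, of g \<one>] rist_ray_carrier[OF g(1)] by auto
    ultimately show ?thesis by blast
  qed
  then show ?thesis
    using level_transitive_hat H.level_transitive_iff H.tree_action_axioms
    by (simp add: wb_action_def wb_action_axioms_def)
qed

lemma kernel_q: "kernel \<Gamma> F q = \<iota> ` carrier G"
  using exact by simp

lemma finite_cover_\<iota>:
  assumes "subgroup S \<Gamma>"
  shows "finite_cover \<Gamma> (S \<inter> \<iota> ` carrier G) S"
  using \<Gamma>.finite_cover_kernel[OF q.homh group_F finite_F assms]
  by (simp add: kernel_q)

lemma branch_hat_iff: "branch_on T (\<phi> ` carrier G) \<longleftrightarrow> branch_on hat (\<Phi> ` carrier \<Gamma>)"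
proof -
  define K where "K n = generate G (\<Union>v\<in>level T n. Rist G T \<phi> v)" for n
  define Q where "Q n = generate \<Gamma> (\<Union>u\<in>level hat n. Rist \<Gamma> hat \<Phi> u)" for n
  have K_sub: "subgroup (K n) G" for n unfolding K_def by (rule generate_is_subgroup[OF Rist_level_subset])
  have Q_sub: "subgroup (Q n) \<Gamma>" for n unfolding Q_def by (rule \<Gamma>.generate_is_subgroup[OF H.Rist_level_subset])
  have \<iota>K: "\<iota> ` K n = generate \<Gamma> (\<iota> ` (\<Union>v\<in>level T n. Rist G T \<phi> v))" for n
    unfolding K_def by (rule \<iota>.generate_img[OF Rist_level_subset, symmetric])
  have levelT: "(\<Union>v\<in>level T n. Rist G T \<phi> v) = (\<Union>x\<in>boundary T. rist_ray n x)" for n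
    unfolding level_eq using rist_ray_eq by simp
  have 1: "\<forall>n. finite (rcosets\<^bsub>\<Gamma>\<^esub> (Q n))" if fin: "\<forall>n. finite (rcosets (K n))"
  proof
    fix n
    \<comment> \<open>Going down to level N puts K N inside Q n. Finite index then passes along the
      chain from K N to G and from G to \<Gamma>.\<close>
    obtain N where N: "\<forall>\<xi>\<in>boundary T. \<forall>\<eta>\<in>boundary T. \<xi> N = \<eta> N \<longrightarrow> hat_eq n \<xi> \<eta>"
      using hat_eq_uniform by blast
    have "\<iota> ` (\<Union>x\<in>boundary T. rist_ray N x) \<subseteq> (\<Union>u\<in>level hat n. Rist \<Gamma> hat \<Phi> u)"
    proof
      fix \<gamma> assume "\<gamma> \<in> \<iota> ` (\<Union>x\<in>boundary T. rist_ray N x)"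
      then obtain x g where x: "x \<in> boundary T" "g \<in> rist_ray N x" "\<gamma> = \<iota> g" by blast
      have "\<gamma> \<in> Rist \<Gamma> hat \<Phi> (n, hat_cls n x)" using rist_ray_imp_rist_hat[OF N x(1,2)] x(3) by simp
      moreover have "(n, hat_cls n x) \<in> level hat n" using x(1) by (simp add: level_hat)
      ultimately show "\<gamma> \<in> (\<Union>u\<in>level hat n. Rist \<Gamma> hat \<Phi> u)" by blast
    qed
    then have KQ: "\<iota> ` K N \<subseteq> Q n"
      unfolding \<iota>K Q_def levelT by (rule \<Gamma>.mono_generate)
    have "finite_cover G (K N) (carrier G)"
      using fin finite_rcosets_iff_finite_cover[OF K_sub] by simp
    then have c1: "finite_cover \<Gamma> (\<iota> ` K N) (\<iota> ` carrier G)" by (rule \<iota>.finite_cover_image) simp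
    have "carrier \<Gamma> \<inter> \<iota> ` carrier G = \<iota> ` carrier G" by auto
    then have "finite_cover \<Gamma> (\<iota> ` carrier G) (carrier \<Gamma>)"
      using finite_cover_\<iota>[OF \<Gamma>.subgroup_self] by simp
    then have "finite_cover \<Gamma> (\<iota> ` K N) (carrier \<Gamma>)"
      using c1 by (rule \<Gamma>.finite_cover_trans) simp
    then have "finite_cover \<Gamma> (Q n) (carrier \<Gamma>)"
      using KQ by (rule \<Gamma>.finite_cover_mono) simp
    then show "finite (rcosets\<^bsub>\<Gamma>\<^esub> (Q n))" using \<Gamma>.finite_rcosets_iff_finite_cover[OF Q_sub] by simp
  qed
  \<comment> \<open>Q n can contain elements outside G. The rigid stabilizers generating it are cut
    down to G, at the cost of finite index by \<open>finite_cover_commuting\<close>; what they then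
    generate lies in the image of K n.\<close>
  have 2: "\<forall>n. finite (rcosets (K n))" if fin: "\<forall>n. finite (rcosets\<^bsub>\<Gamma>\<^esub> (Q n))"
  proof
    fix n
    let ?R = "\<lambda>u. Rist \<Gamma> hat \<Phi> u"
    let ?M = "\<lambda>u. Rist \<Gamma> hat \<Phi> u \<inter> \<iota> ` carrier G"
    have fin_level: "finite (level hat n)" by (rule rooted_tree.finite_level[OF rooted_tree_hat])
    have sub: "subgroup (?R u) \<Gamma>" if "u \<in> level hat n" for u
      using that by (intro H.subgroup_Rist) (simp add: level_def)
    have com: "\<gamma> \<otimes>\<^bsub>\<Gamma>\<^esub> \<delta> = \<delta> \<otimes>\<^bsub>\<Gamma>\<^esub> \<gamma>"
      if uv: "u \<in> level hat n" "v \<in> level hat n" "u \<noteq> v" and gd: "\<gamma> \<in> ?R u" "\<delta> \<in> ?R v" for u v \<gamma> \<delta>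
    proof -
      obtain \<xi> \<eta> where \<xi>: "\<xi> \<in> boundary hat" "u = \<xi> n" and \<eta>: "\<eta> \<in> boundary hat" "v = \<eta> n"
        using uv H.level_eq[of n] by auto
      show ?thesis
        by (rule H.rist_ray_commute[OF \<xi>(1) \<eta>(1)]) (use uv gd \<xi> \<eta> H.rist_ray_eq in auto)
    qed
    have "finite_cover \<Gamma> (generate \<Gamma> (\<Union>u\<in>level hat n. ?M u)) (Q n)"
      unfolding Q_def
    proof (rule \<Gamma>.finite_cover_commuting[OF fin_level])
      fix u assume u: "u \<in> level hat n"
      show "subgroup (?R u) \<Gamma>" by (rule sub[OF u])
      show "?M u \<subseteq> ?R u" by blast
      show "finite_cover \<Gamma> (?M u) (?R u)" by (rule finite_cover_\<iota>[OF sub[OF u]])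
    next
      fix u v x y assume "u \<in> level hat n" "v \<in> level hat n" "u \<noteq> v" "x \<in> ?R u" "y \<in> ?R v"
      then show "x \<otimes>\<^bsub>\<Gamma>\<^esub> y = y \<otimes>\<^bsub>\<Gamma>\<^esub> x" by (rule com)
    qed
    moreover have "finite_cover \<Gamma> (Q n) (carrier \<Gamma>)"
      using fin \<Gamma>.finite_rcosets_iff_finite_cover[OF Q_sub] by simp
    ultimately have c: "finite_cover \<Gamma> (generate \<Gamma> (\<Union>u\<in>level hat n. ?M u)) (carrier \<Gamma>)"
      using \<Gamma>.finite_cover_trans by blast
    have "(\<Union>u\<in>level hat n. ?M u) \<subseteq> \<iota> ` (\<Union>x\<in>boundary T. rist_ray n x)"
    proof
      fix \<gamma> assume "\<gamma> \<in> (\<Union>u\<in>level hat n. ?M u)"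
      then obtain x g where x: "x \<in> boundary T" "g \<in> carrier G" "\<gamma> = \<iota> g" "\<iota> g \<in> ?R (n, hat_cls n x)"
        unfolding level_hat by blast
      then show "\<gamma> \<in> \<iota> ` (\<Union>x\<in>boundary T. rist_ray n x)" using rist_hat_imp_rist_ray[OF x(1,2,4)] by blast
    qed
    then have "generate \<Gamma> (\<Union>u\<in>level hat n. ?M u) \<subseteq> \<iota> ` K n"
      unfolding \<iota>K levelT by (rule \<Gamma>.mono_generate)
    then have "finite_cover \<Gamma> (\<iota> ` K n) (\<iota> ` carrier G)"
      using c by (elim \<Gamma>.finite_cover_mono[rotated]) auto
    then show "finite (rcosets (K n))" by (rule \<iota>.finite_rcosets_pullback[OF inj_\<iota> K_sub])
  qed
  have "branch_on T (\<phi> ` carrier G) \<longleftrightarrow> (\<forall>n. finite (rcosets (K n)))"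
    unfolding branch_on_iff K_def using trans by blast
  moreover have "branch_on hat (\<Phi> ` carrier \<Gamma>) \<longleftrightarrow> (\<forall>n. finite (rcosets\<^bsub>\<Gamma>\<^esub> (Q n)))"
    unfolding H.branch_on_iff Q_def using level_transitive_hat H.level_transitive_iff by blast
  ultimately show ?thesis using 1 2 by blast
qed

end

lemma ext_action_hat:
  assumes "group_extension G \<iota> \<Gamma> q F" "finite (carrier F)" "finitely_generated G"
    and "inj_on (conj_auto G \<iota> \<Gamma>) (carrier \<Gamma>)" and "weakly_branch_action G T \<phi>"
  shows "weakly_branch_action \<Gamma> (hat_tree G T \<phi>) (\<lambda>\<gamma>. hat_act G T \<phi> (conj_auto G \<iota> \<Gamma> \<gamma>))"
    and "branch_action G T \<phi> \<longleftrightarrow>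
      branch_action \<Gamma> (hat_tree G T \<phi>) (\<lambda>\<gamma>. hat_act G T \<phi> (conj_auto G \<iota> \<Gamma> \<gamma>))"
proof -
  interpret E: group_extension G \<iota> \<Gamma> q F by (rule assms(1))
  have "wb_action G T \<phi>" using assms(5) by (simp add: weakly_branch_action_iff[OF E.group_G])
  then interpret X: ext_action G T \<phi> \<iota> \<Gamma> q F
    using assms by (simp add: ext_action_def ext_action_axioms_def fg_wb_action_def fg_wb_action_axioms_def)
  show "weakly_branch_action \<Gamma> (hat_tree G T \<phi>) (\<lambda>\<gamma>. hat_act G T \<phi> (conj_auto G \<iota> \<Gamma> \<gamma>))"
    using X.wb_action_hat by (simp add: weakly_branch_action_iff[OF E.group_\<Gamma>])
  show "branch_action G T \<phi> \<longleftrightarrow>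
      branch_action \<Gamma> (hat_tree G T \<phi>) (\<lambda>\<gamma>. hat_act G T \<phi> (conj_auto G \<iota> \<Gamma> \<gamma>))"
    using X.branch_hat_iff X.\<Phi>_mon X.\<phi>_mon X.rooted_tree_hat X.rooted_tree_axioms
    by (simp add: branch_action_def)
qed

section \<open>Relabelling the vertices\<close>

text \<open>The vertices of the hat tree are tagged sets of rays, whereas (weakly) branch groups are
  defined by trees on the natural numbers. An action is transported along an injection of the
  vertices.\<close>

locale relabelled_action = tree_action G T \<phi>
  for G :: "('g, 'm) monoid_scheme" (structure) and T :: "'v rooted_graph" and \<phi> +
  fixes e :: "'v \<Rightarrow> 'w"
  assumes inj_e: "inj_on e (verts T)"
begin

definition d :: "'w \<Rightarrow> 'v" where
  "d = inv_into (verts T) e"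

definition T' :: "'w rooted_graph" where
  "T' = \<lparr>verts = e ` verts T,
     adj = (\<lambda>a b. a \<in> e ` verts T \<and> b \<in> e ` verts T \<and> adj T (d a) (d b)), root = e (root T)\<rparr>"

definition \<phi>' :: "'g \<Rightarrow> 'w \<Rightarrow> 'w" where
  "\<phi>' g = (\<lambda>a\<in>e ` verts T. e (\<phi> g (d a)))"

lemma d_e [simp]: "v \<in> verts T \<Longrightarrow> d (e v) = v"
  using inj_e by (simp add: d_def)

lemma verts_T': "verts T' = e ` verts T"
  by (simp add: T'_def)

lemma e_eq_iff: "u \<in> verts T \<Longrightarrow> v \<in> verts T \<Longrightarrow> e u = e v \<longleftrightarrow> u = v"
  using inj_e by (auto dest: inj_onD)

lemma adj_T': "u \<in> verts T \<Longrightarrow> v \<in> verts T \<Longrightarrow> adj T' (e u) (e v) \<longleftrightarrow> adj T u v"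
  by (simp add: T'_def)

lemma \<phi>'_e: "v \<in> verts T \<Longrightarrow> \<phi>' g (e v) = e (\<phi> g v)"
  by (simp add: \<phi>'_def)

lemma ranked': "ranked_tree T' (depth T \<circ> d) (e \<circ> parent \<circ> d)"
proof
  show "root T' \<in> verts T'" "(depth T \<circ> d) (root T') = 0"
    using root_in_verts by (auto simp: T'_def)
  fix a b n
  show "a = root T'" if "a \<in> verts T'" "(depth T \<circ> d) a = 0"
    using that depth_0 by (auto simp: T'_def)
  show "(e \<circ> parent \<circ> d) a \<in> verts T' \<and> (depth T \<circ> d) ((e \<circ> parent \<circ> d) a) = n"
    if a: "a \<in> verts T'" "(depth T \<circ> d) a = Suc n"
  proof -
    obtain v where v: "v \<in> verts T" "a = e v" using a(1) by (auto simp: verts_T')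
    then show ?thesis using parent[of v n] a(2) by (simp add: verts_T')
  qed
  show "adj T' a b \<longleftrightarrow> a \<in> verts T' \<and> b \<in> verts T' \<and>
      ((depth T \<circ> d) b = Suc ((depth T \<circ> d) a) \<and> (e \<circ> parent \<circ> d) b = a \<or>
       (depth T \<circ> d) a = Suc ((depth T \<circ> d) b) \<and> (e \<circ> parent \<circ> d) a = b)" for a b
  proof (cases "a \<in> verts T' \<and> b \<in> verts T'")
    case True
    then obtain u v where uv: "u \<in> verts T" "a = e u" "v \<in> verts T" "b = e v" by (auto simp: verts_T')
    have "e (parent v) = e u \<longleftrightarrow> parent v = u" if "depth T v = Suc (depth T u)"
      using that uv parent(2) e_eq_iff by blast
    moreover have "e (parent u) = e v \<longleftrightarrow> parent u = v" if "depth T u = Suc (depth T v)"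
      using that uv parent(2) e_eq_iff by blast
    ultimately show ?thesis using uv adj_T'[OF uv(1,3)] adj_iff[of u v] by (auto simp: verts_T')
  next
    case False
    then show ?thesis by (auto simp: T'_def)
  qed
  assume a: "a \<in> verts T'"
  then obtain v where v: "v \<in> verts T" "a = e v" by (auto simp: verts_T')
  have ch: "e w \<in> verts T' \<and> (depth T \<circ> d) (e w) = Suc ((depth T \<circ> d) a) \<and> (e \<circ> parent \<circ> d) (e w) = a \<longleftrightarrow>
      depth T w = Suc (depth T v) \<and> parent w = v" if w: "w \<in> verts T" for w
  proof -
    have "e (parent w) = e v \<longleftrightarrow> parent w = v" if "depth T w = Suc (depth T v)"
      using that w v parent(2) e_eq_iff by blast
    then show ?thesis using w v by (auto simp: verts_T')
  qed
  show "finite {b \<in> verts T'. (depth T \<circ> d) b = Suc ((depth T \<circ> d) a) \<and> (e \<circ> parent \<circ> d) b = a}"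
  proof (rule finite_subset)
    show "{b \<in> verts T'. (depth T \<circ> d) b = Suc ((depth T \<circ> d) a) \<and> (e \<circ> parent \<circ> d) b = a} \<subseteq>
      e ` {w \<in> verts T. depth T w = Suc (depth T v) \<and> parent w = v}"
    proof
      fix b assume b: "b \<in> {b \<in> verts T'. (depth T \<circ> d) b = Suc ((depth T \<circ> d) a) \<and> (e \<circ> parent \<circ> d) b = a}"
      then obtain w where w: "w \<in> verts T" "b = e w" by (auto simp: verts_T')
      then show "b \<in> e ` {w \<in> verts T. depth T w = Suc (depth T v) \<and> parent w = v}"
        using ch[OF w(1)] b by blast
    qed
    show "finite (e ` {w \<in> verts T. depth T w = Suc (depth T v) \<and> parent w = v})"
      using finite_children[OF v(1)] by simp
  qed
  obtain w where "w \<in> verts T" "depth T w = Suc (depth T v)" "parent w = v" using ex_child[OF v(1)] by blast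
  then show "\<exists>b\<in>verts T'. (depth T \<circ> d) b = Suc ((depth T \<circ> d) a) \<and> (e \<circ> parent \<circ> d) b = a"
    using ch[of w] by blast
qed

lemmas rooted_tree_T' = ranked_tree.rooted_tree[OF ranked']

lemma depth_T': "v \<in> verts T \<Longrightarrow> depth T' (e v) = depth T v"
  using ranked_tree.depth_eq[OF ranked', of "e v"] by (simp add: verts_T')

lemma level_T': "level T' n = e ` level T n"
  using depth_T' by (auto simp: level_def verts_T')

lemma child_rel_T':
  "u \<in> verts T \<Longrightarrow> v \<in> verts T \<Longrightarrow> (e u, e v) \<in> child_rel T' \<longleftrightarrow> (u, v) \<in> child_rel T"
  by (simp add: child_rel_def verts_T' depth_T' adj_T')

lemma subtree_T':
  assumes u: "u \<in> verts T" and v: "v \<in> verts T"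
  shows "e v \<in> subtree T' (e u) \<longleftrightarrow> v \<in> subtree T u"
proof
  have "\<exists>w\<in>verts T. b = e w \<and> (u, w) \<in> (child_rel T)\<^sup>*" if "(e u, b) \<in> (child_rel T')\<^sup>*" for b
    using that
  proof induction
    case base
    then show ?case using u by blast
  next
    case (step b c)
    then obtain w where w: "w \<in> verts T" "b = e w" "(u, w) \<in> (child_rel T)\<^sup>*" by blast
    obtain x where x: "x \<in> verts T" "c = e x" using step(2) by (auto simp: child_rel_def verts_T')
    then have "(w, x) \<in> child_rel T" using step(2) w child_rel_T' by simp
    with w(3) have "(u, x) \<in> (child_rel T)\<^sup>*" by (rule rtrancl_into_rtrancl)
    then show ?case using x by blast
  qed
  then show "v \<in> subtree T u" if "e v \<in> subtree T' (e u)"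
    using that v e_eq_iff unfolding subtree_def by blast
next
  have "w \<in> verts T \<and> (e u, e w) \<in> (child_rel T')\<^sup>*" if "(u, w) \<in> (child_rel T)\<^sup>*" for w
    using that
  proof induction
    case base
    then show ?case using u by blast
  next
    case (step w x)
    then have "(e w, e x) \<in> child_rel T'" using child_rel_T' by (simp add: child_rel_def)
    then show ?case using step by (auto simp: child_rel_def intro: rtrancl_into_rtrancl)
  qed
  then show "e v \<in> subtree T' (e u)" if "v \<in> subtree T u"
    using that by (simp add: subtree_def)
qed

lemma \<phi>'_auto:
  assumes g: "g \<in> carrier G"
  shows "\<phi>' g \<in> tree_auto T'"
proof -
  have 1: "\<phi>' h (\<phi>' k a) = a"
    if hk: "h \<in> carrier G" "k \<in> carrier G" "h \<otimes> k = \<one>" and a: "a \<in> verts T'" for h k a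
  proof -
    obtain v where v: "v \<in> verts T" "a = e v" using a by (auto simp: verts_T')
    then show ?thesis using hk \<phi>_mult[of h k v] \<phi>_one[of v] by (simp add: \<phi>'_e \<phi>_closed)
  qed
  have closed: "\<phi>' h a \<in> verts T'" if "h \<in> carrier G" "a \<in> verts T'" for h a
    using that by (auto simp: verts_T' \<phi>'_e \<phi>_closed)
  have "bij_betw (\<phi>' g) (verts T') (verts T')"
    by (rule bij_betwI[where g = "\<phi>' (inv g)"]) (simp_all add: closed 1 g)
  moreover have "\<phi>' g \<in> extensional (verts T')" by (simp add: \<phi>'_def verts_T')
  moreover have "\<phi>' g (root T') = root T'"
  proof -
    have "\<phi> g (root T) = root T" using \<phi>_auto[OF g] by (simp add: tree_auto_def)
    then show ?thesis using root_in_verts by (simp add: T'_def \<phi>'_e)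
  qed
  moreover have "adj T' (\<phi>' g a) (\<phi>' g b) \<longleftrightarrow> adj T' a b" if "a \<in> verts T'" "b \<in> verts T'" for a b
  proof -
    obtain u v where "u \<in> verts T" "a = e u" "v \<in> verts T" "b = e v" using \<open>a \<in> verts T'\<close> \<open>b \<in> verts T'\<close> by (auto simp: verts_T')
    then show ?thesis using g by (simp add: \<phi>'_e adj_T' \<phi>_closed tree_auto_adj[OF \<phi>_auto])
  qed
  ultimately show ?thesis by (simp add: tree_auto_def Bij_def)
qed

lemma tree_action': "tree_action G T' \<phi>'"
proof -
  have "\<phi>' \<in> hom G (TreeAuto T')"
  proof (rule homI)
    show "\<phi>' g \<in> carrier (TreeAuto T')" if "g \<in> carrier G" for g
      using that by (simp add: carrier_TreeAuto \<phi>'_auto)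
    fix g h assume gh: "g \<in> carrier G" "h \<in> carrier G"
    have "\<phi>' (g \<otimes> h) = compose (verts T') (\<phi>' g) (\<phi>' h)"
    proof (rule extensionalityI)
      show "\<phi>' (g \<otimes> h) \<in> extensional (verts T')" by (simp add: \<phi>'_def verts_T')
      fix a assume "a \<in> verts T'"
      then obtain v where "v \<in> verts T" "a = e v" by (auto simp: verts_T')
      then show "\<phi>' (g \<otimes> h) a = compose (verts T') (\<phi>' g) (\<phi>' h) a"
        using gh by (simp add: compose_eq verts_T' \<phi>'_e \<phi>_mult \<phi>_closed del: \<phi>.hom_mult)
    qed simp
    then show "\<phi>' (g \<otimes> h) = \<phi>' g \<otimes>\<^bsub>TreeAuto T'\<^esub> \<phi>' h"
      using gh by (simp add: mult_TreeAuto \<phi>'_auto)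
  qed
  moreover have "inj_on \<phi>' (carrier G)"
  proof (rule inj_onI)
    fix g h assume gh: "g \<in> carrier G" "h \<in> carrier G" "\<phi>' g = \<phi>' h"
    have "\<phi> g = \<phi> h"
    proof (rule extensionalityI)
      show "\<phi> g \<in> extensional (verts T)" "\<phi> h \<in> extensional (verts T)"
        using \<phi>_auto gh by (auto simp: tree_auto_def Bij_def)
      fix v assume v: "v \<in> verts T"
      have "e (\<phi> g v) = e (\<phi> h v)" using fun_cong[OF gh(3), of "e v"] v by (simp add: \<phi>'_e)
      then show "\<phi> g v = \<phi> h v" using v gh e_eq_iff \<phi>_closed by blast
    qed
    then show "g = h" using gh inj_onD[OF \<phi>_inj] by blast
  qed
  ultimately show ?thesis
    using rooted_tree_T' is_group by (simp add: tree_action_iff mon_def)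
qed

lemma Rist_T':
  assumes v: "v \<in> verts T"
  shows "Rist G T' \<phi>' (e v) = Rist G T \<phi> v"
proof -
  have "(\<forall>b\<in>verts T' - subtree T' (e v). \<phi>' g b = b) \<longleftrightarrow> (\<forall>w\<in>verts T - subtree T v. \<phi> g w = w)"
    if g: "g \<in> carrier G" for g
  proof -
    have "\<phi>' g (e w) = e w \<longleftrightarrow> \<phi> g w = w" if "w \<in> verts T" for w
      using that g e_eq_iff by (simp add: \<phi>'_e \<phi>_closed)
    then show ?thesis using subtree_T'[OF v] by (auto simp: verts_T')
  qed
  then show ?thesis by (auto simp: Rist_def)
qed

lemma level_transitive_T':
  assumes "level_transitive T (\<phi> ` carrier G)"
  shows "level_transitive T' (\<phi>' ` carrier G)"
  unfolding level_transitive_def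
proof (intro allI ballI)
  fix n a b assume "a \<in> level T' n" "b \<in> level T' n"
  then obtain u v where uv: "u \<in> level T n" "a = e u" "v \<in> level T n" "b = e v" by (auto simp: level_T')
  then obtain g where g: "g \<in> carrier G" "\<phi> g u = v" using assms unfolding level_transitive_def by blast
  then show "\<exists>f\<in>\<phi>' ` carrier G. f a = b" using uv by (auto simp: level_def \<phi>'_e)
qed

lemma weakly_branch_T':
  assumes "weakly_branch_action G T \<phi>"
  shows "weakly_branch_action G T' \<phi>'"
proof -
  interpret W: tree_action G T' \<phi>' by (rule tree_action')
  have w: "level_transitive T (\<phi> ` carrier G)" "\<And>v. v \<in> verts T \<Longrightarrow> rist T (\<phi> ` carrier G) v \<noteq> {\<one>\<^bsub>TreeAuto T\<^esub>}"
    using assms by (auto simp: weakly_branch_action_def weakly_branch_on_def)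
  have "rist T' (\<phi>' ` carrier G) a \<noteq> {\<one>\<^bsub>TreeAuto T'\<^esub>}" if a: "a \<in> verts T'" for a
  proof -
    obtain v where "v \<in> verts T" "a = e v" using a by (auto simp: verts_T')
    then show ?thesis using w(2) W.rist_trivial_iff[OF a] rist_trivial_iff Rist_T' by simp
  qed
  then show ?thesis
    using level_transitive_T'[OF w(1)] W.\<phi>_mon W.\<phi>.img_is_subgroup rooted_tree_T'
    by (simp add: weakly_branch_action_def weakly_branch_on_def)
qed

lemma branch_T':
  assumes "branch_action G T \<phi>"
  shows "branch_action G T' \<phi>'"
proof -
  interpret W: tree_action G T' \<phi>' by (rule tree_action')
  have lt: "level_transitive T (\<phi> ` carrier G)" and b: "branch_on T (\<phi> ` carrier G)"
    using assms by (auto simp: branch_action_def branch_on_def)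
  have "(\<Union>a\<in>level T' n. Rist G T' \<phi>' a) = (\<Union>v\<in>level T n. Rist G T \<phi> v)" for n
  proof -
    have "(\<Union>a\<in>level T' n. Rist G T' \<phi>' a) = (\<Union>v\<in>level T n. Rist G T' \<phi>' (e v))"
      by (simp add: level_T')
    also have "\<dots> = (\<Union>v\<in>level T n. Rist G T \<phi> v)"
      by (rule SUP_cong) (simp_all add: level_def Rist_T')
    finally show ?thesis .
  qed
  then have "branch_on T' (\<phi>' ` carrier G)"
    unfolding W.branch_on_iff
    using b level_transitive_T'[OF lt] unfolding branch_on_iff W.level_transitive_iff by simp
  then show ?thesis using W.\<phi>_mon rooted_tree_T' by (simp add: branch_action_def)
qed

end

text \<open>All levels are finite, so the vertices are countable. One relabelling serves both kinds
  of action, hence the two conditional conclusions.\<close>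

lemma relabel_nat:
  assumes "group G" "rooted_tree T" "\<phi> \<in> mon G (TreeAuto T)"
  obtains T' :: "nat rooted_graph" and \<phi>'
  where "weakly_branch_action G T \<phi> \<Longrightarrow> weakly_branch_action G T' \<phi>'"
    and "branch_action G T \<phi> \<Longrightarrow> branch_action G T' \<phi>'"
proof -
  interpret tree_action G T \<phi> using assms by (simp add: tree_action_iff)
  interpret relabelled_action G T \<phi> "to_nat_on (verts T)"
    by unfold_locales (rule inj_on_to_nat_on[OF countable_verts])
  show thesis using that[of T' \<phi>'] weakly_branch_T' branch_T' by blast
qed

lemma weakly_branch_groupI: "group G \<Longrightarrow> weakly_branch_action G T \<phi> \<Longrightarrow> weakly_branch_group G"
  using relabel_nat[of G T \<phi>] unfolding weakly_branch_group_def weakly_branch_action_def by metis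

lemma branch_groupI: "group G \<Longrightarrow> branch_action G T \<phi> \<Longrightarrow> branch_group G"
  using relabel_nat[of G T \<phi>] unfolding branch_group_def branch_action_def by metis

section \<open>Branch extensions\<close>

lemma (in tree_action) branch_imp_wb_action:
  assumes b: "branch_on T (\<phi> ` carrier G)" and inf: "infinite (carrier G)"
  shows "wb_action G T \<phi>"
proof -
  have tr: "\<exists>g\<in>carrier G. act g \<xi> n = \<eta> n" if "\<xi> \<in> boundary T" "\<eta> \<in> boundary T" for \<xi> \<eta> n
    using b that unfolding branch_on_iff by blast
  have "\<exists>g\<in>Rist G T \<phi> v. g \<noteq> \<one>" if v: "v \<in> verts T" for v
  proof (rule ccontr)
    assume *: "\<not> (\<exists>g\<in>Rist G T \<phi> v. g \<noteq> \<one>)"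
    define n where "n = depth T v"
    obtain x where x: "x \<in> boundary T" "x n = v" using ex_ray[OF v] by (auto simp: n_def)
    have Rx: "g = \<one>" if "g \<in> rist_ray n x" for g using * that rist_ray_eq[OF x(1), of n] x(2) by auto
    \<comment> \<open>Transitivity makes the rigid stabilizers of one level conjugate, so a single
      trivial one makes all of them trivial.\<close>
    have "rist_ray n y \<subseteq> {\<one>}" if y: "y \<in> boundary T" for y
    proof
      fix h assume h: "h \<in> rist_ray n y"
      have ch: "h \<in> carrier G" using h by (rule rist_ray_carrier)
      obtain g where g: "g \<in> carrier G" "act g y n = x n" using tr[OF y x(1)] by blast
      have "g \<otimes> h \<otimes> inv g \<in> rist_ray n x" using rist_ray_conj[OF g(1) y h] rist_ray_cong[of "act g y" n x] g(2) by simp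
      then have "g \<otimes> h \<otimes> inv g = \<one>" by (rule Rx)
      then have "g \<otimes> h = g" using g(1) ch by (metis inv_closed inv_equality inv_inv m_closed)
      then show "h \<in> {\<one>}" using g(1) ch by (simp add: r_cancel_one)
    qed
    then have "(\<Union>w\<in>level T n. Rist G T \<phi> w) \<subseteq> {\<one>}" unfolding level_eq using rist_ray_eq by auto
    then have "generate G (\<Union>w\<in>level T n. Rist G T \<phi> w) \<subseteq> {\<one>}"
      using mono_generate[of _ "{\<one>}"] generate_one by simp
    moreover have "finite (rcosets (generate G (\<Union>w\<in>level T n. Rist G T \<phi> w)))"
      using b unfolding branch_on_iff by blast
    ultimately have "finite_cover G {\<one>} (carrier G)"
      using finite_rcosets_iff_finite_cover[OF generate_is_subgroup[OF Rist_level_subset]] finite_cover_mono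
      by blast
    then obtain S where S: "finite S" "S \<subseteq> carrier G" "\<And>g. g \<in> carrier G \<Longrightarrow> \<exists>s\<in>S. g \<otimes> inv s = \<one>"
      by (auto simp: finite_cover_def)
    have "carrier G \<subseteq> S"
    proof
      fix g assume g: "g \<in> carrier G"
      then obtain s where s: "s \<in> S" "g \<otimes> inv s = \<one>" using S(3) by blast
      then have "g = s" using inv_equality[of g "inv s"] g S(2) by auto
      then show "g \<in> S" using s by simp
    qed
    then show False using S(1) inf finite_subset by blast
  qed
  then show ?thesis
    using tr tree_action_axioms by (simp add: wb_action_def wb_action_axioms_def)
qed

section \<open>Assembly of the equivalences and of the action on the hat tree\<close>

theorem theorem5p4:
  fixes G :: "('g, 'm) monoid_scheme" and \<Gamma> :: "('e, 'n) monoid_scheme"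
    and F :: "('f, 'k) monoid_scheme" and \<iota> :: "'g \<Rightarrow> 'e" and q :: "'e \<Rightarrow> 'f"
  assumes "finitely_generated G" and "weakly_branch_group G"
    and "group_extension G \<iota> \<Gamma> q F" and "finite (carrier F)"
  shows "let \<rho> = conj_auto G \<iota> \<Gamma>;
             \<mu> = monodromy G \<iota> \<Gamma> q;
             P = {\<alpha> \<in> carrier (AutoGroup G). out_class G \<alpha> \<in> \<mu> ` carrier F};
             AutP = AutoGroup G \<lparr>carrier := P\<rparr>
         in
           subgroup P (AutoGroup G) \<and>
           \<rho> \<in> epi \<Gamma> AutP \<and>
           q \<in> iso (\<Gamma> \<lparr>carrier := kernel \<Gamma> AutP \<rho>\<rparr>) (F \<lparr>carrier := kernel F (OutGroup G) \<mu>\<rparr>) \<and>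
           (inj_on \<mu> (carrier F) \<longleftrightarrow> \<rho> \<in> iso \<Gamma> AutP) \<and>
           (inj_on \<mu> (carrier F) \<longleftrightarrow> weakly_branch_group \<Gamma>) \<and>
           (branch_group G \<longrightarrow> (inj_on \<mu> (carrier F) \<longleftrightarrow> branch_group \<Gamma>)) \<and>
           (inj_on \<mu> (carrier F) \<longrightarrow>
             (\<forall>(T :: 'v rooted_graph) \<phi>. weakly_branch_action G T \<phi> \<longrightarrow>
               weakly_branch_action \<Gamma> (hat_tree G T \<phi>) (\<lambda>\<gamma>. hat_act G T \<phi> (\<rho> \<gamma>)) \<and>
               (branch_action G T \<phi> \<longleftrightarrow>
                branch_action \<Gamma> (hat_tree G T \<phi>) (\<lambda>\<gamma>. hat_act G T \<phi> (\<rho> \<gamma>)))))"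
proof -
  interpret E: group_extension G \<iota> \<Gamma> q F by (rule assms(3))
  obtain T0 :: "nat rooted_graph" and \<phi>0 where wba0: "weakly_branch_action G T0 \<phi>0"
    using assms(2) by (auto simp: weakly_branch_group_def)
  then have wb0: "wb_action G T0 \<phi>0" by (simp add: weakly_branch_action_iff[OF E.group_G])
  interpret W0: wb_action G T0 \<phi>0 by (rule wb0)
  interpret C: centerless_extension G \<iota> \<Gamma> q F
    by unfold_locales (rule W0.center_trivial)
  define \<rho> where "\<rho> = conj_auto G \<iota> \<Gamma>"
  define \<mu> where "\<mu> = monodromy G \<iota> \<Gamma> q"
  define P where "P = {\<alpha> \<in> carrier (AutoGroup G). out_class G \<alpha> \<in> \<mu> ` carrier F}"
  define AutP where "AutP = AutoGroup G \<lparr>carrier := P\<rparr>"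
  have P: "P = \<rho> ` carrier \<Gamma>"
    using E.out_class_range_iff E.\<rho>.hom_closed unfolding P_def \<rho>_def \<mu>_def by blast
  have subP: "subgroup P (AutoGroup G)"
    unfolding P \<rho>_def by (rule E.\<rho>.img_is_subgroup)
  have \<rho>_epi: "\<rho> \<in> epi \<Gamma> AutP"
    using E.\<rho>.homh unfolding epi_def hom_def AutP_def P \<rho>_def by auto
  have K\<rho>: "kernel \<Gamma> AutP \<rho> = {\<gamma> \<in> carrier \<Gamma>. E.\<rho> \<gamma> = \<one>\<^bsub>AutoGroup G\<^esub>}"
    by (simp add: kernel_def AutP_def \<rho>_def)
  have K\<mu>: "kernel F (OutGroup G) \<mu> = {f \<in> carrier F. E.\<mu> f = \<one>\<^bsub>OutGroup G\<^esub>}"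
    by (simp add: kernel_def \<mu>_def)
  \<comment> \<open>The natural isomorphism of the kernels is the restriction of q itself.\<close>
  have q_iso: "q \<in> iso (\<Gamma> \<lparr>carrier := kernel \<Gamma> AutP \<rho>\<rparr>) (F \<lparr>carrier := kernel F (OutGroup G) \<mu>\<rparr>)"
    unfolding K\<rho> K\<mu> iso_def hom_def using C.bij_kernels bij_betwE[OF C.bij_kernels] by auto
  have inj: "inj_on \<mu> (carrier F) \<longleftrightarrow> inj_on \<rho> (carrier \<Gamma>)"
    unfolding \<mu>_def \<rho>_def by (rule C.inj_\<mu>_iff)
  have \<rho>_iso: "inj_on \<mu> (carrier F) \<longleftrightarrow> \<rho> \<in> iso \<Gamma> AutP"
    using \<rho>_epi unfolding inj iso_def epi_def bij_betw_def by auto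
  \<comment> \<open>The vertex type is left general: the fact is applied both to trees on natural
    numbers and to the arbitrary trees of the conclusion.\<close>
  have hat_wb: "weakly_branch_action \<Gamma> (hat_tree G T \<phi>) (\<lambda>\<gamma>. hat_act G T \<phi> (\<rho> \<gamma>))"
    and hat_b: "branch_action G T \<phi> \<longleftrightarrow> branch_action \<Gamma> (hat_tree G T \<phi>) (\<lambda>\<gamma>. hat_act G T \<phi> (\<rho> \<gamma>))"
    if "inj_on \<mu> (carrier F)" "weakly_branch_action G T \<phi>" for T :: "'w rooted_graph" and \<phi>
    using ext_action_hat[OF assms(3,4,1) _ that(2)] that(1) unfolding inj unfolding \<rho>_def by auto
  have wb_inj: "inj_on \<mu> (carrier F)" if "wb_action \<Gamma> T \<psi>" for T :: "nat rooted_graph" and \<psi>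
    unfolding inj unfolding \<rho>_def by (rule E.wb_action_imp_inj[OF that assms(4)])
  have wb: "inj_on \<mu> (carrier F) \<longleftrightarrow> weakly_branch_group \<Gamma>"
  proof
    assume "inj_on \<mu> (carrier F)"
    then show "weakly_branch_group \<Gamma>"
      using hat_wb[OF _ wba0] weakly_branch_groupI[OF E.group_\<Gamma>] by blast
  next
    assume "weakly_branch_group \<Gamma>"
    then obtain T :: "nat rooted_graph" and \<psi> where "weakly_branch_action \<Gamma> T \<psi>"
      by (auto simp: weakly_branch_group_def)
    then show "inj_on \<mu> (carrier F)"
      by (intro wb_inj) (simp add: weakly_branch_action_iff[OF E.group_\<Gamma>])
  qed
  have b: "inj_on \<mu> (carrier F) \<longleftrightarrow> branch_group \<Gamma>" if bG: "branch_group G"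
  proof
    assume i: "inj_on \<mu> (carrier F)"
    \<comment> \<open>This tree may differ from T0. From T0 it is only taken that G is infinite,
      which makes the branch action on T weakly branch.\<close>
    obtain T :: "nat rooted_graph" and \<phi> where T: "branch_action G T \<phi>"
      using bG by (auto simp: branch_group_def)
    then interpret B: tree_action G T \<phi>
      using E.group_G by (simp add: tree_action_iff branch_action_def)
    have "wb_action G T \<phi>"
      using T W0.infinite_carrier by (intro B.branch_imp_wb_action) (simp_all add: branch_action_def)
    then have "weakly_branch_action G T \<phi>" by (simp add: weakly_branch_action_iff[OF E.group_G])
    then show "branch_group \<Gamma>"
      using hat_b[OF i] T branch_groupI[OF E.group_\<Gamma>] by blast
  next
    assume "branch_group \<Gamma>"
    then obtain T :: "nat rooted_graph" and \<psi> where T: "branch_action \<Gamma> T \<psi>"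
      by (auto simp: branch_group_def)
    then interpret B: tree_action \<Gamma> T \<psi>
      using E.group_\<Gamma> by (simp add: tree_action_iff branch_action_def)
    have "infinite (\<iota> ` carrier G)" using W0.infinite_carrier E.inj_\<iota> by (simp add: finite_image_iff)
    moreover have "\<iota> ` carrier G \<subseteq> carrier \<Gamma>" by auto
    ultimately have "infinite (carrier \<Gamma>)" using finite_subset by blast
    then have "wb_action \<Gamma> T \<psi>" using T by (intro B.branch_imp_wb_action) (simp_all add: branch_action_def)
    then show "inj_on \<mu> (carrier F)" by (rule wb_inj)
  qed
  show ?thesis
    unfolding Let_def
    using subP \<rho>_epi q_iso \<rho>_iso wb b hat_wb hat_b
    unfolding AutP_def P_def \<mu>_def \<rho>_def by blast
qed

end
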